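(* Let $s_1,\dots,s_n\in(0,1)$ and $p_1,\dots,p_n>1$ satisfy $\overline{sp}<n$ and $p_{\max}<p^{\ast}$. Then there exists a nonnegative minimizer $u\in\mathcal{D}^{\vec{s},\vec{p}}(\mathbb{R}^n)$ of $$S:=\inf_{u\in\mathcal{D}^{\vec{s},\vec{p}}(\mathbb{R}^n),\ \|u\|_{L^{p^{\ast}}(\mathbb{R}^n)}=1}\ \sum_{i=1}^n\frac1{p_i}\|D^{s_i}_{p_i}u\|_{L^{p_i}(\mathbb{R}^n)}^{p_i},$$ that is, there is $u\in\mathcal{D}^{\vec{s},\vec{p}}(\mathbb{R}^n)$ with $u\ge0$ a.e., $\|u\|_{L^{p^{\ast}}(\mathbb{R}^n)}=1$ and $\sum_{i=1}^n\frac1{p_i}\|D^{s_i}_{p_i}u\|_{L^{p_i}(\mathbb{R}^n)}^{p_i}=S$.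
   Context: Given $s_1,\dots,s_n\in(0,1)$ and $p_1,\dots,p_n>1$, define $$\bar{s}=\Big(\frac1n\sum_{i=1}^n\frac1{s_i}\Big)^{-1},\quad \overline{sp}=\Big(\frac1n\sum_{i=1}^n\frac1{s_ip_i}\Big)^{-1},\quad p^{\ast}=\frac{n\,\overline{sp}/\bar{s}}{n-\overline{sp}},\quad p_{\max}=\max\{p_1,\dots,p_n\}.$$ Let $e_i$ be the $i$-th standard unit vector of $\mathbb{R}^n$. For measurable $u:\mathbb{R}^n\to\mathbb{R}$ put $$|D^{s_i}_{p_i}u(x)|^{p_i}=s_i(1-s_i)\int_{\mathbb{R}}\frac{|u(x)-u(x+he_i)|^{p_i}}{|h|^{1+s_ip_i}}\,dh ,\qquad \|D^{s_i}_{p_i}u\|_{L^{p_i}(\mathbb{R}^n)}=\Big(\int_{\mathbb{R}^n}|D^{s_i}_{p_i}u(x)|^{p_i}\,dx\Big)^{1/p_i}.$$ The homogeneous anisotropic Sobolev space is $$\mathcal{D}^{\vec{s},\vec{p}}(\mathbb{R}^n)=\Big\{u\in L^{p^{\ast}}(\mathbb{R}^n):\ \sum_{i=1}^n\int_{\mathbb{R}^n}|D^{s_i}_{p_i}u(x)|^{p_i}\,dx<\infty\Big\}.$$ *)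

theory Defs
  imports "HOL-Analysis.Analysis"
begin

definition s_bar :: "('n::finite \<Rightarrow> real) \<Rightarrow> real" where
  "s_bar s = inverse (1 / real CARD('n) * (\<Sum>i\<in>UNIV. 1 / s i))"

definition sp_bar :: "('n::finite \<Rightarrow> real) \<Rightarrow> ('n \<Rightarrow> real) \<Rightarrow> real" where
  "sp_bar s p = inverse (1 / real CARD('n) * (\<Sum>i\<in>UNIV. 1 / (s i * p i)))"

definition p_star :: "('n::finite \<Rightarrow> real) \<Rightarrow> ('n \<Rightarrow> real) \<Rightarrow> real" where
  "p_star s p = (real CARD('n) * sp_bar s p / s_bar s) / (real CARD('n) - sp_bar s p)"

definition p_max :: "('n::finite \<Rightarrow> real) \<Rightarrow> real" where
  "p_max p = Max (range p)"

text \<open>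
  \<open>L\<^sup>q\<close> on Euclidean space is represented by Lebesgue measurable functions rather than by
  classes modulo null sets; everything below is invariant under changes on a null set.
\<close>

definition Lq_space :: "real \<Rightarrow> ('a::euclidean_space \<Rightarrow> real) set" where
  "Lq_space q = {u. u \<in> borel_measurable lebesgue \<and> integrable lebesgue (\<lambda>x. \<bar>u x\<bar> powr q)}"

definition Lq_norm :: "real \<Rightarrow> ('a::euclidean_space \<Rightarrow> real) \<Rightarrow> real" where
  "Lq_norm q u = (\<integral>x. \<bar>u x\<bar> powr q \<partial>lebesgue) powr (1 / q)"

text \<open>
  \<open>frac_D_pow i \<sigma> q u x\<close> is the \<open>q\<close>-th power of the pointwise fractional derivative of order
  \<open>\<sigma>\<close> in direction \<open>i\<close>, a value in \<open>[0, \<infinity>]\<close>.  At \<open>h = 0\<close> the quotient is \<open>0\<close> by convention.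
\<close>

definition frac_D_pow ::
  "'n::finite \<Rightarrow> real \<Rightarrow> real \<Rightarrow> (real^'n \<Rightarrow> real) \<Rightarrow> real^'n \<Rightarrow> ennreal" where
  "frac_D_pow i \<sigma> q u x =
     ennreal (\<sigma> * (1 - \<sigma>)) *
     (\<integral>\<^sup>+ h. ennreal (\<bar>u x - u (x + h *\<^sub>R axis i 1)\<bar> powr q / \<bar>h\<bar> powr (1 + \<sigma> * q)) \<partial>lebesgue)"

text \<open>
  Because of \<open>enn2real\<close>, this real number is the intended norm only if the integral is finite,
  as it is for all members of \<open>aniso_space\<close>.
\<close>

definition frac_D_norm ::
  "'n::finite \<Rightarrow> real \<Rightarrow> real \<Rightarrow> (real^'n \<Rightarrow> real) \<Rightarrow> real" where
  "frac_D_norm i \<sigma> q u = enn2real (\<integral>\<^sup>+ x. frac_D_pow i \<sigma> q u x \<partial>lebesgue) powr (1 / q)"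

definition aniso_space ::
  "('n::finite \<Rightarrow> real) \<Rightarrow> ('n \<Rightarrow> real) \<Rightarrow> (real^'n \<Rightarrow> real) set" where
  "aniso_space s p =
     {u \<in> Lq_space (p_star s p).
        (\<Sum>i\<in>UNIV. \<integral>\<^sup>+ x. frac_D_pow i (s i) (p i) u x \<partial>lebesgue) < \<infinity>}"

definition aniso_energy ::
  "('n::finite \<Rightarrow> real) \<Rightarrow> ('n \<Rightarrow> real) \<Rightarrow> (real^'n \<Rightarrow> real) \<Rightarrow> real" where
  "aniso_energy s p u = (\<Sum>i\<in>UNIV. 1 / p i * frac_D_norm i (s i) (p i) u powr p i)"

definition sobolev_const :: "('n::finite \<Rightarrow> real) \<Rightarrow> ('n \<Rightarrow> real) \<Rightarrow> real" where
  "sobolev_const s p =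
     (INF u\<in>{u \<in> aniso_space s p. Lq_norm (p_star s p) u = 1}. aniso_energy s p u)"

end

theory Submission
  imports Defs "HOL-Complex_Analysis.Great_Picard"
begin

text \<open>
  The proof follows Lieb's method of the missing mass.  Take a nonnegative minimizing sequence for the energy
  \<open>E\<close> on \<open>\<integral> \<bar>u\<bar>\<^sup>q = 1\<close>, \<open>q = p\<^sup>*\<close>.  Because \<open>p i < q\<close>, a layer-cake
  argument shows that a function of mass one and bounded energy cannot be small, relative to the height
  \<open>t\<close>, on half of every box of side lengths \<open>t\<close> to the power \<open>- b i\<close>, where
  \<open>b i = (q - p i) / (s i * p i)\<close>.  These boxes are permuted by the dilations under which
  mass and energy are invariant, so after translation and dilation the sequence stays bounded away from zero
  on a fixed cube.  Bounded energy also gives almost everywhere convergence of a subsequence to some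
  \<open>w \<noteq> 0\<close>.  By the Brezis--Lieb lemma mass and energy split asymptotically between
  \<open>w\<close> and \<open>u k - w\<close>, and since the infimum at mass \<open>m\<close> is \<open>S\<close> times \<open>m\<close> to a
  power in \<open>(0, 1)\<close>, a splitting with \<open>0 < m < 1\<close> would cost strictly more than \<open>S\<close>.
\<close>

section \<open>Lebesgue integrals on coordinate space\<close>

text \<open>The exponents are forced. The map \<open>u\<close> to
  \<open>t * u (t powr b i * x $ i)\<close> multiplies the mass by \<open>t\<close> to the power q -
  sum b, and the i-th seminorm by \<open>t\<close> to the power p i + s i * p i * b i - sum b.
  Invariance means sum b = q and s i * p i * b i = q - p i, and these equations are compatible
  exactly when q = \<open>p_star s p\<close>. The condition \<open>p_max p < q\<close> makes every
  \<open>b i\<close> positive: boxes shrink as the height grows, and the powers q - p i of the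
  threshold are positive. The main obstacle is that increments in different directions belong to
  different spaces L^(p i), so no single norm controls an oblique increment. The measure of the set
  of large increments does obey a triangle inequality, and Chebyshev's inequality then applies in
  each direction with its own exponent. This device serves both the lower bound on a cube and the
  compactness. No Sobolev inequality and no positivity of S is presupposed. The estimate that
  excludes vanishing also shows that a function of positive mass has positive energy, which gives S
  > 0 once the limit \<open>w\<close> is at hand.\<close>

lemma Basis_vec_range: "(Basis :: (real^'n::finite) set) = range (\<lambda>i. axis i 1)"
  by (auto simp: Basis_vec_def)

lemma inj_axis: "inj (\<lambda>i::'n::finite. axis i (1::real))"
  by (auto simp: inj_on_def axis_eq_axis)

lemma nn_integral_lborel_vec_prod:
  fixes f :: "'n::finite \<Rightarrow> real \<Rightarrow> ennreal"
  assumes [measurable]: "\<And>i. f i \<in> borel_measurable borel"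
  shows "(\<integral>\<^sup>+(x::real^'n). (\<Prod>i\<in>UNIV. f i (x$i)) \<partial>lborel) = (\<Prod>i\<in>UNIV. \<integral>\<^sup>+x. f i x \<partial>lborel)"
proof -
  \<comment> \<open>The library formula is indexed by basis vectors; \<open>inv\<close> recovers the
    coordinate from \<open>axis i 1\<close>.\<close>
  define g where "g b = f (inv (\<lambda>i. axis i (1::real)) b)" for b
  have g: "g (axis i 1) = f i" for i
    by (simp add: g_def inv_f_f[OF inj_axis])
  have "(\<integral>\<^sup>+(x::real^'n). (\<Prod>b\<in>Basis. g b (x \<bullet> b)) \<partial>lborel) = (\<Prod>b\<in>Basis. \<integral>\<^sup>+x. g b x \<partial>lborel)"
    by (rule nn_integral_lborel_prod) (auto simp: Basis_vec_range g)
  then show ?thesis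
    by (simp add: Basis_vec_range prod.reindex inj_axis g inner_axis)
qed

lemma nn_integral_lborel_vec_affine:
  fixes f :: "real^'n::finite \<Rightarrow> ennreal"
  assumes [measurable]: "f \<in> borel_measurable borel" and c: "\<And>i. c i \<noteq> 0"
  shows "(\<integral>\<^sup>+x. f x \<partial>lborel) =
    ennreal (\<Prod>i\<in>UNIV. \<bar>c i\<bar>) * (\<integral>\<^sup>+x. f (t + (\<chi> i. c i * x $ i)) \<partial>lborel)"
proof -
  define d where "d b = c (inv (\<lambda>i. axis i (1::real)) b)" for b
  have d: "d (axis i 1) = c i" for i
    by (simp add: d_def inv_f_f[OF inj_axis])
  have s: "(\<Sum>j\<in>Basis. (d j * (x \<bullet> j)) *\<^sub>R j) = (\<chi> i. c i * x $ i)" for x :: "real^'n"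
  proof -
    have "(\<Sum>j\<in>Basis. (d j * (x \<bullet> j)) *\<^sub>R j) = (\<Sum>i\<in>UNIV. (c i * x $ i) *\<^sub>R axis i 1)"
      by (simp add: Basis_vec_range sum.reindex[OF inj_axis] d inner_axis)
    also have "\<dots> = (\<chi> i. c i * x $ i)"
      by (simp add: vec_eq_iff sum_component axis_def if_distrib[of "\<lambda>z. _ * z"] cong: if_cong)
    finally show ?thesis .
  qed
  have m[measurable]: "(\<lambda>x::real^'n. t + (\<chi> i. c i * x $ i)) \<in> borel_measurable borel"
    unfolding s[symmetric] by simp
  have "lborel = density (distr lborel borel (\<lambda>x. t + (\<Sum>j\<in>Basis. (d j * (x \<bullet> j)) *\<^sub>R j)))
      (\<lambda>_. (\<Prod>j\<in>Basis. \<bar>d j\<bar>))"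
    by (rule lborel_affine_euclidean) (auto simp: Basis_vec_range d c)
  then have L: "lborel = density (distr lborel borel (\<lambda>x::real^'n. t + (\<chi> i. c i * x $ i)))
      (\<lambda>_. (\<Prod>i\<in>UNIV. \<bar>c i\<bar>))"
    by (simp add: s) (simp add: Basis_vec_range prod.reindex inj_axis d)
  show ?thesis
    by (subst L) (simp add: nn_integral_density nn_integral_distr nn_integral_cmult)
qed

lemma nn_integral_lborel_translate:
  fixes f :: "'a::euclidean_space \<Rightarrow> ennreal"
  assumes [measurable]: "f \<in> borel_measurable borel"
  shows "(\<integral>\<^sup>+x. f (x + t) \<partial>lborel) = (\<integral>\<^sup>+x. f x \<partial>lborel)"
proof -
  have "(\<integral>\<^sup>+x. f x \<partial>lborel) = (\<integral>\<^sup>+x. f x \<partial>(distr lborel borel ((+) t)))"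
    by (simp add: lborel_distr_plus)
  also have "\<dots> = (\<integral>\<^sup>+x. f (x + t) \<partial>lborel)"
    by (simp add: nn_integral_distr add.commute)
  finally show ?thesis by simp
qed

lemma AE_lborel_translate:
  fixes t :: "'a::euclidean_space"
  assumes "AE x in lborel. P x"
  shows "AE x in lborel. P (x + t)"
proof -
  have "AE x in distr lborel borel ((+) t). P x"
    using assms unfolding lborel_distr_plus .
  then have "AE x in lborel. P (t + x)"
    by (rule AE_distrD[rotated]) simp
  then show ?thesis by (simp add: add.commute)
qed

text \<open>For each fixed step the exceptional set in x is a null set together with one of its
  translates; Fubini then makes it null in the product. This carries changes of representative and
  almost everywhere convergence over to difference quotients.\<close>

lemma AE_lborel_pair_translate:
  fixes e :: "'a::euclidean_space"
  assumes "AE x in lborel. P x"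
  shows "AE z in lborel \<Otimes>\<^sub>M lborel. P (fst z) \<and> P (fst z + snd z *\<^sub>R e)"
proof -
  \<comment> \<open>The exceptional set need not be measurable, so it is enlarged to a Borel null
    set before Fubini is used.\<close>
  obtain N where N: "N \<in> null_sets lborel" "{x. \<not> P x} \<subseteq> N"
    using assms by (auto elim!: AE_E simp: null_sets_def)
  have [measurable]: "N \<in> sets borel" using N by auto
  have out: "AE x in lborel. x \<notin> N" using N(1) by (rule AE_not_in)
  have S: "{z \<in> space (lborel \<Otimes>\<^sub>M lborel). fst z \<notin> N \<and> fst z + snd z *\<^sub>R e \<notin> N} \<in> sets (lborel \<Otimes>\<^sub>M lborel)"
    by measurable
  \<comment> \<open>Translation invariance works with the step fixed, whereas the product measure
    has the step as inner variable; hence the exchange of quantifiers that follows.\<close>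
  have "AE h in lborel. AE x in lborel. x \<notin> N \<and> x + h *\<^sub>R e \<notin> N"
    by (intro AE_I2 AE_conjI out AE_lborel_translate[OF out])
  then have "AE x in lborel. AE h in lborel. x \<notin> N \<and> x + h *\<^sub>R e \<notin> N"
    by (subst lborel_pair.AE_commute) (use S in simp_all)
  then have "AE z in lborel \<Otimes>\<^sub>M lborel. fst z \<notin> N \<and> fst z + snd z *\<^sub>R e \<notin> N"
    by (intro lborel_pair.AE_pair_measure) (use S in simp_all)
  then show ?thesis by eventually_elim (use N(2) in auto)
qed

section \<open>Directional Gagliardo seminorms\<close>

definition diff_pow :: "'n::finite \<Rightarrow> real \<Rightarrow> (real^'n \<Rightarrow> real) \<Rightarrow> real \<Rightarrow> ennreal" where
  "diff_pow i q u h = (\<integral>\<^sup>+x. ennreal (\<bar>u x - u (x + h *\<^sub>R axis i 1)\<bar> powr q) \<partial>lborel)"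

text \<open>The step is the outer variable, so translations and dilations act on
  \<open>diff_pow\<close> alone. The factor \<open>\<sigma> * (1 - \<sigma>)\<close> is left out
  here and reappears in \<open>weight\<close>.\<close>

definition gagliardo :: "'n::finite \<Rightarrow> real \<Rightarrow> real \<Rightarrow> (real^'n \<Rightarrow> real) \<Rightarrow> ennreal" where
  "gagliardo i \<sigma> q u = (\<integral>\<^sup>+h. diff_pow i q u h * ennreal (\<bar>h\<bar> powr - (1 + \<sigma> * q)) \<partial>lborel)"

definition mass :: "real \<Rightarrow> ('a::euclidean_space \<Rightarrow> real) \<Rightarrow> ennreal" where
  "mass q u = (\<integral>\<^sup>+x. ennreal (\<bar>u x\<bar> powr q) \<partial>lborel)"

lemma measurable_diff_pow[measurable]:
  assumes [measurable]: "u \<in> borel_measurable borel"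
  shows "diff_pow i q u \<in> borel_measurable borel"
  unfolding diff_pow_def by measurable

lemma mass_cong_AE:
  assumes "AE x in lborel. u x = v x"
  shows "mass q u = mass q v"
  unfolding mass_def by (rule nn_integral_cong_AE) (use assms in eventually_elim, simp)

lemma gagliardo_mono:
  assumes "0 < q" "\<And>x y. \<bar>u x - u y\<bar> \<le> \<bar>v x - v y\<bar>"
  shows "gagliardo i \<sigma> q u \<le> gagliardo i \<sigma> q v"
  unfolding gagliardo_def diff_pow_def
  by (intro nn_integral_mono mult_right_mono ennreal_leI powr_mono2) (use assms in auto)

lemma gagliardo_abs: "0 < q \<Longrightarrow> gagliardo i \<sigma> q (\<lambda>x. \<bar>u x\<bar>) \<le> gagliardo i \<sigma> q u"
  by (rule gagliardo_mono) auto

lemma mass_abs[simp]: "mass q (\<lambda>x. \<bar>u x\<bar>) = mass q u"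
  by (simp add: mass_def)

lemma gagliardo_eq_pair:
  assumes [measurable]: "u \<in> borel_measurable borel"
  shows "gagliardo i \<sigma> q u = (\<integral>\<^sup>+z. ennreal (\<bar>u (fst z) - u (fst z + snd z *\<^sub>R axis i 1)\<bar> powr q
      * \<bar>snd z\<bar> powr - (1 + \<sigma> * q)) \<partial>(lborel \<Otimes>\<^sub>M lborel))"
proof -
  have "(\<integral>\<^sup>+z. ennreal (\<bar>u (fst z) - u (fst z + snd z *\<^sub>R axis i 1)\<bar> powr q
      * \<bar>snd z\<bar> powr - (1 + \<sigma> * q)) \<partial>(lborel \<Otimes>\<^sub>M lborel)) =
    (\<integral>\<^sup>+h. \<integral>\<^sup>+x. ennreal (\<bar>u x - u (x + h *\<^sub>R axis i 1)\<bar> powr q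
      * \<bar>h\<bar> powr - (1 + \<sigma> * q)) \<partial>lborel \<partial>lborel)"
    by (subst lborel_pair.nn_integral_snd[symmetric]) simp_all
  also have "\<dots> = gagliardo i \<sigma> q u"
    unfolding gagliardo_def diff_pow_def
    by (simp add: nn_integral_multc ennreal_mult')
  finally show ?thesis by simp
qed

text \<open>For almost every x the line through x in direction i meets the set where
  \<open>u\<close> and \<open>v\<close> differ in a null set. Hence the inner integrals agree, and
  Tonelli applies to the Borel function \<open>v\<close>. This is the bridge from Lebesgue
  measurable functions to Borel ones.\<close>

lemma nn_integral_frac_D_pow:
  fixes u :: "real^'n::finite \<Rightarrow> real"
  assumes v[measurable]: "v \<in> borel_measurable borel" and ae: "AE x in lborel. u x = v x"
  shows "(\<integral>\<^sup>+ x. frac_D_pow i \<sigma> q u x \<partial>lebesgue) = ennreal (\<sigma> * (1 - \<sigma>)) * gagliardo i \<sigma> q v"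
proof -
  have "AE x in lborel. AE h in lborel. u (x + h *\<^sub>R axis i 1) = v (x + h *\<^sub>R axis i 1)"
    using lborel_pair.AE_pair[OF AE_lborel_pair_translate[OF ae, of "axis i 1"]] by (rule AE_mp) simp
  then have E: "AE x in lborel. frac_D_pow i \<sigma> q u x = ennreal (\<sigma> * (1 - \<sigma>)) *
     (\<integral>\<^sup>+ h. ennreal (\<bar>v x - v (x + h *\<^sub>R axis i 1)\<bar> powr q * \<bar>h\<bar> powr - (1 + \<sigma> * q)) \<partial>lborel)"
    using ae
  proof eventually_elim
    case (elim x)
    have "(\<integral>\<^sup>+ h. ennreal (\<bar>u x - u (x + h *\<^sub>R axis i 1)\<bar> powr q / \<bar>h\<bar> powr (1 + \<sigma> * q)) \<partial>lebesgue)
      = (\<integral>\<^sup>+ h. ennreal (\<bar>v x - v (x + h *\<^sub>R axis i 1)\<bar> powr q * \<bar>h\<bar> powr - (1 + \<sigma> * q)) \<partial>lborel)"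
      unfolding nn_integral_completion
    proof (rule nn_integral_cong_AE, use elim(1) in eventually_elim)
      case h: (elim h)
      then show ?case using elim(2) powr_minus[of "\<bar>h\<bar>" "1 + \<sigma> * q"] by (simp add: divide_inverse)
    qed
    then show ?case by (simp add: frac_D_pow_def)
  qed
  have "(\<integral>\<^sup>+ x. frac_D_pow i \<sigma> q u x \<partial>lebesgue) = (\<integral>\<^sup>+ x. ennreal (\<sigma> * (1 - \<sigma>)) *
     (\<integral>\<^sup>+ h. ennreal (\<bar>v x - v (x + h *\<^sub>R axis i 1)\<bar> powr q * \<bar>h\<bar> powr - (1 + \<sigma> * q)) \<partial>lborel) \<partial>lborel)"
    unfolding nn_integral_completion by (rule nn_integral_cong_AE[OF E])
  also have "\<dots> = ennreal (\<sigma> * (1 - \<sigma>)) * gagliardo i \<sigma> q v"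
    by (subst nn_integral_cmult)
      (simp_all add: gagliardo_eq_pair lborel.nn_integral_fst[symmetric])
  finally show ?thesis .
qed

section \<open>Translations and anisotropic dilations\<close>

lemma measurable_vec_affine[measurable]:
  "(\<lambda>x::real^'n::finite. t + (\<chi> i. c i * x $ i)) \<in> borel_measurable borel"
  by (intro borel_measurable_continuous_onI continuous_intros)

lemma mass_scale:
  fixes u :: "real^'n::finite \<Rightarrow> real"
  assumes [measurable]: "u \<in> borel_measurable borel" and l: "\<And>i. 0 < l i" and a: "0 < a"
  shows "mass q (\<lambda>x. a * u (y + (\<chi> i. l i * x $ i))) = ennreal (a powr q / (\<Prod>i\<in>UNIV. l i)) * mass q u"
proof -
  have P: "0 < (\<Prod>i\<in>UNIV. l i)" using l by (simp add: prod_pos)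
  have l': "l i \<noteq> 0" "\<bar>l i\<bar> = l i" for i using l[of i] by auto
  define I where "I = (\<integral>\<^sup>+x. ennreal (\<bar>u (y + (\<chi> i. l i * x $ i))\<bar> powr q) \<partial>lborel)"
  have "mass q u = ennreal (\<Prod>i\<in>UNIV. \<bar>l i\<bar>) * I"
    unfolding mass_def I_def by (intro nn_integral_lborel_vec_affine) (auto simp: l')
  then have "ennreal (a powr q / (\<Prod>i\<in>UNIV. l i)) * mass q u = ennreal (a powr q / (\<Prod>i\<in>UNIV. l i)) * ennreal (\<Prod>i\<in>UNIV. l i) * I"
    by (simp add: l' mult.assoc)
  also have "\<dots> = ennreal (a powr q) * I"
    using P by (subst ennreal_mult[symmetric]) (auto simp: l')
  also have "\<dots> = mass q (\<lambda>x. a * u (y + (\<chi> i. l i * x $ i)))"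
    unfolding mass_def I_def
    by (subst nn_integral_cmult[symmetric]) (use a in \<open>auto simp: abs_mult powr_mult ennreal_mult\<close>)
  finally show ?thesis by simp
qed

lemma diff_pow_scale:
  fixes u :: "real^'n::finite \<Rightarrow> real"
  assumes [measurable]: "u \<in> borel_measurable borel" and l: "\<And>i. 0 < l i" and a: "0 < a"
  shows "diff_pow i q (\<lambda>x. a * u (y + (\<chi> i. l i * x $ i))) h =
    ennreal (a powr q / (\<Prod>i\<in>UNIV. l i)) * diff_pow i q u (l i * h)"
proof -
  have e: "y + (\<chi> j. l j * (x + h *\<^sub>R axis i 1) $ j) = (y + (\<chi> j. l j * x $ j)) + (l i * h) *\<^sub>R axis i 1" for x
    by (simp add: vec_eq_iff axis_def algebra_simps)
  have "diff_pow i q u (l i * h) = mass q (\<lambda>x. u x - u (x + (l i * h) *\<^sub>R axis i 1))"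
    by (simp add: diff_pow_def mass_def)
  then have "ennreal (a powr q / (\<Prod>i\<in>UNIV. l i)) * diff_pow i q u (l i * h) =
     mass q (\<lambda>x. a * (\<lambda>x. u x - u (x + (l i * h) *\<^sub>R axis i 1)) (y + (\<chi> i. l i * x $ i)))"
    by (subst mass_scale) (use l a in auto)
  also have "\<dots> = diff_pow i q (\<lambda>x. a * u (y + (\<chi> i. l i * x $ i))) h"
    unfolding diff_pow_def mass_def e by (simp add: right_diff_distrib)
  finally show ?thesis by simp
qed

text \<open>The Jacobian in x gives the product in the denominator; substituting
  \<open>l i * h\<close> in the kernel gives the power \<open>\<sigma> * q\<close> of
  \<open>l i\<close>.\<close>

lemma gagliardo_scale:
  fixes u :: "real^'n::finite \<Rightarrow> real"
  assumes [measurable]: "u \<in> borel_measurable borel" and l: "\<And>i. 0 < l i" and a: "0 < a"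
  shows "gagliardo i \<sigma> q (\<lambda>x. a * u (y + (\<chi> i. l i * x $ i))) =
    ennreal (a powr q * l i powr (\<sigma> * q) / (\<Prod>i\<in>UNIV. l i)) * gagliardo i \<sigma> q u"
proof -
  have P: "0 < (\<Prod>i\<in>UNIV. l i)" using l by (simp add: prod_pos)
  let ?A = "ennreal (a powr q / (\<Prod>i\<in>UNIV. l i))"
  define I where "I = (\<integral>\<^sup>+h. diff_pow i q u (0 + l i * h) * ennreal (\<bar>h\<bar> powr - (1 + \<sigma> * q)) \<partial>lborel)"
  have w: "\<bar>0 + l i * h\<bar> powr - (1 + \<sigma> * q) = l i powr - (1 + \<sigma> * q) * \<bar>h\<bar> powr - (1 + \<sigma> * q)" for h
    using l[of i] by (simp add: abs_mult powr_mult)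
  have "gagliardo i \<sigma> q u = ennreal \<bar>l i\<bar> * (\<integral>\<^sup>+h. diff_pow i q u (0 + l i * h) * ennreal (\<bar>0 + l i * h\<bar> powr - (1 + \<sigma> * q)) \<partial>lborel)"
    unfolding gagliardo_def by (rule nn_integral_real_affine) (use l[of i] in auto)
  also have "(\<integral>\<^sup>+h. diff_pow i q u (0 + l i * h) * ennreal (\<bar>0 + l i * h\<bar> powr - (1 + \<sigma> * q)) \<partial>lborel) =
     (\<integral>\<^sup>+h. ennreal (l i powr - (1 + \<sigma> * q)) * (diff_pow i q u (0 + l i * h) * ennreal (\<bar>h\<bar> powr - (1 + \<sigma> * q))) \<partial>lborel)"
    unfolding w by (simp add: ennreal_mult mult_ac)
  also have "\<dots> = ennreal (l i powr - (1 + \<sigma> * q)) * I"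
    unfolding I_def by (subst nn_integral_cmult) auto
  finally have G: "gagliardo i \<sigma> q u = ennreal (l i * l i powr - (1 + \<sigma> * q)) * I"
    using l[of i] by (simp add: ennreal_mult mult.assoc)
  have "l i * l i powr - (1 + \<sigma> * q) = l i powr 1 * l i powr - (1 + \<sigma> * q)"
    using l[of i] by simp
  then have c: "l i * l i powr - (1 + \<sigma> * q) = l i powr - (\<sigma> * q)"
    unfolding powr_add[symmetric] by simp
  have "a powr q * l i powr (\<sigma> * q) / (\<Prod>i\<in>UNIV. l i) * l i powr - (\<sigma> * q) = a powr q / (\<Prod>i\<in>UNIV. l i)"
    using l[of i] by (simp add: powr_minus)
  then have "ennreal (a powr q * l i powr (\<sigma> * q) / (\<Prod>i\<in>UNIV. l i)) * gagliardo i \<sigma> q u = ?A * I"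
    unfolding G c mult.assoc[symmetric] using P
    by (subst ennreal_mult[symmetric]) (simp_all del: times_divide_eq_left)
  also have "\<dots> = gagliardo i \<sigma> q (\<lambda>x. a * u (y + (\<chi> i. l i * x $ i)))"
    unfolding gagliardo_def I_def using diff_pow_scale[OF assms]
    by (subst nn_integral_cmult[symmetric]) (auto simp: mult.assoc)
  finally show ?thesis by simp
qed

section \<open>Distribution of increments\<close>

lemma measurable_vec_lambda[measurable (raw)]:
  fixes f :: "'n::finite \<Rightarrow> 'a \<Rightarrow> real"
  assumes "\<And>i. f i \<in> borel_measurable M"
  shows "(\<lambda>x. \<chi> i. f i x) \<in> borel_measurable M"
  by (subst borel_measurable_euclidean_space) (auto simp: Basis_vec_range inner_axis assms)

lemma measurable_vec_nth[measurable (raw)]: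
  fixes f :: "'a \<Rightarrow> real^'n::finite"
  assumes "f \<in> borel_measurable M"
  shows "(\<lambda>x. f x $ i) \<in> borel_measurable M"
proof -
  have "(\<lambda>x. f x \<bullet> axis i 1) \<in> borel_measurable M" using assms by measurable
  then show ?thesis by (simp add: inner_axis)
qed

text \<open>The distribution function of an increment. It is a quantity common to all directions
  although the integrability exponents differ.\<close>

definition dev :: "('a::euclidean_space \<Rightarrow> real) \<Rightarrow> real \<Rightarrow> 'a \<Rightarrow> ennreal" where
  "dev u c h = emeasure lborel {x. c < \<bar>u x - u (x + h)\<bar>}"

lemma dev_eq_nn_integral:
  assumes [measurable]: "u \<in> borel_measurable borel"
  shows "dev u c h = (\<integral>\<^sup>+x. indicator {x. c < \<bar>u x - u (x + h)\<bar>} x \<partial>lborel)"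
  unfolding dev_def by simp

text \<open>A total change above \<open>c + d\<close> along the path x, x + h, x + h + k forces a
  change above \<open>c\<close> on the first leg or above \<open>d\<close> on the second; the second
  leg is moved back by translation invariance.\<close>

lemma dev_add:
  assumes [measurable]: "u \<in> borel_measurable borel"
  shows "dev u (c + d) (h + k) \<le> dev u c h + dev u d k"
proof -
  have tr: "emeasure lborel {x. d < \<bar>u (x + h) - u (x + h + k)\<bar>} = dev u d k"
  proof -
    have "(\<integral>\<^sup>+x. indicator {x. d < \<bar>u x - u (x + k)\<bar>} (x + h) \<partial>lborel) = dev u d k"
      unfolding dev_eq_nn_integral[OF assms] by (rule nn_integral_lborel_translate) measurable
    moreover have "(\<lambda>x. indicator {x. d < \<bar>u x - u (x + k)\<bar>} (x + h) :: ennreal)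
        = indicator {x. d < \<bar>u (x + h) - u (x + h + k)\<bar>}"
      by (auto simp: fun_eq_iff indicator_def)
    ultimately show ?thesis by simp
  qed
  have "dev u (c + d) (h + k) \<le> emeasure lborel ({x. c < \<bar>u x - u (x + h)\<bar>} \<union> {x. d < \<bar>u (x + h) - u (x + h + k)\<bar>})"
    unfolding dev_def by (rule emeasure_mono) (auto simp: add.assoc)
  also have "\<dots> \<le> dev u c h + dev u d k"
    unfolding tr[symmetric] unfolding dev_def by (rule emeasure_subadditive) measurable
  finally show ?thesis .
qed

lemma dev_sum:
  fixes u :: "real^'n::finite \<Rightarrow> real"
  assumes [measurable]: "u \<in> borel_measurable borel"
  shows "dev u (real CARD('n) * c) (\<chi> i. h i) \<le> (\<Sum>i\<in>UNIV. dev u c (h i *\<^sub>R axis i 1))"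
proof -
  have "dev u (real (card I) * c) (\<Sum>i\<in>I. h i *\<^sub>R axis i 1) \<le> (\<Sum>i\<in>I. dev u c (h i *\<^sub>R axis i 1))"
    if "finite I" for I :: "'n set"
    using that
  proof induction
    case empty
    then show ?case by (simp add: dev_def)
  next
    case (insert i I)
    have "dev u (c + real (card I) * c) (h i *\<^sub>R axis i 1 + (\<Sum>i\<in>I. h i *\<^sub>R axis i 1)) \<le>
      dev u c (h i *\<^sub>R axis i 1) + dev u (real (card I) * c) (\<Sum>i\<in>I. h i *\<^sub>R axis i 1)"
      by (rule dev_add) measurable
    also have "\<dots> \<le> dev u c (h i *\<^sub>R axis i 1) + (\<Sum>i\<in>I. dev u c (h i *\<^sub>R axis i 1))"
      by (intro add_left_mono insert)
    finally show ?case using insert by (simp add: algebra_simps)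
  qed
  from this[of UNIV] show ?thesis
    by (simp add: basis_expansion[of "\<chi> i. h i", simplified scalar_mult_eq_scaleR, simplified])
qed

text \<open>Chebyshev's inequality. It is applied after an oblique step has been split, so that each
  direction can use its own exponent.\<close>

lemma dev_le_diff_pow:
  assumes [measurable]: "u \<in> borel_measurable borel" and "0 < c" "0 < q"
  shows "dev u c (h *\<^sub>R axis i 1) \<le> ennreal (c powr - q) * diff_pow i q u h"
proof -
  have "dev u c (h *\<^sub>R axis i 1) \<le> (\<integral>\<^sup>+x. ennreal (c powr - q) * ennreal (\<bar>u x - u (x + h *\<^sub>R axis i 1)\<bar> powr q) \<partial>lborel)"
    unfolding dev_eq_nn_integral[OF assms(1)]
  proof (rule nn_integral_mono)
    fix x
    have "1 \<le> c powr - q * \<bar>u x - u (x + h *\<^sub>R axis i 1)\<bar> powr q" if "c < \<bar>u x - u (x + h *\<^sub>R axis i 1)\<bar>"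
    proof -
      have "c powr q \<le> \<bar>u x - u (x + h *\<^sub>R axis i 1)\<bar> powr q"
        using that assms by (intro powr_mono2) auto
      then show ?thesis using assms by (simp add: powr_minus field_simps)
    qed
    then show "indicator {x. c < \<bar>u x - u (x + h *\<^sub>R axis i 1)\<bar>} x \<le>
      ennreal (c powr - q) * ennreal (\<bar>u x - u (x + h *\<^sub>R axis i 1)\<bar> powr q)"
      by (auto simp: indicator_def ennreal_mult[symmetric] simp flip: ennreal_1)
  qed
  also have "\<dots> = ennreal (c powr - q) * diff_pow i q u h"
    unfolding diff_pow_def by (rule nn_integral_cmult) measurable
  finally show ?thesis .
qed

section \<open>Increments averaged over boxes\<close>

definition cube :: "(real^'n::finite) set" where
  "cube = {x. \<forall>i. \<bar>x $ i\<bar> \<le> 1}"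

lemma sets_cube[measurable]: "cube \<in> sets borel"
  unfolding cube_def by measurable

lemma indicator_cube: "indicator cube x = (\<Prod>i\<in>UNIV. indicator {-1..1} (x $ i) :: ennreal)"
proof (cases "x \<in> cube")
  case True
  then show ?thesis by (auto simp: cube_def indicator_def abs_le_iff minus_le_iff intro!: prod.neutral[symmetric])
next
  case False
  then obtain i where "1 < \<bar>x $ i\<bar>" by (auto simp: cube_def not_le)
  then have "indicator {-1..1} (x $ i) = (0::ennreal)" by (auto simp: indicator_def)
  then have "(\<Prod>i\<in>UNIV. indicator {-1..1} (x $ i)) = (0::ennreal)" by (intro prod_zero) auto
  then show ?thesis using False by simp
qed

lemma nn_integral_cube_coordinate:
  fixes i :: "'n::finite"
  assumes [measurable]: "f \<in> borel_measurable borel"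
  shows "(\<integral>\<^sup>+(x::real^'n). f (x $ i) * indicator cube x \<partial>lborel) =
    2 ^ (CARD('n) - 1) * (\<integral>\<^sup>+r. f r * indicator {-1..1} r \<partial>lborel)"
proof -
  define g where "g j r = (if j = i then f r else 1) * indicator {-1..1} r" for j :: 'n and r
  have [measurable]: "g j \<in> borel_measurable borel" for j
    unfolding g_def by (cases "j = i") simp_all
  have s: "f (x $ i) * indicator cube x = (\<Prod>j\<in>UNIV. g j (x $ j))" for x :: "real^'n"
    unfolding g_def indicator_cube by (simp add: prod.distrib)
  have "(\<integral>\<^sup>+(x::real^'n). f (x $ i) * indicator cube x \<partial>lborel) = (\<Prod>j\<in>UNIV. \<integral>\<^sup>+r. g j r \<partial>lborel)"
    unfolding s by (rule nn_integral_lborel_vec_prod) measurable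
  also have "\<dots> = (\<integral>\<^sup>+r. g i r \<partial>lborel) * (\<Prod>j\<in>UNIV - {i}. \<integral>\<^sup>+r. g j r \<partial>lborel)"
    by (rule prod.remove) auto
  also have "(\<Prod>j\<in>UNIV - {i}. \<integral>\<^sup>+r. g j r \<partial>lborel) = (\<Prod>j\<in>UNIV - {i}. 2)"
    by (rule prod.cong) (auto simp: g_def)
  finally show ?thesis by (simp add: g_def mult.commute card_Diff_singleton)
qed

lemma emeasure_cube: "emeasure lborel (cube :: (real^'n::finite) set) = 2 ^ CARD('n)"
proof -
  have "emeasure lborel (cube :: (real^'n::finite) set) = (\<integral>\<^sup>+(x::real^'n). 1 * indicator cube x \<partial>lborel)"
    by simp
  also have "\<dots> = 2 ^ (CARD('n) - 1) * (\<integral>\<^sup>+(r::real). 1 * indicator {-1..1} r \<partial>lborel)"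
    by (rule nn_integral_cube_coordinate[of "\<lambda>_. 1"]) simp
  also have "\<dots> = 2 ^ CARD('n)"
    by (simp flip: power_Suc2)
  finally show ?thesis .
qed

text \<open>A box step is walked along the coordinate axes, each of the n legs being allowed the
  share \<open>c\<close> of the threshold. Every leg depends on one coordinate of \<open>y\<close>,
  so the remaining coordinates contribute the factor \<open>2 ^ (CARD('n) - 1)\<close>.\<close>

lemma nn_integral_dev_cube:
  fixes u :: "real^'n::finite \<Rightarrow> real"
  assumes [measurable]: "u \<in> borel_measurable borel" and "0 < c" "\<And>i. 0 < p i"
  shows "(\<integral>\<^sup>+y. dev u (real CARD('n) * c) (\<chi> i. l i * y $ i) * indicator cube y \<partial>lborel)
   \<le> (\<Sum>i\<in>UNIV. ennreal (2 ^ (CARD('n) - 1) * c powr - p i) *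
        (\<integral>\<^sup>+r. diff_pow i (p i) u (l i * r) * indicator {-1..1} r \<partial>lborel))"
proof -
  have "(\<integral>\<^sup>+y. dev u (real CARD('n) * c) (\<chi> i. l i * y $ i) * indicator cube y \<partial>lborel) \<le>
    (\<integral>\<^sup>+y. (\<Sum>i\<in>UNIV. ennreal (c powr - p i) * (diff_pow i (p i) u (l i * y $ i) * indicator cube y)) \<partial>lborel)"
  proof (rule nn_integral_mono)
    fix y :: "real^'n"
    have "dev u (real CARD('n) * c) (\<chi> i. l i * y $ i) \<le> (\<Sum>i\<in>UNIV. dev u c ((l i * y $ i) *\<^sub>R axis i 1))"
      by (rule dev_sum) measurable
    also have "\<dots> \<le> (\<Sum>i\<in>UNIV. ennreal (c powr - p i) * diff_pow i (p i) u (l i * y $ i))"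
      by (intro sum_mono dev_le_diff_pow assms)
    finally have "dev u (real CARD('n) * c) (\<chi> i. l i * y $ i) * indicator cube y
      \<le> (\<Sum>i\<in>UNIV. ennreal (c powr - p i) * diff_pow i (p i) u (l i * y $ i)) * indicator cube y"
      by (rule mult_right_mono) simp
    then show "dev u (real CARD('n) * c) (\<chi> i. l i * y $ i) * indicator cube y
      \<le> (\<Sum>i\<in>UNIV. ennreal (c powr - p i) * (diff_pow i (p i) u (l i * y $ i) * indicator cube y))"
      by (simp add: sum_distrib_right mult.assoc)
  qed
  also have "\<dots> = (\<Sum>i\<in>UNIV. ennreal (c powr - p i) * (\<integral>\<^sup>+y. diff_pow i (p i) u (l i * y $ i) * indicator cube y \<partial>lborel))"
    by (subst nn_integral_sum) (auto intro!: sum.cong nn_integral_cmult)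
  also have "\<dots> = (\<Sum>i\<in>UNIV. ennreal (2 ^ (CARD('n) - 1) * c powr - p i) *
        (\<integral>\<^sup>+r. diff_pow i (p i) u (l i * r) * indicator {-1..1} r \<partial>lborel))"
  proof (rule sum.cong)
    fix i :: 'n
    have "ennreal (2 ^ (CARD('n) - 1) * c powr - p i) = ennreal (c powr - p i) * 2 ^ (CARD('n) - 1)"
      by (simp add: ennreal_mult' mult.commute flip: ennreal_power)
    then show "ennreal (c powr - p i) * (\<integral>\<^sup>+y. diff_pow i (p i) u (l i * y $ i) * indicator cube y \<partial>lborel) =
      ennreal (2 ^ (CARD('n) - 1) * c powr - p i) *
        (\<integral>\<^sup>+r. diff_pow i (p i) u (l i * r) * indicator {-1..1} r \<partial>lborel)"
      using nn_integral_cube_coordinate[of "\<lambda>r. diff_pow i (p i) u (l i * r)" i] by (simp add: mult.assoc)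
  qed simp
  finally show ?thesis .
qed

lemma nn_integral_Icc_scale:
  assumes [measurable]: "f \<in> borel_measurable borel" and l: "0 < l"
  shows "(\<integral>\<^sup>+r. f (l * r) * indicator {-1..1} r \<partial>lborel) =
    ennreal (1 / l) * (\<integral>\<^sup>+r. f r * indicator {-l..l} r \<partial>lborel)"
proof -
  have ind: "indicator {-l..l} (0 + l * r) = (indicator {-1..1} r :: ennreal)" for r
  proof -
    have "-l \<le> l * r \<longleftrightarrow> -1 \<le> r" "l * r \<le> l \<longleftrightarrow> r \<le> 1"
      using l mult_le_cancel_left_pos[of l "-1" r] mult_le_cancel_left_pos[of l r 1] by auto
    then show ?thesis by (auto simp: indicator_def)
  qed
  have "(\<integral>\<^sup>+r. f r * indicator {-l..l} r \<partial>lborel) = ennreal \<bar>l\<bar> * (\<integral>\<^sup>+r. f (0 + l * r) * indicator {-l..l} (0 + l * r) \<partial>lborel)"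
    by (rule nn_integral_real_affine) (use l in auto)
  then show ?thesis
    unfolding ind using l by (simp add: mult.assoc[symmetric] ennreal_mult[symmetric])
qed

text \<open>For steps up to \<open>l\<close> the normalized kernel \<open>l powr (1 + \<sigma> * q)
  * \<bar>r\<bar> powr - (1 + \<sigma> * q)\<close> is at least 1; rescaling the interval divides by
  \<open>l\<close>.\<close>

lemma nn_integral_diff_pow_small:
  assumes [measurable]: "u \<in> borel_measurable borel" and l: "0 < l" and "0 < \<sigma>" "0 < q"
  shows "(\<integral>\<^sup>+r. diff_pow i q u (l * r) * indicator {-1..1} r \<partial>lborel) \<le>
    ennreal (l powr (\<sigma> * q)) * gagliardo i \<sigma> q u"
proof -
  have "(\<integral>\<^sup>+r. diff_pow i q u r * indicator {-l..l} r \<partial>lborel) \<le>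
    (\<integral>\<^sup>+r. ennreal (l powr (1 + \<sigma> * q)) * (diff_pow i q u r * ennreal (\<bar>r\<bar> powr - (1 + \<sigma> * q))) \<partial>lborel)"
  proof (rule nn_integral_mono_AE, rule eventually_mono[OF AE_lborel_singleton[of 0]])
    \<comment> \<open>At the origin \<open>powr\<close> gives the kernel the value 0, so the lower
      bound 1 fails there and the point is discarded as a null set.\<close>
    fix r :: real assume "r \<noteq> 0"
    have "1 \<le> ennreal (l powr (1 + \<sigma> * q)) * ennreal (\<bar>r\<bar> powr - (1 + \<sigma> * q))" if "\<bar>r\<bar> \<le> l"
    proof -
      have "\<bar>r\<bar> powr (1 + \<sigma> * q) \<le> l powr (1 + \<sigma> * q)"
        using that assms by (intro powr_mono2) auto
      then have "1 \<le> l powr (1 + \<sigma> * q) * \<bar>r\<bar> powr - (1 + \<sigma> * q)"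
        unfolding powr_minus using \<open>r \<noteq> 0\<close> by (simp add: field_simps)
      then show ?thesis by (simp add: ennreal_mult[symmetric] flip: ennreal_1)
    qed
    from mult_left_mono[OF this, of "diff_pow i q u r"]
    show "diff_pow i q u r * indicator {-l..l} r \<le>
      ennreal (l powr (1 + \<sigma> * q)) * (diff_pow i q u r * ennreal (\<bar>r\<bar> powr - (1 + \<sigma> * q)))"
      by (auto simp: indicator_def mult_ac)
  qed
  also have "\<dots> = ennreal (l powr (1 + \<sigma> * q)) * gagliardo i \<sigma> q u"
    unfolding gagliardo_def by (rule nn_integral_cmult) measurable
  finally have "ennreal (1 / l) * (\<integral>\<^sup>+r. diff_pow i q u r * indicator {-l..l} r \<partial>lborel) \<le>
    ennreal (1 / l) * (ennreal (l powr (1 + \<sigma> * q)) * gagliardo i \<sigma> q u)"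
    by (rule mult_left_mono) simp
  also have "\<dots> = ennreal (l powr (\<sigma> * q)) * gagliardo i \<sigma> q u"
    using l by (simp add: mult.assoc[symmetric] ennreal_mult[symmetric] powr_add)
  finally show ?thesis
    by (subst nn_integral_Icc_scale) (use l in auto)
qed

lemma nn_integral_powr_Icc:
  fixes c q :: real
  assumes "0 \<le> c" "0 < q"
  shows "(\<integral>\<^sup>+t. ennreal (t powr (q - 1)) * indicator {0..c} t \<partial>lborel) = ennreal (c powr q / q)"
proof -
  have "((\<lambda>t. t powr (q - 1)) has_integral (c powr (q - 1 + 1) / (q - 1 + 1))) {0..c}"
    by (rule has_integral_powr_from_0) (use assms in auto)
  then have "(\<integral>\<^sup>+t. ennreal (t powr (q - 1)) * indicator {0..c} t \<partial>lborel) = ennreal (c powr (q - 1 + 1) / (q - 1 + 1))"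
    by (intro nn_integral_has_integral_lebesgue') auto
  then show ?thesis by simp
qed

section \<open>A refined Sobolev inequality\<close>

text \<open>Using the single-scale bound at every \<open>t\<close> would leave the divergent
  integral of dt/t. Exchanging the integrals avoids this loss: a step r is seen only by the scales t
  up to \<open>\<bar>r\<bar> powr (- 1 / b)\<close>, and integrating the power of t over that range
  reproduces the Gagliardo kernel.\<close>

lemma nn_integral_diff_pow_scales:
  assumes [measurable]: "u \<in> borel_measurable borel" and b: "0 < b" and "0 < \<sigma>" "0 < q"
  shows "(\<integral>\<^sup>+t. ennreal (t powr (\<sigma> * q * b - 1)) * indicator {0<..} t *
     (\<integral>\<^sup>+r. diff_pow i q u (t powr - b * r) * indicator {-1..1} r \<partial>lborel) \<partial>lborel) \<le>
    ennreal (1 / ((\<sigma> * q + 1) * b)) * gagliardo i \<sigma> q u"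
proof -
  \<comment> \<open>The part \<open>\<sigma> * q * b\<close> is the given weight; the extra
    \<open>b\<close> is the factor \<open>t powr b\<close> from undoing the rescaling of r.\<close>
  let ?a = "(\<sigma> * q + 1) * b"
  have a: "0 < ?a" using assms by (simp add: add_pos_pos)
  have "(\<integral>\<^sup>+t. ennreal (t powr (\<sigma> * q * b - 1)) * indicator {0<..} t *
     (\<integral>\<^sup>+r. diff_pow i q u (t powr - b * r) * indicator {-1..1} r \<partial>lborel) \<partial>lborel) =
    (\<integral>\<^sup>+t. (\<integral>\<^sup>+r. ennreal (t powr (?a - 1)) * indicator {0<..} t * diff_pow i q u r * indicator {- (t powr - b)..t powr - b} r \<partial>lborel) \<partial>lborel)"
  proof (rule nn_integral_cong)
    fix t :: real
    show "ennreal (t powr (\<sigma> * q * b - 1)) * indicator {0<..} t *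
     (\<integral>\<^sup>+r. diff_pow i q u (t powr - b * r) * indicator {-1..1} r \<partial>lborel) =
      (\<integral>\<^sup>+r. ennreal (t powr (?a - 1)) * indicator {0<..} t * diff_pow i q u r * indicator {- (t powr - b)..t powr - b} r \<partial>lborel)"
    proof (cases "0 < t")
      case True
      then have l: "0 < t powr - b" by simp
      have "1 / t powr - b = t powr b" by (simp add: powr_minus inverse_eq_divide)
      then have "ennreal (t powr (\<sigma> * q * b - 1)) * ennreal (1 / t powr - b) = ennreal (t powr (\<sigma> * q * b - 1) * t powr b)"
        by (simp add: ennreal_mult)
      also have "t powr (\<sigma> * q * b - 1) * t powr b = t powr (?a - 1)"
        by (simp add: powr_add[symmetric] algebra_simps)
      finally show ?thesis using True
        by (simp add: nn_integral_Icc_scale[OF _ l] mult.assoc[symmetric] nn_integral_cmult)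
           (simp add: mult.assoc nn_integral_cmult)
    qed simp
  qed
  also have "\<dots> = (\<integral>\<^sup>+r. (\<integral>\<^sup>+t. ennreal (t powr (?a - 1)) * indicator {0<..} t * diff_pow i q u r * indicator {- (t powr - b)..t powr - b} r \<partial>lborel) \<partial>lborel)"
  proof (rule lborel_pair.Fubini')
    have "(\<lambda>z. indicator {- (snd z powr - b)..snd z powr - b} (fst z)) = (\<lambda>z::real \<times> real. indicator {z. \<bar>fst z\<bar> \<le> snd z powr - b} z :: ennreal)"
      by (auto simp: indicator_def fun_eq_iff)
    then have [measurable]: "(\<lambda>z. indicator {- (snd z powr - b)..snd z powr - b} (fst z) :: ennreal) \<in> borel_measurable (lborel \<Otimes>\<^sub>M lborel)"
      by simp
    show "(\<lambda>(r, t). ennreal (t powr (?a - 1)) * indicator {0<..} t * diff_pow i q u r * indicator {- (t powr - b)..t powr - b} r) \<in> borel_measurable (lborel \<Otimes>\<^sub>M lborel)"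
      unfolding split_beta by measurable
  qed
  also have "\<dots> = (\<integral>\<^sup>+r. ennreal (1 / ?a) * (diff_pow i q u r * ennreal (\<bar>r\<bar> powr - (1 + \<sigma> * q))) \<partial>lborel)"
  proof (rule nn_integral_cong_AE, rule eventually_mono[OF AE_lborel_singleton[of 0]])
    \<comment> \<open>For r = 0 every scale is admissible and the inner integral need not be finite,
      while the kernel is 0 by convention; again one point is discarded.\<close>
    fix r :: real assume r: "r \<noteq> 0"
    have ind: "indicator {0<..} t * indicator {- (t powr - b)..t powr - b} r = (indicator {0<..} t * indicator {0..\<bar>r\<bar> powr (- 1 / b)} t :: ennreal)" for t
    proof (cases "0 < t")
      case True
      have "\<bar>r\<bar> \<le> t powr - b \<longleftrightarrow> t \<le> \<bar>r\<bar> powr (- 1 / b)"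
      proof
        assume "\<bar>r\<bar> \<le> t powr - b"
        then have "(t powr - b) powr (-1/b) \<le> \<bar>r\<bar> powr (-1/b)"
          using r b by (intro powr_mono2') auto
        then show "t \<le> \<bar>r\<bar> powr (- 1 / b)" using True b by (simp add: powr_powr)
      next
        assume "t \<le> \<bar>r\<bar> powr (- 1 / b)"
        then have "(\<bar>r\<bar> powr (-1/b)) powr - b \<le> t powr - b"
          using True b by (intro powr_mono2') auto
        then show "\<bar>r\<bar> \<le> t powr - b" using r b by (simp add: powr_powr)
      qed
      then show ?thesis using True by (auto simp: indicator_def abs_le_iff)
    qed simp
    have "(\<integral>\<^sup>+t. ennreal (t powr (?a - 1)) * indicator {0<..} t * diff_pow i q u r * indicator {- (t powr - b)..t powr - b} r \<partial>lborel)
      = (\<integral>\<^sup>+t. diff_pow i q u r * (ennreal (t powr (?a - 1)) * indicator {0..\<bar>r\<bar> powr (- 1 / b)} t) \<partial>lborel)"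
    proof (rule nn_integral_cong)
      fix t :: real
      have "ennreal (t powr (?a - 1)) * indicator {0<..} t * diff_pow i q u r * indicator {- (t powr - b)..t powr - b} r
        = ennreal (t powr (?a - 1)) * diff_pow i q u r * (indicator {0<..} t * indicator {- (t powr - b)..t powr - b} r)"
        by (simp add: mult_ac)
      also have "\<dots> = diff_pow i q u r * (ennreal (t powr (?a - 1)) * indicator {0..\<bar>r\<bar> powr (- 1 / b)} t)"
        unfolding ind by (cases "t = 0") (auto simp: indicator_def mult_ac)
      finally show "ennreal (t powr (?a - 1)) * indicator {0<..} t * diff_pow i q u r * indicator {- (t powr - b)..t powr - b} r =
         diff_pow i q u r * (ennreal (t powr (?a - 1)) * indicator {0..\<bar>r\<bar> powr (- 1 / b)} t)" .
    qed
    also have "\<dots> = diff_pow i q u r * ennreal ((\<bar>r\<bar> powr (- 1 / b)) powr ?a / ?a)"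
      by (subst nn_integral_cmult) (simp_all add: nn_integral_powr_Icc a)
    also have "(\<bar>r\<bar> powr (- 1 / b)) powr ?a / ?a = 1 / ?a * \<bar>r\<bar> powr - (1 + \<sigma> * q)"
      unfolding powr_powr using b by (simp add: algebra_simps)
    also have E: "ennreal (1 / ?a * \<bar>r\<bar> powr - (1 + \<sigma> * q)) = ennreal (1 / ?a) * ennreal (\<bar>r\<bar> powr - (1 + \<sigma> * q))"
      by (rule ennreal_mult) (use a in auto)
    finally show "(\<integral>\<^sup>+t. ennreal (t powr (?a - 1)) * indicator {0<..} t * diff_pow i q u r * indicator {- (t powr - b)..t powr - b} r \<partial>lborel)
      = ennreal (1 / ?a) * (diff_pow i q u r * ennreal (\<bar>r\<bar> powr - (1 + \<sigma> * q)))"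
      by (simp only: mult_ac)
  qed
  also have "\<dots> = ennreal (1 / ?a) * gagliardo i \<sigma> q u"
    unfolding gagliardo_def by (rule nn_integral_cmult) measurable
  finally show ?thesis by simp
qed

text \<open>
  Cutting \<open>u\<close> into its level sets \<open>{u > 2 \<delta> t}\<close> and comparing \<open>u x\<close> with \<open>u\<close> on the box of side lengths
  \<open>2 t powr - b i\<close> around \<open>x\<close> costs no integrability assumption on box averages: the hypothesis says that
  \<open>u < \<delta> t\<close> on at least half of every such box.  The powers of \<open>\<delta>\<close> on the right are positive, which
  is what excludes vanishing of a minimizing sequence.
\<close>

lemma mass_le_gagliardo:
  fixes u :: "real^'n::finite \<Rightarrow> real"
  assumes u[measurable]: "u \<in> borel_measurable borel" and nn: "\<And>x. 0 \<le> u x" and \<delta>: "0 < \<delta>"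
    and pos: "\<And>i. 0 < \<sigma> i" "\<And>i. 0 < p i" "\<And>i. 0 < b i"
    and b: "\<And>i. \<sigma> i * p i * b i = q - p i"
    and small: "\<And>t x. 0 < t \<Longrightarrow> emeasure lborel {y \<in> cube. \<delta> * t \<le> u (x + (\<chi> i. t powr - b i * y $ i))} < 1"
  shows "mass q u \<le> (\<Sum>i\<in>UNIV. ennreal (q * 2 powr q * 2 ^ (CARD('n) - 1) * real CARD('n) powr p i /
     ((\<sigma> i * p i + 1) * b i) * \<delta> powr (q - p i)) * gagliardo i (\<sigma> i) (p i) u)"
proof -
  let ?n = "real CARD('n)"
  obtain i0 :: 'n where True by auto
  have "0 < \<sigma> i0 * p i0 * b i0" using pos by simp
  then have q: "0 < q" using b[of i0] pos(2)[of i0] by simp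
  \<comment> \<open>This constant normalizes the layer-cake formula: \<open>K\<close> times the
    integral of \<open>t powr (q - 1)\<close> up to \<open>u x / (2 * \<delta>)\<close> is
    \<open>u x powr q\<close>.\<close>
  define K where "K = q * (2 * \<delta>) powr q"
  have K: "0 \<le> K" using q by (simp add: K_def)
  \<comment> \<open>Height, base point and box step enter as one point of a product, so joint
    measurability is proved once and serves every exchange of integrals.\<close>
  define W where "W t x y = (indicator {z. \<delta> * fst z < \<bar>u (fst (snd z)) - u (fst (snd z) + (\<chi> i. fst z powr - b i * snd (snd z) $ i))\<bar>} (t, x, y)
     * indicator cube y :: ennreal)" for t :: real and x y :: "real^'n"
  have Wm: "(\<lambda>z. W (f z) (g z) (h z)) \<in> borel_measurable M"
    if "f \<in> borel_measurable M" "g \<in> borel_measurable M" "h \<in> borel_measurable M" for f g h and M :: "'z measure"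
  proof -
    note [measurable] = that
    have "{z. \<delta> * fst z < \<bar>u (fst (snd z)) - u (fst (snd z) + (\<chi> i. fst z powr - b i * snd (snd z) $ i))\<bar>} \<in> sets (borel \<Otimes>\<^sub>M borel \<Otimes>\<^sub>M borel)"
      (is "?S \<in> _")
    proof -
      have "{z \<in> space (borel \<Otimes>\<^sub>M borel \<Otimes>\<^sub>M borel). \<delta> * fst z < \<bar>u (fst (snd z)) - u (fst (snd z) + (\<chi> i. fst z powr - b i * snd (snd z) $ i))\<bar>} \<in> sets (borel \<Otimes>\<^sub>M borel \<Otimes>\<^sub>M borel)"
        by measurable
      then show ?thesis by (simp add: space_pair_measure)
    qed
    then have [measurable]: "indicator ?S \<in> borel_measurable (borel \<Otimes>\<^sub>M borel \<Otimes>\<^sub>M borel)" by simp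
    show ?thesis unfolding W_def by measurable
  qed
  note Wm[measurable (raw)]
  \<comment> \<open>Where \<open>u x\<close> is at least \<open>2 * \<delta> * t\<close>, each box
    point either has value at least \<open>\<delta> * t\<close> or marks a drop by more than
    \<open>\<delta> * t\<close>. The cube has measure \<open>2 ^ CARD('n)\<close>, at least 2, and
    the first kind fills less than 1, so the second fills at least 1.\<close>
  have layer: "indicator {0..\<bar>u x\<bar> / (2 * \<delta>)} t \<le> (\<integral>\<^sup>+y. W t x y \<partial>lborel)" if t: "0 < t" for t x
  proof (cases "2 * \<delta> * t \<le> u x")
    case True
    let ?A = "{y \<in> cube. \<delta> * t \<le> u (x + (\<chi> i. t powr - b i * y $ i))}"
    let ?B = "{y \<in> cube. \<delta> * t < \<bar>u x - u (x + (\<chi> i. t powr - b i * y $ i))\<bar>}"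
    have [measurable]: "?A \<in> sets borel" "?B \<in> sets borel" by measurable
    have "(2::ennreal) ^ 1 \<le> 2 ^ CARD('n)"
      by (rule power_increasing) (auto simp: Suc_le_eq)
    also have "\<dots> = emeasure lborel (cube :: (real^'n) set)" by (rule emeasure_cube[symmetric])
    also have "\<dots> \<le> emeasure lborel (?A \<union> ?B)"
      by (rule emeasure_mono) (use True in \<open>auto simp: mult.assoc\<close>)
    also have "\<dots> \<le> emeasure lborel ?A + emeasure lborel ?B"
      by (rule emeasure_subadditive) measurable
    finally have two: "2 \<le> emeasure lborel ?A + emeasure lborel ?B" by simp
    have "1 \<le> emeasure lborel ?B"
    proof (rule ccontr)
      assume "\<not> 1 \<le> emeasure lborel ?B"
      then have "emeasure lborel ?A + emeasure lborel ?B < 1 + 1"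
        using small[OF t, of x] by (intro add_strict_mono) auto
      then show False using two by simp
    qed
    also have "emeasure lborel ?B = (\<integral>\<^sup>+y. indicator ?B y \<partial>lborel)" by simp
    also have "(\<lambda>y. indicator ?B y) = (\<lambda>y. W t x y)"
      by (auto simp: W_def indicator_def fun_eq_iff)
    finally show ?thesis by (auto simp: indicator_def)
  next
    case False
    then have "t \<notin> {0..\<bar>u x\<bar> / (2 * \<delta>)}" using \<delta> nn[of x] by (auto simp: field_simps)
    then show ?thesis by simp
  qed
  have "mass q u \<le> (\<integral>\<^sup>+x. \<integral>\<^sup>+t. ennreal K * (ennreal (t powr (q - 1)) * indicator {0<..} t * (\<integral>\<^sup>+y. W t x y \<partial>lborel)) \<partial>lborel \<partial>lborel)"
    unfolding mass_def
  proof (rule nn_integral_mono)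
    fix x
    have "K * ((\<bar>u x\<bar> / (2 * \<delta>)) powr q / q) = \<bar>u x\<bar> powr q"
      using q \<delta> by (simp add: K_def powr_divide)
    then have "ennreal (\<bar>u x\<bar> powr q) = ennreal K * ennreal ((\<bar>u x\<bar> / (2 * \<delta>)) powr q / q)"
      using K q by (simp add: ennreal_mult[symmetric])
    also have "\<dots> = ennreal K * (\<integral>\<^sup>+t. ennreal (t powr (q - 1)) * indicator {0..\<bar>u x\<bar> / (2 * \<delta>)} t \<partial>lborel)"
      by (subst nn_integral_powr_Icc) (use \<delta> q in auto)
    also have "\<dots> = (\<integral>\<^sup>+t. ennreal K * (ennreal (t powr (q - 1)) * indicator {0..\<bar>u x\<bar> / (2 * \<delta>)} t) \<partial>lborel)"
      by (rule nn_integral_cmult[symmetric]) measurable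
    also have "\<dots> \<le> (\<integral>\<^sup>+t. ennreal K * (ennreal (t powr (q - 1)) * indicator {0<..} t * (\<integral>\<^sup>+y. W t x y \<partial>lborel)) \<partial>lborel)"
    proof (rule nn_integral_mono)
      fix t :: real
      show "ennreal K * (ennreal (t powr (q - 1)) * indicator {0..\<bar>u x\<bar> / (2 * \<delta>)} t) \<le>
        ennreal K * (ennreal (t powr (q - 1)) * indicator {0<..} t * (\<integral>\<^sup>+y. W t x y \<partial>lborel))"
      proof (cases "0 < t")
        case True
        then show ?thesis using layer[OF True, of x] by (auto intro!: mult_left_mono)
      qed (cases "t = 0"; auto simp: indicator_def)
    qed
    finally show "ennreal (\<bar>u x\<bar> powr q) \<le> (\<integral>\<^sup>+t. ennreal K * (ennreal (t powr (q - 1)) * indicator {0<..} t * (\<integral>\<^sup>+y. W t x y \<partial>lborel)) \<partial>lborel)" .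
  qed
  also have "\<dots> = (\<integral>\<^sup>+t. \<integral>\<^sup>+x. ennreal K * (ennreal (t powr (q - 1)) * indicator {0<..} t * (\<integral>\<^sup>+y. W t x y \<partial>lborel)) \<partial>lborel \<partial>lborel)"
    by (rule lborel_pair.Fubini') measurable
  also have "\<dots> \<le> (\<integral>\<^sup>+t. (\<Sum>i\<in>UNIV. ennreal (K * 2 ^ (CARD('n) - 1) * (\<delta> / ?n) powr - p i) * (ennreal (t powr (\<sigma> i * p i * b i - 1)) * indicator {0<..} t *
        (\<integral>\<^sup>+r. diff_pow i (p i) u (t powr - b i * r) * indicator {-1..1} r \<partial>lborel))) \<partial>lborel)"
  proof (rule nn_integral_mono)
    fix t :: real
    show "(\<integral>\<^sup>+x. ennreal K * (ennreal (t powr (q - 1)) * indicator {0<..} t * (\<integral>\<^sup>+y. W t x y \<partial>lborel)) \<partial>lborel) \<le>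
      (\<Sum>i\<in>UNIV. ennreal (K * 2 ^ (CARD('n) - 1) * (\<delta> / ?n) powr - p i) * (ennreal (t powr (\<sigma> i * p i * b i - 1)) * indicator {0<..} t *
        (\<integral>\<^sup>+r. diff_pow i (p i) u (t powr - b i * r) * indicator {-1..1} r \<partial>lborel)))"
    proof (cases "0 < t")
      case True
      have "(\<integral>\<^sup>+x. \<integral>\<^sup>+y. W t x y \<partial>lborel \<partial>lborel) = (\<integral>\<^sup>+y. \<integral>\<^sup>+x. W t x y \<partial>lborel \<partial>lborel)"
        by (rule lborel_pair.Fubini') measurable
      also have "\<dots> = (\<integral>\<^sup>+y. dev u (?n * (\<delta> * t / ?n)) (\<chi> i. t powr - b i * y $ i) * indicator cube y \<partial>lborel)"
      proof (rule nn_integral_cong)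
        fix y :: "real^'n"
        have "(\<integral>\<^sup>+x. W t x y \<partial>lborel) = (\<integral>\<^sup>+x. indicator {x. \<delta> * t < \<bar>u x - u (x + (\<chi> i. t powr - b i * y $ i))\<bar>} x * indicator cube y \<partial>lborel)"
          by (rule nn_integral_cong) (simp add: W_def indicator_def)
        also have "\<dots> = dev u (\<delta> * t) (\<chi> i. t powr - b i * y $ i) * indicator cube y"
          unfolding dev_eq_nn_integral[OF u] by (rule nn_integral_multc) measurable
        finally show "(\<integral>\<^sup>+x. W t x y \<partial>lborel) = dev u (?n * (\<delta> * t / ?n)) (\<chi> i. t powr - b i * y $ i) * indicator cube y"
          by simp
      qed
      also have "\<dots> \<le> (\<Sum>i\<in>UNIV. ennreal (2 ^ (CARD('n) - 1) * (\<delta> * t / ?n) powr - p i) *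
        (\<integral>\<^sup>+r. diff_pow i (p i) u (t powr - b i * r) * indicator {-1..1} r \<partial>lborel))"
        by (rule nn_integral_dev_cube) (use True \<delta> pos in auto)
      finally have "(ennreal K * ennreal (t powr (q - 1))) * (\<integral>\<^sup>+x. \<integral>\<^sup>+y. W t x y \<partial>lborel \<partial>lborel) \<le>
         (ennreal K * ennreal (t powr (q - 1))) * (\<Sum>i\<in>UNIV. ennreal (2 ^ (CARD('n) - 1) * (\<delta> * t / ?n) powr - p i) *
        (\<integral>\<^sup>+r. diff_pow i (p i) u (t powr - b i * r) * indicator {-1..1} r \<partial>lborel))"
        by (rule mult_left_mono) simp
      also have "\<dots> = (\<Sum>i\<in>UNIV. ennreal (K * 2 ^ (CARD('n) - 1) * (\<delta> / ?n) powr - p i) * (ennreal (t powr (\<sigma> i * p i * b i - 1)) * indicator {0<..} t *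
        (\<integral>\<^sup>+r. diff_pow i (p i) u (t powr - b i * r) * indicator {-1..1} r \<partial>lborel)))"
        unfolding sum_distrib_left
      proof (rule sum.cong)
        fix i :: 'n
        \<comment> \<open>Here the choice of \<open>b\<close> is used: Chebyshev costs t to the
          power -p i, and q - 1 - p i is exactly the exponent that
          \<open>nn_integral_diff_pow_scales\<close> integrates.\<close>
        have "t powr (\<sigma> i * p i * b i - 1) = t powr ((q - 1) + - p i)"
          unfolding b by (simp add: algebra_simps)
        then have e: "K * t powr (q - 1) * (2 ^ (CARD('n) - 1) * (\<delta> * t / ?n) powr - p i) = K * 2 ^ (CARD('n) - 1) * (\<delta> / ?n) powr - p i * t powr (\<sigma> i * p i * b i - 1)"
          using True \<delta> by (simp only: powr_add) (simp add: powr_mult powr_divide powr_minus field_simps)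
        have "ennreal K * ennreal (t powr (q - 1)) * ennreal (2 ^ (CARD('n) - 1) * (\<delta> * t / ?n) powr - p i) =
          ennreal (K * 2 ^ (CARD('n) - 1) * (\<delta> / ?n) powr - p i) * ennreal (t powr (\<sigma> i * p i * b i - 1))"
          using K e by (simp add: ennreal_mult[symmetric] del: times_divide_eq_left times_divide_eq_right)
        then show "ennreal K * ennreal (t powr (q - 1)) * (ennreal (2 ^ (CARD('n) - 1) * (\<delta> * t / ?n) powr - p i) *
        (\<integral>\<^sup>+r. diff_pow i (p i) u (t powr - b i * r) * indicator {-1..1} r \<partial>lborel)) =
         ennreal (K * 2 ^ (CARD('n) - 1) * (\<delta> / ?n) powr - p i) * (ennreal (t powr (\<sigma> i * p i * b i - 1)) * indicator {0<..} t *
        (\<integral>\<^sup>+r. diff_pow i (p i) u (t powr - b i * r) * indicator {-1..1} r \<partial>lborel))"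
          using True by (simp add: mult.assoc[symmetric])
      qed simp
      finally show ?thesis using True
        by (simp add: mult.assoc[symmetric] nn_integral_cmult)
    qed simp
  qed
  also have "\<dots> = (\<Sum>i\<in>UNIV. ennreal (K * 2 ^ (CARD('n) - 1) * (\<delta> / ?n) powr - p i) * (\<integral>\<^sup>+t. (ennreal (t powr (\<sigma> i * p i * b i - 1)) * indicator {0<..} t *
        (\<integral>\<^sup>+r. diff_pow i (p i) u (t powr - b i * r) * indicator {-1..1} r \<partial>lborel)) \<partial>lborel))"
    by (subst nn_integral_sum) (auto intro!: sum.cong nn_integral_cmult)
  also have "\<dots> \<le> (\<Sum>i\<in>UNIV. ennreal (K * 2 ^ (CARD('n) - 1) * (\<delta> / ?n) powr - p i) * (ennreal (1 / ((\<sigma> i * p i + 1) * b i)) * gagliardo i (\<sigma> i) (p i) u))"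
    by (intro sum_mono mult_left_mono nn_integral_diff_pow_scales) (use pos in auto)
  also have "\<dots> = (\<Sum>i\<in>UNIV. ennreal (q * 2 powr q * 2 ^ (CARD('n) - 1) * ?n powr p i /
     ((\<sigma> i * p i + 1) * b i) * \<delta> powr (q - p i)) * gagliardo i (\<sigma> i) (p i) u)"
  proof (rule sum.cong)
    fix i :: 'n
    have P: "0 < (\<sigma> i * p i + 1) * b i" using pos[of i] by (simp add: add_pos_pos)
    have d: "(\<delta> / ?n) powr - p i = \<delta> powr - p i * ?n powr p i"
      using \<delta> by (simp add: powr_divide powr_minus field_simps)
    have "\<delta> powr (q - p i) = \<delta> powr q * \<delta> powr - p i" by (simp add: powr_add[symmetric])
    then have "K * 2 ^ (CARD('n) - 1) * (\<delta> / ?n) powr - p i * (1 / ((\<sigma> i * p i + 1) * b i)) =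
      q * 2 powr q * 2 ^ (CARD('n) - 1) * ?n powr p i / ((\<sigma> i * p i + 1) * b i) * \<delta> powr (q - p i)"
      unfolding K_def d powr_mult by (simp only: mult_ac times_divide_eq_left times_divide_eq_right mult_1)
    moreover have "ennreal (K * 2 ^ (CARD('n) - 1) * (\<delta> / ?n) powr - p i) * ennreal (1 / ((\<sigma> i * p i + 1) * b i)) =
       ennreal (K * 2 ^ (CARD('n) - 1) * (\<delta> / ?n) powr - p i * (1 / ((\<sigma> i * p i + 1) * b i)))"
      using K P by (intro ennreal_mult[symmetric]) auto
    ultimately show "ennreal (K * 2 ^ (CARD('n) - 1) * (\<delta> / ?n) powr - p i) * (ennreal (1 / ((\<sigma> i * p i + 1) * b i)) * gagliardo i (\<sigma> i) (p i) u)
      = ennreal (q * 2 powr q * 2 ^ (CARD('n) - 1) * ?n powr p i / ((\<sigma> i * p i + 1) * b i) * \<delta> powr (q - p i)) * gagliardo i (\<sigma> i) (p i) u"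
      by (simp only: mult.assoc[symmetric])
  qed simp
  finally show ?thesis .
qed

section \<open>Local compactness\<close>

text \<open>The completeness argument for L^1: along indices whose successive distances are at most
  (1/2)^j, the sum of the increments is integrable, hence finite almost everywhere, and the sequence
  telescopes.\<close>

lemma L1_Cauchy_AE_subseq:
  fixes f :: "nat \<Rightarrow> 'a \<Rightarrow> real"
  assumes [measurable]: "\<And>k. f k \<in> borel_measurable M"
    and C: "\<And>e. 0 < e \<Longrightarrow> \<exists>N. \<forall>k\<ge>N. \<forall>l\<ge>N. (\<integral>\<^sup>+x. ennreal \<bar>f k x - f l x\<bar> \<partial>M) \<le> ennreal e"
  shows "\<exists>r. strict_mono r \<and> (AE x in M. convergent (\<lambda>k. f (r k) x))"
proof -
  have "\<forall>j. \<exists>N. \<forall>k\<ge>N. \<forall>l\<ge>N. (\<integral>\<^sup>+x. ennreal \<bar>f k x - f l x\<bar> \<partial>M) \<le> ennreal ((1/2) ^ j)"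
    using C by simp
  then obtain N where N: "\<And>j k l. N j \<le> k \<Longrightarrow> N j \<le> l \<Longrightarrow> (\<integral>\<^sup>+x. ennreal \<bar>f k x - f l x\<bar> \<partial>M) \<le> ennreal ((1/2) ^ j)"
    by metis
  define r where "r = rec_nat (N 0) (\<lambda>j m. max (N (Suc j)) (Suc m))"
  have r: "r (Suc j) = max (N (Suc j)) (Suc (r j))" for j by (simp add: r_def)
  have mono: "strict_mono r" by (rule strict_monoI_Suc) (simp add: r)
  have rN: "N j \<le> r j" for j by (cases j) (simp_all add: r, simp add: r_def)
  have "(\<integral>\<^sup>+x. (\<Sum>j. ennreal \<bar>f (r (Suc j)) x - f (r j) x\<bar>) \<partial>M) = (\<Sum>j. \<integral>\<^sup>+x. ennreal \<bar>f (r (Suc j)) x - f (r j) x\<bar> \<partial>M)"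
    by (rule nn_integral_suminf) measurable
  also have "\<dots> \<le> (\<Sum>j. ennreal ((1/2) ^ j))"
  proof (rule suminf_le)
    fix j
    have "r j \<le> r (Suc j)" by (simp add: r)
    with rN[of j] show "(\<integral>\<^sup>+x. ennreal \<bar>f (r (Suc j)) x - f (r j) x\<bar> \<partial>M) \<le> ennreal ((1/2) ^ j)"
      by (intro N) auto
  qed auto
  also have "\<dots> < \<infinity>"
    by (subst suminf_ennreal2) (auto simp: summable_geometric)
  finally have "AE x in M. (\<Sum>j. ennreal \<bar>f (r (Suc j)) x - f (r j) x\<bar>) \<noteq> \<infinity>"
    by (intro nn_integral_PInf_AE) auto
  then have "AE x in M. convergent (\<lambda>k. f (r k) x)"
  proof eventually_elim
    case (elim x)
    have "summable (\<lambda>j. \<bar>f (r (Suc j)) x - f (r j) x\<bar>)"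
      by (rule summable_suminf_not_top) (use elim in auto)
    then have "summable (\<lambda>j. f (r (Suc j)) x - f (r j) x)" by (rule summable_rabs_cancel)
    then have "convergent (\<lambda>n. f (r n) x - f (r 0) x)"
      unfolding summable_iff_convergent by (simp add: sum_lessThan_telescope[of "\<lambda>j. f (r j) x"])
    then show ?case by (simp add: convergent_diff_const_right_iff)
  qed
  with mono show ?thesis by blast
qed

text \<open>The average over the grid cell with corner \<open>\<tau> * z\<close> and side
  \<open>\<tau>\<close>, pulled back to the unit cell so that no volume factor appears. Cells are
  labelled by integer vectors because the diagonal extraction needs a countable family.\<close>

definition cell_avg :: "real \<Rightarrow> (real^'n::finite \<Rightarrow> real) \<Rightarrow> ('n \<Rightarrow> int) \<Rightarrow> real" where
  "cell_avg \<tau> v z = (\<integral>y. indicator (cbox 0 1) y * v (\<chi> i. \<tau> * (of_int (z i) + y $ i)) \<partial>lborel)"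

lemma emeasure_unit_cbox: "emeasure lborel (cbox 0 1 :: (real^'n::finite) set) = 1"
  by (subst emeasure_lborel_cbox) (auto simp: Basis_vec_range inner_axis intro!: prod.neutral)

lemma measurable_cell_avg[measurable]:
  fixes v :: "real^'n::finite \<Rightarrow> real"
  assumes [measurable]: "v \<in> borel_measurable borel"
  shows "(\<lambda>x. cell_avg \<tau> v (\<lambda>i. \<lfloor>x $ i / \<tau>\<rfloor>)) \<in> borel_measurable borel"
  unfolding cell_avg_def by measurable

lemma cell_avg_bound:
  fixes v :: "real^'n::finite \<Rightarrow> real"
  assumes [measurable]: "v \<in> borel_measurable borel" and v: "\<And>x. \<bar>v x\<bar> \<le> 1"
  shows "integrable lborel (\<lambda>y. indicator (cbox 0 1) y * v (\<chi> i. \<tau> * (of_int (z i) + y $ i)))"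
    and "\<bar>cell_avg \<tau> v z\<bar> \<le> 1"
proof -
  have e: "emeasure lborel (cbox 0 1 :: (real^'n::finite) set) < \<infinity>" by (simp add: emeasure_unit_cbox)
  have i1: "integrable lborel (indicator (cbox 0 (1::real^'n)) :: _ \<Rightarrow> real)"
    using e by (intro integrable_real_indicator) auto
  show i2: "integrable lborel (\<lambda>y. indicator (cbox 0 1) y * v (\<chi> i. \<tau> * (of_int (z i) + y $ i)))"
    by (rule Bochner_Integration.integrable_bound[OF i1]) (use v in \<open>auto simp: indicator_def abs_mult\<close>)
  have "\<bar>cell_avg \<tau> v z\<bar> \<le> (\<integral>y. indicator (cbox 0 (1::real^'n)) y \<partial>lborel)"
    unfolding cell_avg_def
    by (rule integral_abs_bound_integral[OF i2 i1]) (use v in \<open>auto simp: indicator_def\<close>)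
  also have "\<dots> = 1" by (simp add: measure_def emeasure_unit_cbox)
  finally show "\<bar>cell_avg \<tau> v z\<bar> \<le> 1" .
qed

text \<open>Points of the cell where \<open>v\<close> differs from \<open>v x\<close> by at most
  \<open>c\<close> contribute at most \<open>c\<close>; at the others the difference is at most 2,
  since \<open>v\<close> is bounded by 1.\<close>

lemma cell_avg_approx:
  fixes v :: "real^'n::finite \<Rightarrow> real"
  assumes m[measurable]: "v \<in> borel_measurable borel" and v: "\<And>x. \<bar>v x\<bar> \<le> 1" and \<tau>: "0 < \<tau>" and c: "0 < c"
  shows "ennreal \<bar>v x - cell_avg \<tau> v (\<lambda>i. \<lfloor>x $ i / \<tau>\<rfloor>)\<bar> \<le> ennreal c +
    2 * (\<integral>\<^sup>+y. indicator {y. c < \<bar>v x - v (x + (\<chi> i. \<tau> * y $ i))\<bar>} y * indicator cube y \<partial>lborel)"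
proof -
  let ?I = "cbox 0 (1::real^'n)"
  let ?z = "\<lambda>i. \<lfloor>x $ i / \<tau>\<rfloor>"
  \<comment> \<open>The offset from \<open>x\<close> to the corner of its cell, in units of
    \<open>\<tau>\<close>. Its coordinates lie in (-1, 0], so the shifted unit cell stays inside
    \<open>cube\<close>.\<close>
  define w :: "real^'n" where "w = (\<chi> i. of_int (?z i) - x $ i / \<tau>)"
  have pt: "(\<chi> i. \<tau> * (of_int (?z i) + y $ i)) = x + (\<chi> i. \<tau> * (y + w) $ i)" for y
    using \<tau> by (simp add: w_def vec_eq_iff algebra_simps)
  have e: "emeasure lborel ?I < \<infinity>" by (simp add: emeasure_unit_cbox)
  have i1: "integrable lborel (indicator ?I :: _ \<Rightarrow> real)"
    using e by (intro integrable_real_indicator) auto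
  have "(\<integral>y. indicator ?I y * v x \<partial>lborel) = v x"
    by (simp add: measure_def emeasure_unit_cbox)
  then have "v x - cell_avg \<tau> v ?z = (\<integral>y. indicator ?I y * v x - indicator ?I y * v (\<chi> i. \<tau> * (of_int (?z i) + y $ i)) \<partial>lborel)"
    unfolding cell_avg_def
    using i1 cell_avg_bound(1)[OF m v, of \<tau> ?z] by (subst Bochner_Integration.integral_diff) auto
  also have "ennreal (norm \<dots>) \<le> (\<integral>\<^sup>+y. ennreal (norm (indicator ?I y * v x - indicator ?I y * v (\<chi> i. \<tau> * (of_int (?z i) + y $ i)))) \<partial>lborel)"
    by (rule integral_norm_bound_ennreal)
       (use i1 cell_avg_bound(1)[OF m v, of \<tau> ?z] in auto)
  also have "\<dots> \<le> (\<integral>\<^sup>+y. ennreal c * indicator ?I y + 2 * (indicator {y. c < \<bar>v x - v (x + (\<chi> i. \<tau> * y $ i))\<bar>} (y + w) * indicator cube (y + w)) \<partial>lborel)"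
  proof (rule nn_integral_mono)
    fix y :: "real^'n"
    have cube: "y + w \<in> cube" if "y \<in> ?I"
    proof -
      have "\<bar>y $ i + (of_int (?z i) - x $ i / \<tau>)\<bar> \<le> 1" for i
      proof -
        have "0 \<le> y $ i" "y $ i \<le> 1" using that by (auto simp: mem_box_cart)
        then show ?thesis by linarith
      qed
      then show ?thesis by (simp add: cube_def w_def)
    qed
    show "ennreal (norm (indicator ?I y * v x - indicator ?I y * v (\<chi> i. \<tau> * (of_int (?z i) + y $ i)))) \<le>
      ennreal c * indicator ?I y + 2 * (indicator {y. c < \<bar>v x - v (x + (\<chi> i. \<tau> * y $ i))\<bar>} (y + w) * indicator cube (y + w))"
    proof (cases "y \<in> ?I")
      case True
      show ?thesis
      proof (cases "c < \<bar>v x - v (x + (\<chi> i. \<tau> * (y + w) $ i))\<bar>")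
        case big: True
        have "\<bar>v x - v (x + (\<chi> i. \<tau> * (y + w) $ i))\<bar> \<le> 2" using v[of x] v[of "x + (\<chi> i. \<tau> * (y + w) $ i)"] by linarith
        then have "ennreal \<bar>v x - v (x + (\<chi> i. \<tau> * (y + w) $ i))\<bar> \<le> ennreal 2" by (rule ennreal_leI)
        then show ?thesis using True cube[OF True] big unfolding pt
          by (simp add: add_increasing)
      next
        case False
        then show ?thesis using True unfolding pt by (auto intro!: add_increasing2 ennreal_leI)
      qed
    qed simp
  qed
  also have "\<dots> = ennreal c * emeasure lborel ?I +
     (\<integral>\<^sup>+y. 2 * (indicator {y. c < \<bar>v x - v (x + (\<chi> i. \<tau> * y $ i))\<bar>} (y + w) * indicator cube (y + w)) \<partial>lborel)"
    by (subst nn_integral_add) (auto simp: nn_integral_cmult)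
  also have "(\<integral>\<^sup>+y. 2 * (indicator {y. c < \<bar>v x - v (x + (\<chi> i. \<tau> * y $ i))\<bar>} (y + w) * indicator cube (y + w)) \<partial>lborel)
     = (\<integral>\<^sup>+y. 2 * (indicator {y. c < \<bar>v x - v (x + (\<chi> i. \<tau> * y $ i))\<bar>} y * indicator cube y) \<partial>lborel)"
    by (rule nn_integral_lborel_translate) measurable
  also have "\<dots> = 2 * (\<integral>\<^sup>+y. indicator {y. c < \<bar>v x - v (x + (\<chi> i. \<tau> * y $ i))\<bar>} y * indicator cube y \<partial>lborel)"
    by (rule nn_integral_cmult) measurable
  finally show ?thesis by (simp add: emeasure_unit_cbox)
qed

text \<open>Only the constant error is integrated against \<open>g\<close>; the part with large
  increments is already summable over the whole space, and there \<open>g\<close> is replaced by 1.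
  The constant \<open>c\<close> is to be fixed first, then \<open>\<tau>\<close> made small.\<close>

lemma cell_avg_L1:
  fixes v :: "real^'n::finite \<Rightarrow> real" and g :: "real^'n \<Rightarrow> real"
  assumes m[measurable]: "v \<in> borel_measurable borel" and v: "\<And>x. \<bar>v x\<bar> \<le> 1" and \<tau>: "0 < \<tau>" and c: "0 < c"
    and g[measurable]: "g \<in> borel_measurable borel" and g1: "\<And>x. g x \<le> 1" and pos: "\<And>i. 0 < \<sigma> i" "\<And>i. 0 < p i"
  shows "(\<integral>\<^sup>+x. ennreal \<bar>v x - cell_avg \<tau> v (\<lambda>i. \<lfloor>x $ i / \<tau>\<rfloor>)\<bar> * ennreal (g x) \<partial>lborel) \<le>
    ennreal (real CARD('n) * c) * (\<integral>\<^sup>+x. ennreal (g x) \<partial>lborel) +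
    (\<Sum>i\<in>UNIV. ennreal (2 ^ CARD('n) * c powr - p i * \<tau> powr (\<sigma> i * p i)) * gagliardo i (\<sigma> i) (p i) v)"
proof -
  let ?d = "real CARD('n) * c"
  have d: "0 < ?d" using c by simp
  define W where "W x y = (indicator {z. ?d < \<bar>v (fst z) - v (fst z + (\<chi> i. \<tau> * snd z $ i))\<bar>} (x, y)
     * indicator cube y :: ennreal)" for x y :: "real^'n"
  have Wm[measurable (raw)]: "(\<lambda>z. W (f z) (h z)) \<in> borel_measurable M"
    if [measurable]: "f \<in> borel_measurable M" "h \<in> borel_measurable M" for f h and M :: "'z measure"
  proof -
    have "{z \<in> space (borel \<Otimes>\<^sub>M borel). ?d < \<bar>v (fst z) - v (fst z + (\<chi> i. \<tau> * snd z $ i))\<bar>} \<in> sets (borel \<Otimes>\<^sub>M borel)"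
      by measurable
    then have [measurable]: "indicator {z. ?d < \<bar>v (fst z) - v (fst z + (\<chi> i. \<tau> * snd z $ i))\<bar>} \<in> borel_measurable (borel \<Otimes>\<^sub>M borel)"
      by (simp add: space_pair_measure)
    show ?thesis unfolding W_def by measurable
  qed
  have "(\<integral>\<^sup>+x. ennreal \<bar>v x - cell_avg \<tau> v (\<lambda>i. \<lfloor>x $ i / \<tau>\<rfloor>)\<bar> * ennreal (g x) \<partial>lborel) \<le>
    (\<integral>\<^sup>+x. ennreal ?d * ennreal (g x) + 2 * (\<integral>\<^sup>+y. W x y \<partial>lborel) \<partial>lborel)"
  proof (rule nn_integral_mono)
    fix x
    have "ennreal \<bar>v x - cell_avg \<tau> v (\<lambda>i. \<lfloor>x $ i / \<tau>\<rfloor>)\<bar> * ennreal (g x) \<le> (ennreal ?d + 2 * (\<integral>\<^sup>+y. W x y \<partial>lborel)) * ennreal (g x)"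
      using cell_avg_approx[OF m v \<tau> d, of x] unfolding W_def
      by (intro mult_right_mono) (simp_all add: indicator_def)
    also have "\<dots> \<le> ennreal ?d * ennreal (g x) + 2 * (\<integral>\<^sup>+y. W x y \<partial>lborel) * 1"
      unfolding distrib_right using ennreal_leI[OF g1[of x]] by (intro add_left_mono mult_left_mono) auto
    finally show "ennreal \<bar>v x - cell_avg \<tau> v (\<lambda>i. \<lfloor>x $ i / \<tau>\<rfloor>)\<bar> * ennreal (g x) \<le>
      ennreal ?d * ennreal (g x) + 2 * (\<integral>\<^sup>+y. W x y \<partial>lborel)" by simp
  qed
  also have "\<dots> = ennreal ?d * (\<integral>\<^sup>+x. ennreal (g x) \<partial>lborel) + 2 * (\<integral>\<^sup>+x. \<integral>\<^sup>+y. W x y \<partial>lborel \<partial>lborel)"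
    by (subst nn_integral_add) (auto simp: nn_integral_cmult)
  also have "(\<integral>\<^sup>+x. \<integral>\<^sup>+y. W x y \<partial>lborel \<partial>lborel) = (\<integral>\<^sup>+y. \<integral>\<^sup>+x. W x y \<partial>lborel \<partial>lborel)"
    by (rule lborel_pair.Fubini') measurable
  also have "\<dots> = (\<integral>\<^sup>+y. dev v ?d (\<chi> i. \<tau> * y $ i) * indicator cube y \<partial>lborel)"
  proof (rule nn_integral_cong)
    fix y :: "real^'n"
    have "(\<integral>\<^sup>+x. W x y \<partial>lborel) = (\<integral>\<^sup>+x. indicator {x. ?d < \<bar>v x - v (x + (\<chi> i. \<tau> * y $ i))\<bar>} x * indicator cube y \<partial>lborel)"
      by (rule nn_integral_cong) (simp add: W_def indicator_def)
    also have "\<dots> = dev v ?d (\<chi> i. \<tau> * y $ i) * indicator cube y"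
      unfolding dev_eq_nn_integral[OF m] by (rule nn_integral_multc) measurable
    finally show "(\<integral>\<^sup>+x. W x y \<partial>lborel) = dev v ?d (\<chi> i. \<tau> * y $ i) * indicator cube y" .
  qed
  also have "\<dots> \<le> (\<Sum>i\<in>UNIV. ennreal (2 ^ (CARD('n) - 1) * c powr - p i) *
        (\<integral>\<^sup>+r. diff_pow i (p i) v (\<tau> * r) * indicator {-1..1} r \<partial>lborel))"
    by (rule nn_integral_dev_cube) (use pos c in auto)
  also have "\<dots> \<le> (\<Sum>i\<in>UNIV. ennreal (2 ^ (CARD('n) - 1) * c powr - p i) *
        (ennreal (\<tau> powr (\<sigma> i * p i)) * gagliardo i (\<sigma> i) (p i) v))"
    by (intro sum_mono mult_left_mono nn_integral_diff_pow_small) (use pos \<tau> in auto)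
  finally have "(\<integral>\<^sup>+x. ennreal \<bar>v x - cell_avg \<tau> v (\<lambda>i. \<lfloor>x $ i / \<tau>\<rfloor>)\<bar> * ennreal (g x) \<partial>lborel) \<le>
    ennreal ?d * (\<integral>\<^sup>+x. ennreal (g x) \<partial>lborel) + 2 * (\<Sum>i\<in>UNIV. ennreal (2 ^ (CARD('n) - 1) * c powr - p i) *
        (ennreal (\<tau> powr (\<sigma> i * p i)) * gagliardo i (\<sigma> i) (p i) v))"
    by (simp add: add_left_mono mult_left_mono)
  also have "2 * (\<Sum>i\<in>UNIV. ennreal (2 ^ (CARD('n) - 1) * c powr - p i) *
        (ennreal (\<tau> powr (\<sigma> i * p i)) * gagliardo i (\<sigma> i) (p i) v)) =
    (\<Sum>i\<in>UNIV. ennreal (2 ^ CARD('n) * c powr - p i * \<tau> powr (\<sigma> i * p i)) * gagliardo i (\<sigma> i) (p i) v)"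
    unfolding sum_distrib_left
  proof (rule sum.cong)
    fix i :: 'n
    have "(2::real) ^ CARD('n) = 2 * 2 ^ (CARD('n) - 1)" by (simp flip: power_Suc)
    then have "ennreal (2 ^ CARD('n) * c powr - p i * \<tau> powr (\<sigma> i * p i)) = ennreal 2 * ennreal (2 ^ (CARD('n) - 1) * c powr - p i) *
        ennreal (\<tau> powr (\<sigma> i * p i))"
      by (subst ennreal_mult[symmetric], simp, simp)+ (simp add: mult.assoc)
    then show "2 * (ennreal (2 ^ (CARD('n) - 1) * c powr - p i) *
        (ennreal (\<tau> powr (\<sigma> i * p i)) * gagliardo i (\<sigma> i) (p i) v)) = ennreal (2 ^ CARD('n) * c powr - p i * \<tau> powr (\<sigma> i * p i)) * gagliardo i (\<sigma> i) (p i) v"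
      by (simp add: mult.assoc)
  qed simp
  finally show ?thesis .
qed

text \<open>Compressing a nonnegative function to values below 1 by this map does not increase any
  directional seminorm.\<close>

lemma divide_one_plus_Lipschitz:
  fixes a b :: real
  assumes "0 \<le> a" "0 \<le> b"
  shows "\<bar>a / (1 + a) - b / (1 + b)\<bar> \<le> \<bar>a - b\<bar>"
proof -
  have "a / (1 + a) - b / (1 + b) = (a - b) / ((1 + a) * (1 + b))"
    using assms by (simp add: divide_simps) algebra
  also have "\<bar>\<dots>\<bar> = \<bar>a - b\<bar> / ((1 + a) * (1 + b))"
    using assms by (simp add: abs_divide abs_mult)
  also have "\<dots> \<le> \<bar>a - b\<bar> / 1"
  proof (rule divide_left_mono)
    have "1 * 1 \<le> (1 + a) * (1 + b)" using assms by (intro mult_mono) auto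
    then show "1 \<le> (1 + a) * (1 + b)" by simp
  qed (use assms in auto)
  finally show ?thesis by simp
qed

text \<open>
  The bounded functions \<open>v k\<close> are compared with their averages over the cells of a grid: the error is
  small uniformly in \<open>k\<close> by the increment bounds, while countably many averages converge along a
  diagonal sequence.  A positive integrable weight \<open>g\<close> replaces localization to balls.
\<close>

lemma compactness_bounded:
  fixes v :: "nat \<Rightarrow> real^'n::finite \<Rightarrow> real"
  assumes m[measurable]: "\<And>k. v k \<in> borel_measurable borel" and v: "\<And>k x. \<bar>v k x\<bar> \<le> 1"
    and pos: "\<And>i. 0 < \<sigma> i" "\<And>i. 0 < p i" and A: "0 \<le> A" "\<And>i k. gagliardo i (\<sigma> i) (p i) (v k) \<le> ennreal A"
  shows "\<exists>r. strict_mono r \<and> (AE x in lborel. convergent (\<lambda>k. v (r k) x))"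
proof -
  let ?n = "real CARD('n)"
  obtain g :: "real^'n \<Rightarrow> real" where g: "g \<in> borel_measurable lborel" "\<And>x. 0 < g x" "\<And>x. g x \<le> 1" "integrable lborel g"
    using sigma_finite_measure.obtain_positive_integrable_function[OF sigma_finite_lborel] by metis
  have [measurable]: "g \<in> borel_measurable borel" using g(1) by simp
  \<comment> \<open>A finite measure with the same null sets as Lebesgue measure: constants become
    integrable, and almost everywhere convergence transfers back because \<open>g\<close> is
    positive.\<close>
  define M where "M = density lborel (\<lambda>x. ennreal (g x))"
  have [measurable_cong]: "sets M = sets borel" by (simp add: M_def)
  define G where "G = (\<integral>x. g x \<partial>lborel)"
  have G: "(\<integral>\<^sup>+x. ennreal (g x) \<partial>lborel) = ennreal G" "0 \<le> G"
    unfolding G_def using g by (auto intro!: nn_integral_eq_integral integral_nonneg_AE simp: less_imp_le)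
  have nnM: "(\<integral>\<^sup>+x. f x \<partial>M) = (\<integral>\<^sup>+x. f x * ennreal (g x) \<partial>lborel)" if "f \<in> borel_measurable borel" for f
    unfolding M_def using that by (subst nn_integral_density) (auto simp: mult.commute)
  have spM: "emeasure M (space M) < \<infinity>"
    using nnM[of "\<lambda>_. 1"] by (simp add: G)
  define E where "E j k x = cell_avg (1 / real (Suc j)) (v k) (\<lambda>i. \<lfloor>x $ i / (1 / real (Suc j))\<rfloor>)" for j k x
  have [measurable]: "E j k \<in> borel_measurable borel" for j k
    unfolding E_def by (rule measurable_cell_avg) measurable
  have E1: "\<bar>E j k x\<bar> \<le> 1" for j k x
    unfolding E_def by (rule cell_avg_bound(2)[OF m v])
  have approx: "\<exists>j. \<forall>k. (\<integral>\<^sup>+x. ennreal \<bar>v k x - E j k x\<bar> \<partial>M) \<le> ennreal e" if "0 < e" for e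
  proof -
    \<comment> \<open>Chosen so that the constant error is at most \<open>e / 2\<close>; the summand
      1 guards against a vanishing \<open>G\<close>. With \<open>c\<close> fixed, the grid is then
      refined.\<close>
    define c where "c = e / (2 * ?n * (G + 1))"
    have c: "0 < c" using G \<open>0 < e\<close> by (simp add: c_def)
    have cG: "?n * c * G \<le> e / 2"
    proof -
      have "?n * c * G = e / 2 * (G / (G + 1))" using G by (simp add: c_def divide_simps)
      also have "\<dots> \<le> e / 2 * 1" using G \<open>0 < e\<close> by (intro mult_left_mono) auto
      finally show ?thesis by simp
    qed
    have "(\<lambda>j. \<Sum>i\<in>UNIV. 2 ^ CARD('n) * c powr - p i * (1 / real (Suc j)) powr (\<sigma> i * p i) * A) \<longlonglongrightarrow>
       (\<Sum>i\<in>(UNIV::'n set). 2 ^ CARD('n) * c powr - p i * 0 * A)"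
    proof (intro tendsto_intros)
      fix i
      have "(\<lambda>j. 1 / real (Suc j)) \<longlonglongrightarrow> 0"
        by (rule LIMSEQ_Suc[OF lim_1_over_n])
      then have "(\<lambda>j. (1 / real (Suc j)) powr (\<sigma> i * p i)) \<longlonglongrightarrow> 0 powr (\<sigma> i * p i)"
        by (rule tendsto_powr2) (use pos[of i] in auto)
      then show "(\<lambda>j. (1 / real (Suc j)) powr (\<sigma> i * p i)) \<longlonglongrightarrow> 0" by simp
    qed
    then have "(\<lambda>j. \<Sum>i\<in>UNIV. 2 ^ CARD('n) * c powr - p i * (1 / real (Suc j)) powr (\<sigma> i * p i) * A) \<longlonglongrightarrow> 0" by simp
    then have "eventually (\<lambda>j. (\<Sum>i\<in>UNIV. 2 ^ CARD('n) * c powr - p i * (1 / real (Suc j)) powr (\<sigma> i * p i) * A) < e / 2) sequentially"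
      using \<open>0 < e\<close> by (intro order_tendstoD) auto
    then obtain j where j: "(\<Sum>i\<in>UNIV. 2 ^ CARD('n) * c powr - p i * (1 / real (Suc j)) powr (\<sigma> i * p i) * A) < e / 2"
      by (auto simp: eventually_sequentially)
    have "(\<integral>\<^sup>+x. ennreal \<bar>v k x - E j k x\<bar> \<partial>M) \<le> ennreal e" for k
    proof -
      have "(\<integral>\<^sup>+x. ennreal \<bar>v k x - E j k x\<bar> \<partial>M) = (\<integral>\<^sup>+x. ennreal \<bar>v k x - E j k x\<bar> * ennreal (g x) \<partial>lborel)"
        by (rule nnM) measurable
      also have "\<dots> \<le> ennreal (?n * c) * ennreal G +
         (\<Sum>i\<in>UNIV. ennreal (2 ^ CARD('n) * c powr - p i * (1 / real (Suc j)) powr (\<sigma> i * p i)) * gagliardo i (\<sigma> i) (p i) (v k))"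
        unfolding E_def G(1)[symmetric]
        by (rule cell_avg_L1) (use v c g pos in auto)
      also have "\<dots> \<le> ennreal (?n * c) * ennreal G +
         (\<Sum>i\<in>UNIV. ennreal (2 ^ CARD('n) * c powr - p i * (1 / real (Suc j)) powr (\<sigma> i * p i)) * ennreal A)"
        by (intro add_left_mono sum_mono mult_left_mono A) auto
      also have "\<dots> = ennreal (?n * c * G + (\<Sum>i\<in>UNIV. 2 ^ CARD('n) * c powr - p i * (1 / real (Suc j)) powr (\<sigma> i * p i) * A))"
        using c G A by (simp add: ennreal_mult[symmetric] sum_nonneg ennreal_plus[symmetric] del: ennreal_plus)
      also have "\<dots> \<le> ennreal e"
        using cG j by (intro ennreal_leI) simp
      finally show ?thesis .
    qed
    then show ?thesis by blast
  qed
  \<comment> \<open>One diagonal sequence for all pairs of a grid level and a cell, available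
    because the averages are bounded by 1.\<close>
  obtain r where r: "strict_mono (r::nat\<Rightarrow>nat)"
    and conv: "\<And>jz. jz \<in> (UNIV :: (nat \<times> ('n \<Rightarrow> int)) set) \<Longrightarrow> \<exists>l. (\<lambda>k. cell_avg (1 / real (Suc (fst jz))) (v (r k)) (snd jz)) \<longlonglongrightarrow> l"
  proof (rule function_convergent_subsequence[of UNIV "\<lambda>k (jz :: nat \<times> ('n \<Rightarrow> int)). cell_avg (1 / real (Suc (fst jz))) (v k) (snd jz)" 1])
    show "countable (UNIV :: (nat \<times> ('n \<Rightarrow> int)) set)" by simp
    show "norm (cell_avg (1 / real (Suc (fst jz))) (v k) (snd jz)) \<le> 1" for k and jz :: "nat \<times> ('n \<Rightarrow> int)"
      using cell_avg_bound(2)[OF m v] by simp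
  qed blast
  have convE: "convergent (\<lambda>k. E j (r k) x)" for j x
    using conv[of "(j, \<lambda>i. \<lfloor>x $ i / (1 / real (Suc j))\<rfloor>)"] unfolding E_def convergent_def by simp
  have "\<exists>N. \<forall>k\<ge>N. \<forall>l\<ge>N. (\<integral>\<^sup>+x. ennreal \<bar>v (r k) x - v (r l) x\<bar> \<partial>M) \<le> ennreal e" if "0 < e" for e
  proof -
    obtain j where j: "\<And>k. (\<integral>\<^sup>+x. ennreal \<bar>v k x - E j k x\<bar> \<partial>M) \<le> ennreal (e / 4)"
      using approx[of "e / 4"] \<open>0 < e\<close> by auto
    define w where "w x = lim (\<lambda>k. E j (r k) x)" for x
    have [measurable]: "w \<in> borel_measurable borel" unfolding w_def by measurable
    have lim: "(\<lambda>k. E j (r k) x) \<longlonglongrightarrow> w x" for x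
      unfolding w_def using convE by (simp add: convergent_LIMSEQ_iff)
    \<comment> \<open>Pointwise convergence of the averages becomes convergence in L^1 of
      \<open>M\<close>, the constant 1 being an integrable bound. Two approximation errors and two
      such terms then make up \<open>e\<close>.\<close>
    have "(\<lambda>k. \<integral>\<^sup>+x. ennreal (norm (w x - E j (r k) x)) \<partial>M) \<longlonglongrightarrow> 0"
    proof (rule nn_integral_dominated_convergence_norm)
      show "AE x in M. norm (E j (r k) x) \<le> 1" for k using E1 by simp
      show "(\<integral>\<^sup>+x. ennreal 1 \<partial>M) < \<infinity>" using spM by simp
    qed (use lim in auto)
    then have "eventually (\<lambda>k. (\<integral>\<^sup>+x. ennreal (norm (w x - E j (r k) x)) \<partial>M) < ennreal (e / 4)) sequentially"
      by (rule order_tendstoD) (use \<open>0 < e\<close> in auto)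
    then obtain N where N: "\<And>k. N \<le> k \<Longrightarrow> (\<integral>\<^sup>+x. ennreal (norm (w x - E j (r k) x)) \<partial>M) \<le> ennreal (e / 4)"
      unfolding eventually_sequentially by (metis less_imp_le)
    have "(\<integral>\<^sup>+x. ennreal \<bar>v (r k) x - v (r l) x\<bar> \<partial>M) \<le> ennreal e" if "N \<le> k" "N \<le> l" for k l
    proof -
      have "(\<integral>\<^sup>+x. ennreal \<bar>v (r k) x - v (r l) x\<bar> \<partial>M) \<le> (\<integral>\<^sup>+x. (ennreal \<bar>v (r k) x - E j (r k) x\<bar> + ennreal (norm (w x - E j (r k) x))) +
         (ennreal \<bar>v (r l) x - E j (r l) x\<bar> + ennreal (norm (w x - E j (r l) x))) \<partial>M)"
        by (rule nn_integral_mono) (simp add: ennreal_plus[symmetric] ennreal_leI del: ennreal_plus)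
      also have "\<dots> = ((\<integral>\<^sup>+x. ennreal \<bar>v (r k) x - E j (r k) x\<bar> \<partial>M) + (\<integral>\<^sup>+x. ennreal (norm (w x - E j (r k) x)) \<partial>M)) +
         ((\<integral>\<^sup>+x. ennreal \<bar>v (r l) x - E j (r l) x\<bar> \<partial>M) + (\<integral>\<^sup>+x. ennreal (norm (w x - E j (r l) x)) \<partial>M))"
        by (simp add: nn_integral_add)
      also have "\<dots> \<le> (ennreal (e/4) + ennreal (e/4)) + (ennreal (e/4) + ennreal (e/4))"
        by (intro add_mono j N that)
      also have "\<dots> = ennreal e" using \<open>0 < e\<close> by (simp add: ennreal_plus[symmetric] del: ennreal_plus)
      finally show ?thesis .
    qed
    then show ?thesis by blast
  qed
  from L1_Cauchy_AE_subseq[of "\<lambda>k. v (r k)", OF _ this]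
  obtain r' where r': "strict_mono r'" and ae: "AE x in M. convergent (\<lambda>k. v (r (r' k)) x)"
    by auto
  have "AE x in lborel. convergent (\<lambda>k. v (r (r' k)) x)"
    using ae g(2) unfolding M_def by (subst (asm) AE_density) auto
  then show ?thesis using strict_mono_o[OF r r'] by (auto simp: o_def)
qed

text \<open>Compactness is applied to u / (1 + u). Its limit could equal 1 where the sequence
  escapes to infinity; Fatou's lemma and the mass bound exclude this almost everywhere, and the
  compression can be inverted.\<close>

lemma compactness_AE:
  fixes u :: "nat \<Rightarrow> real^'n::finite \<Rightarrow> real"
  assumes m[measurable]: "\<And>k. u k \<in> borel_measurable borel" and nn: "\<And>k x. 0 \<le> u k x" and q: "0 < q"
    and mass: "\<And>k. mass q (u k) \<le> 1"
    and pos: "\<And>i. 0 < \<sigma> i" "\<And>i. 0 < p i" and A: "0 \<le> A" "\<And>i k. gagliardo i (\<sigma> i) (p i) (u k) \<le> ennreal A"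
  shows "\<exists>r w. strict_mono r \<and> w \<in> borel_measurable borel \<and> (\<forall>x. 0 \<le> w x) \<and> (AE x in lborel. (\<lambda>k. u (r k) x) \<longlonglongrightarrow> w x)"
proof -
  define v where "v k x = u k x / (1 + u k x)" for k x
  have [measurable]: "v k \<in> borel_measurable borel" for k unfolding v_def by measurable
  have v1: "v k x < 1" "0 \<le> v k x" for k x using nn[of k x] by (auto simp: v_def)
  have "\<exists>r. strict_mono r \<and> (AE x in lborel. convergent (\<lambda>k. v (r k) x))"
  proof (rule compactness_bounded)
    show "\<bar>v k x\<bar> \<le> 1" for k x using v1[of k x] by simp
    show "gagliardo i (\<sigma> i) (p i) (v k) \<le> ennreal A" for i k
      by (rule order_trans[OF gagliardo_mono[where v="u k"] A(2)]) (use pos nn divide_one_plus_Lipschitz in \<open>auto simp: v_def\<close>)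
  qed (use pos A in auto)
  then obtain r where r: "strict_mono r" and ae: "AE x in lborel. convergent (\<lambda>k. v (r k) x)" by auto
  have "(\<integral>\<^sup>+x. liminf (\<lambda>k. ennreal (\<bar>u (r k) x\<bar> powr q)) \<partial>lborel) \<le> liminf (\<lambda>k. mass q (u (r k)))"
    unfolding mass_def by (rule nn_integral_liminf) measurable
  also have "\<dots> \<le> 1"
    by (rule Liminf_le) (simp_all add: mass)
  finally have "(\<integral>\<^sup>+x. liminf (\<lambda>k. ennreal (\<bar>u (r k) x\<bar> powr q)) \<partial>lborel) < \<infinity>"
    by (rule le_less_trans) simp
  then have "AE x in lborel. liminf (\<lambda>k. ennreal (\<bar>u (r k) x\<bar> powr q)) \<noteq> \<infinity>"
    by (intro nn_integral_PInf_AE) auto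
  with ae have conv: "AE x in lborel. convergent (\<lambda>k. u (r k) x)"
  proof eventually_elim
    case (elim x)
    then obtain l where l: "(\<lambda>k. v (r k) x) \<longlonglongrightarrow> l" by (auto simp: convergent_def)
    have "l \<le> 1" by (rule LIMSEQ_le_const2[OF l]) (use v1 less_imp_le in blast)
    moreover have "l \<noteq> 1"
    proof
      assume "l = 1"
      \<comment> \<open>A limit 1 makes the original sequence eventually exceed every bound, so the
        liminf of its q-th powers would be infinite.\<close>
      have "of_nat B \<le> liminf (\<lambda>k. ennreal (\<bar>u (r k) x\<bar> powr q))" for B :: nat
      proof (rule Liminf_bounded)
        let ?b = "real B powr (1 / q)"
        have "?b / (1 + ?b) < 1" by (simp add: add_pos_nonneg)
        then have "eventually (\<lambda>k. ?b / (1 + ?b) < v (r k) x) sequentially"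
          using l \<open>l = 1\<close> by (intro order_tendstoD) auto
        then show "eventually (\<lambda>k. of_nat B \<le> ennreal (\<bar>u (r k) x\<bar> powr q)) sequentially"
        proof eventually_elim
          case (elim k)
          have "?b < u (r k) x"
          proof -
            have "0 < 1 + ?b" "0 < 1 + u (r k) x" using nn[of "r k" x] by (auto simp: add_pos_nonneg)
            then have "?b * (1 + u (r k) x) < u (r k) x * (1 + ?b)"
              using elim by (simp add: v_def divide_simps mult.commute)
            then show ?thesis by (simp add: algebra_simps)
          qed
          then have "?b powr q \<le> u (r k) x powr q" using q by (intro powr_mono2) auto
          then have "real B \<le> \<bar>u (r k) x\<bar> powr q" using q nn[of "r k" x] by (simp add: powr_powr)
          then show ?case by (simp add: ennreal_of_nat_eq_real_of_nat ennreal_leI)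
        qed
      qed
      then have "liminf (\<lambda>k. ennreal (\<bar>u (r k) x\<bar> powr q)) = \<infinity>"
        by (metis ennreal_Ex_less_of_nat infinity_ennreal_def leD top.not_eq_extremum)
      then show False using elim by simp
    qed
    ultimately have "l < 1" by simp
    have "(\<lambda>k. v (r k) x / (1 - v (r k) x)) \<longlonglongrightarrow> l / (1 - l)"
      using l \<open>l < 1\<close> by (intro tendsto_intros) auto
    moreover have "v (r k) x / (1 - v (r k) x) = u (r k) x" for k
      using nn[of "r k" x] by (simp add: v_def field_simps)
    ultimately show ?case by (auto simp: convergent_def)
  qed
  \<comment> \<open>The absolute value makes \<open>w\<close> nonnegative everywhere, including the
    null set where the sequence diverges and \<open>lim\<close> is arbitrary.\<close>
  define w where "w x = \<bar>lim (\<lambda>k. u (r k) x)\<bar>" for x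
  have "w \<in> borel_measurable borel" unfolding w_def by measurable
  moreover have "AE x in lborel. (\<lambda>k. u (r k) x) \<longlonglongrightarrow> w x"
    using conv
  proof eventually_elim
    case (elim x)
    then have l: "(\<lambda>k. u (r k) x) \<longlonglongrightarrow> lim (\<lambda>k. u (r k) x)" by (simp add: convergent_LIMSEQ_iff)
    then have "0 \<le> lim (\<lambda>k. u (r k) x)" by (rule LIMSEQ_le_const) (use nn in blast)
    with l show ?case by (simp add: w_def)
  qed
  moreover have "\<forall>x. 0 \<le> w x" by (simp add: w_def)
  ultimately show ?thesis using r by blast
qed

section \<open>The Brezis--Lieb lemma\<close>

text \<open>By homogeneity only the ratio of b to a matters. For a small ratio, continuity of the
  power at 1 gives the factor \<open>e\<close>; for a large ratio, a itself is controlled by b. No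
  convexity enters, so every positive exponent is covered.\<close>

lemma powr_add_close:
  fixes p e :: real
  assumes p: "0 < p" and e: "0 < e"
  shows "\<exists>C\<ge>0. \<forall>a b :: real. \<bar>\<bar>a + b\<bar> powr p - \<bar>a\<bar> powr p\<bar> \<le> e * \<bar>a\<bar> powr p + C * \<bar>b\<bar> powr p"
proof -
  have "((\<lambda>h. (1 + h) powr p) \<longlongrightarrow> (1 + 0) powr p) (at_right 0)" "((\<lambda>h. (1 - h) powr p) \<longlongrightarrow> (1 - 0) powr p) (at_right 0)"
    by (intro tendsto_powr tendsto_add tendsto_diff tendsto_const tendsto_ident_at; simp)+
  then have "eventually (\<lambda>h. (1 + h) powr p < 1 + e) (at_right 0)" "eventually (\<lambda>h. 1 - e < (1 - h) powr p) (at_right 0)"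
    using order_tendstoD(2)[of _ _ "at_right 0" "1 + e"] order_tendstoD(1)[of _ _ "at_right 0" "1 - e"] e by force+
  moreover have "eventually (\<lambda>h::real. 0 < h \<and> h < 1) (at_right 0)"
    using eventually_at_right_less[of "0::real"] eventually_at_right_real[OF zero_less_one[where 'a = real]] by eventually_elim auto
  ultimately have "eventually (\<lambda>h. 0 < h \<and> h < 1 \<and> (1 + h) powr p < 1 + e \<and> 1 - e < (1 - h) powr p) (at_right 0)"
    by eventually_elim auto
  from eventually_happens'[OF _ this] obtain h where h: "0 < h" "h < 1" "(1 + h) powr p < 1 + e" "1 - e < (1 - h) powr p"
    by auto
  \<comment> \<open>If |b| exceeds h|a|, then |a| is at most |b|/h and |a + b| at most (1/h + 1)|b|;
    the two powers are added.\<close>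
  let ?C = "(1 / h + 1) powr p + (1 / h) powr p"
  show ?thesis
  proof (intro exI[of _ ?C] conjI allI)
    fix a b :: real
    show "\<bar>\<bar>a + b\<bar> powr p - \<bar>a\<bar> powr p\<bar> \<le> e * \<bar>a\<bar> powr p + ?C * \<bar>b\<bar> powr p"
    proof (cases "\<bar>b\<bar> \<le> h * \<bar>a\<bar>")
      case True
      have "\<bar>a + b\<bar> \<le> (1 + h) * \<bar>a\<bar>" "(1 - h) * \<bar>a\<bar> \<le> \<bar>a + b\<bar>"
        using True by (auto simp: algebra_simps)
      then have "\<bar>a + b\<bar> powr p \<le> ((1 + h) * \<bar>a\<bar>) powr p" "((1 - h) * \<bar>a\<bar>) powr p \<le> \<bar>a + b\<bar> powr p"
        using h p by (auto intro!: powr_mono2)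
      then have "\<bar>a + b\<bar> powr p \<le> (1 + h) powr p * \<bar>a\<bar> powr p" "(1 - h) powr p * \<bar>a\<bar> powr p \<le> \<bar>a + b\<bar> powr p"
        using h by (auto simp: powr_mult)
      moreover have "(1 + h) powr p * \<bar>a\<bar> powr p \<le> (1 + e) * \<bar>a\<bar> powr p" "(1 - e) * \<bar>a\<bar> powr p \<le> (1 - h) powr p * \<bar>a\<bar> powr p"
        using h by (auto intro!: mult_right_mono)
      ultimately have "\<bar>\<bar>a + b\<bar> powr p - \<bar>a\<bar> powr p\<bar> \<le> e * \<bar>a\<bar> powr p"
        by (simp add: algebra_simps abs_le_iff)
      also have "\<dots> \<le> e * \<bar>a\<bar> powr p + ?C * \<bar>b\<bar> powr p" by simp
      finally show ?thesis .
    next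
      case False
      then have a: "\<bar>a\<bar> \<le> 1 / h * \<bar>b\<bar>" using h by (simp add: field_simps)
      then have "\<bar>a + b\<bar> \<le> (1 / h + 1) * \<bar>b\<bar>" by (simp add: algebra_simps)
      then have "\<bar>a + b\<bar> powr p \<le> ((1 / h + 1) * \<bar>b\<bar>) powr p" "\<bar>a\<bar> powr p \<le> (1 / h * \<bar>b\<bar>) powr p"
        using p a by (auto intro!: powr_mono2)
      then have "\<bar>a + b\<bar> powr p \<le> (1 / h + 1) powr p * \<bar>b\<bar> powr p" "\<bar>a\<bar> powr p \<le> (1 / h) powr p * \<bar>b\<bar> powr p"
        using h by (auto simp only: powr_mult)
      moreover have "\<bar>\<bar>a + b\<bar> powr p - \<bar>a\<bar> powr p\<bar> \<le> \<bar>a + b\<bar> powr p + \<bar>a\<bar> powr p"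
        using powr_ge_zero[of "\<bar>a + b\<bar>" p] powr_ge_zero[of "\<bar>a\<bar>" p] by linarith
      moreover have "0 \<le> e * \<bar>a\<bar> powr p" using e by simp
      ultimately show ?thesis unfolding distrib_right by linarith
    qed
  qed simp
qed

lemma abs_diff_powr_le:
  fixes p a b :: real
  assumes p: "0 < p"
  shows "\<bar>a - b\<bar> powr p \<le> 2 powr p * (\<bar>a\<bar> powr p + \<bar>b\<bar> powr p)"
proof -
  have "\<bar>a - b\<bar> powr p \<le> (2 * max \<bar>a\<bar> \<bar>b\<bar>) powr p"
    using p by (intro powr_mono2) auto
  also have "\<dots> = 2 powr p * max \<bar>a\<bar> \<bar>b\<bar> powr p" by (simp add: powr_mult)
  also have "\<dots> \<le> 2 powr p * (\<bar>a\<bar> powr p + \<bar>b\<bar> powr p)"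
    by (intro mult_left_mono) (auto simp: max_def)
  finally show ?thesis .
qed

text \<open>The defect \<open>?R\<close> has no integrable majorant of its own. After subtracting a
  small multiple of the power of f k - g, the positive part is dominated by a multiple of the power
  of g and tends to 0; the subtracted piece has a uniformly small integral.\<close>

lemma Brezis_Lieb:
  fixes f :: "nat \<Rightarrow> 'a \<Rightarrow> real" and p A :: real
  assumes [measurable]: "\<And>k. f k \<in> borel_measurable M" "g \<in> borel_measurable M"
    and p: "0 < p" and A: "0 \<le> A" "\<And>k. (\<integral>\<^sup>+x. ennreal (\<bar>f k x\<bar> powr p) \<partial>M) \<le> ennreal A"
    and lim: "AE x in M. (\<lambda>k. f k x) \<longlonglongrightarrow> g x"
  shows "(\<integral>\<^sup>+x. ennreal (\<bar>g x\<bar> powr p) \<partial>M) \<le> ennreal A"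
    and "(\<integral>\<^sup>+x. ennreal (\<bar>f k x - g x\<bar> powr p) \<partial>M) < \<infinity>"
    and "(\<lambda>k. enn2real (\<integral>\<^sup>+x. ennreal (\<bar>f k x\<bar> powr p) \<partial>M) - enn2real (\<integral>\<^sup>+x. ennreal (\<bar>f k x - g x\<bar> powr p) \<partial>M))
       \<longlonglongrightarrow> enn2real (\<integral>\<^sup>+x. ennreal (\<bar>g x\<bar> powr p) \<partial>M)"
proof -
  have limp: "AE x in M. (\<lambda>k. \<bar>f k x\<bar> powr p) \<longlonglongrightarrow> \<bar>g x\<bar> powr p"
    using lim
  proof eventually_elim
    case (elim x)
    show ?case by (rule tendsto_powr2) (use elim p in \<open>auto intro: tendsto_rabs\<close>)
  qed
  have "(\<integral>\<^sup>+x. ennreal (\<bar>g x\<bar> powr p) \<partial>M) = (\<integral>\<^sup>+x. liminf (\<lambda>k. ennreal (\<bar>f k x\<bar> powr p)) \<partial>M)"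
  proof (rule nn_integral_cong_AE, use limp in eventually_elim)
    case (elim x)
    then have "(\<lambda>k. ennreal (\<bar>f k x\<bar> powr p)) \<longlonglongrightarrow> ennreal (\<bar>g x\<bar> powr p)" by (rule tendsto_ennrealI)
    from lim_imp_Liminf[OF _ this] show ?case by simp
  qed
  also have "\<dots> \<le> liminf (\<lambda>k. \<integral>\<^sup>+x. ennreal (\<bar>f k x\<bar> powr p) \<partial>M)"
    by (rule nn_integral_liminf) measurable
  also have "\<dots> \<le> ennreal A"
    by (rule Liminf_le) (simp_all add: A)
  finally show gA: "(\<integral>\<^sup>+x. ennreal (\<bar>g x\<bar> powr p) \<partial>M) \<le> ennreal A" .
  define B where "B = 2 powr p * (A + A)"
  have B: "0 \<le> B" using A by (simp add: B_def)
  have dB: "(\<integral>\<^sup>+x. ennreal (\<bar>f k x - g x\<bar> powr p) \<partial>M) \<le> ennreal B" for k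
  proof -
    have "(\<integral>\<^sup>+x. ennreal (\<bar>f k x - g x\<bar> powr p) \<partial>M) \<le> (\<integral>\<^sup>+x. ennreal (2 powr p) * (ennreal (\<bar>f k x\<bar> powr p) + ennreal (\<bar>g x\<bar> powr p)) \<partial>M)"
      by (rule nn_integral_mono) (simp add: ennreal_mult[symmetric] ennreal_plus[symmetric] abs_diff_powr_le[OF p] ennreal_leI del: ennreal_plus)
    also have "\<dots> = ennreal (2 powr p) * ((\<integral>\<^sup>+x. ennreal (\<bar>f k x\<bar> powr p) \<partial>M) + (\<integral>\<^sup>+x. ennreal (\<bar>g x\<bar> powr p) \<partial>M))"
      by (simp add: nn_integral_cmult nn_integral_add)
    also have "\<dots> \<le> ennreal (2 powr p) * (ennreal A + ennreal A)"
      by (intro mult_left_mono add_mono A gA) simp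
    also have "\<dots> = ennreal B"
      using A by (simp add: B_def ennreal_mult[symmetric] ennreal_plus[symmetric] del: ennreal_plus)
    finally show ?thesis .
  qed
  show "(\<integral>\<^sup>+x. ennreal (\<bar>f k x - g x\<bar> powr p) \<partial>M) < \<infinity>"
    by (rule le_less_trans[OF dB]) simp
  have int: "integrable M (\<lambda>x. \<bar>f k x\<bar> powr p)" "integrable M (\<lambda>x. \<bar>g x\<bar> powr p)" "integrable M (\<lambda>x. \<bar>f k x - g x\<bar> powr p)" for k
    using le_less_trans[OF A(2)[of k]] le_less_trans[OF gA] le_less_trans[OF dB[of k]]
    by (auto intro!: integrableI_nonneg)
  let ?R = "\<lambda>k x. \<bar>f k x\<bar> powr p - \<bar>f k x - g x\<bar> powr p - \<bar>g x\<bar> powr p"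
  have R: "(\<lambda>k. \<integral>\<^sup>+x. ennreal \<bar>?R k x\<bar> \<partial>M) \<longlonglongrightarrow> 0"
  proof (rule order_tendstoI)
    fix e :: ennreal assume "0 < e"
    \<comment> \<open>The given bound may be infinite in \<open>ennreal\<close>; \<open>e'\<close>
      is a finite positive number below it.\<close>
    define e' where "e' = (if e = \<infinity> then 1 else enn2real e)"
    have e': "0 < e'" "ennreal e' \<le> e" using \<open>0 < e\<close> by (auto simp: e'_def enn2real_positive_iff top.not_eq_extremum)
    define d where "d = e' / (2 * (B + 1))"
    have d: "0 < d" using e' B by (simp add: d_def)
    have dBe: "d * B \<le> e' / 2"
    proof -
      have "d * B = e' / 2 * (B / (B + 1))" using B by (simp add: d_def divide_simps)
      also have "\<dots> \<le> e' / 2 * 1" using B e' by (intro mult_left_mono) auto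
      finally show ?thesis by simp
    qed
    obtain C where C: "0 \<le> C" "\<And>a b :: real. \<bar>\<bar>a + b\<bar> powr p - \<bar>a\<bar> powr p\<bar> \<le> d * \<bar>a\<bar> powr p + C * \<bar>b\<bar> powr p"
      using powr_add_close[OF p d] by auto
    \<comment> \<open>The portion of the defect to which dominated convergence applies;
      \<open>d\<close> was chosen so that what is left over integrates to at most
      \<open>e' / 2\<close>.\<close>
    define W where "W k x = max 0 (\<bar>?R k x\<bar> - d * \<bar>f k x - g x\<bar> powr p)" for k x
    have [measurable]: "W k \<in> borel_measurable M" for k unfolding W_def by measurable
    have "(\<lambda>k. \<integral>\<^sup>+x. ennreal (norm (0 - W k x)) \<partial>M) \<longlonglongrightarrow> 0"
    proof (rule nn_integral_dominated_convergence_norm)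
      have tri: "\<bar>X - Y - Z\<bar> - a \<le> b + Z" if "\<bar>X - Y\<bar> \<le> a + b" "0 \<le> Z" for X Y Z a b :: real
        using that by arith
      show "AE x in M. norm (W k x) \<le> (C + 1) * \<bar>g x\<bar> powr p" for k
      proof (rule AE_I2)
        fix x
        have "\<bar>\<bar>f k x\<bar> powr p - \<bar>f k x - g x\<bar> powr p\<bar> \<le> d * \<bar>f k x - g x\<bar> powr p + C * \<bar>g x\<bar> powr p"
          using C(2)[of "f k x - g x" "g x"] by simp
        then have "\<bar>?R k x\<bar> - d * \<bar>f k x - g x\<bar> powr p \<le> C * \<bar>g x\<bar> powr p + \<bar>g x\<bar> powr p"
          by (rule tri) simp
        then show "norm (W k x) \<le> (C + 1) * \<bar>g x\<bar> powr p"
          using C(1) by (simp add: W_def distrib_right)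
      qed
      have "(\<integral>\<^sup>+x. ennreal ((C + 1) * \<bar>g x\<bar> powr p) \<partial>M) = ennreal (C + 1) * (\<integral>\<^sup>+x. ennreal (\<bar>g x\<bar> powr p) \<partial>M)"
        using C(1) by (simp add: ennreal_mult nn_integral_cmult)
      also have "\<dots> < \<infinity>" using le_less_trans[OF gA] by (auto simp: ennreal_mult_less_top)
      finally show "(\<integral>\<^sup>+x. ennreal ((C + 1) * \<bar>g x\<bar> powr p) \<partial>M) < \<infinity>" .
      show "AE x in M. (\<lambda>k. W k x) \<longlonglongrightarrow> 0"
        using lim limp
      proof eventually_elim
        case (elim x)
        have z: "(\<lambda>k. \<bar>f k x - g x\<bar>) \<longlonglongrightarrow> 0"
          using elim(1) by (simp add: LIM_zero tendsto_rabs_zero)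
        have "(\<lambda>k. \<bar>f k x - g x\<bar> powr p) \<longlonglongrightarrow> 0 powr p"
          by (rule tendsto_powr2) (use p z in auto)
        then have z: "(\<lambda>k. \<bar>f k x - g x\<bar> powr p) \<longlonglongrightarrow> 0" by simp
        have "(\<lambda>k. W k x) \<longlonglongrightarrow> max 0 (\<bar>\<bar>g x\<bar> powr p - 0 - \<bar>g x\<bar> powr p\<bar> - d * 0)"
          unfolding W_def by (intro tendsto_intros elim z)
        then show ?case by simp
      qed
    qed auto
    then have "eventually (\<lambda>k. (\<integral>\<^sup>+x. ennreal (norm (0 - W k x)) \<partial>M) < ennreal (e' / 2)) sequentially"
      by (rule order_tendstoD) (use e' in auto)
    then show "eventually (\<lambda>k. (\<integral>\<^sup>+x. ennreal \<bar>?R k x\<bar> \<partial>M) < e) sequentially"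
    proof eventually_elim
      case (elim k)
      have "(\<integral>\<^sup>+x. ennreal \<bar>?R k x\<bar> \<partial>M) \<le> (\<integral>\<^sup>+x. ennreal (norm (0 - W k x)) + ennreal d * ennreal (\<bar>f k x - g x\<bar> powr p) \<partial>M)"
      proof (rule nn_integral_mono)
        fix x
        have W0: "0 \<le> W k x" by (simp add: W_def)
        have "r \<le> max 0 (r - s) + s" for r s :: real by simp
        then have "\<bar>?R k x\<bar> \<le> W k x + d * \<bar>f k x - g x\<bar> powr p" unfolding W_def .
        then have "ennreal \<bar>?R k x\<bar> \<le> ennreal (W k x + d * \<bar>f k x - g x\<bar> powr p)" by (rule ennreal_leI)
        also have "\<dots> = ennreal (norm (0 - W k x)) + ennreal d * ennreal (\<bar>f k x - g x\<bar> powr p)"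
          using W0 d by (simp add: ennreal_mult)
        finally show "ennreal \<bar>?R k x\<bar> \<le> ennreal (norm (0 - W k x)) + ennreal d * ennreal (\<bar>f k x - g x\<bar> powr p)" .
      qed
      also have "\<dots> = (\<integral>\<^sup>+x. ennreal (norm (0 - W k x)) \<partial>M) + ennreal d * (\<integral>\<^sup>+x. ennreal (\<bar>f k x - g x\<bar> powr p) \<partial>M)"
        by (subst nn_integral_add) (auto simp: nn_integral_cmult)
      also have "\<dots> \<le> (\<integral>\<^sup>+x. ennreal (norm (0 - W k x)) \<partial>M) + ennreal d * ennreal B"
        by (intro add_left_mono mult_left_mono dB) simp
      also have "\<dots> \<le> (\<integral>\<^sup>+x. ennreal (norm (0 - W k x)) \<partial>M) + ennreal (e' / 2)"
        using d B dBe by (intro add_left_mono) (simp add: ennreal_mult[symmetric] ennreal_leI)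
      also have "\<dots> < ennreal (e' / 2) + ennreal (e' / 2)"
        by (subst add.commute) (use elim in \<open>simp only: ennreal_add_left_cancel_less, simp\<close>)
      also have "\<dots> = ennreal e'" using e' by (simp add: ennreal_plus[symmetric] del: ennreal_plus)
      finally show ?case using e' by (rule_tac less_le_trans)
    qed
  qed simp
  have "(\<lambda>k. enn2real (\<integral>\<^sup>+x. ennreal \<bar>?R k x\<bar> \<partial>M)) \<longlonglongrightarrow> 0"
    by (intro tendsto_enn2real) (simp_all add: R)
  then have "(\<lambda>k. enn2real (\<integral>\<^sup>+x. ennreal (\<bar>f k x\<bar> powr p) \<partial>M) - enn2real (\<integral>\<^sup>+x. ennreal (\<bar>f k x - g x\<bar> powr p) \<partial>M)
     - enn2real (\<integral>\<^sup>+x. ennreal (\<bar>g x\<bar> powr p) \<partial>M)) \<longlonglongrightarrow> 0"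
  proof (rule Lim_null_comparison[rotated, where g = "\<lambda>k. enn2real (\<integral>\<^sup>+x. ennreal \<bar>?R k x\<bar> \<partial>M)", simplified])
    show "eventually (\<lambda>k. norm (enn2real (\<integral>\<^sup>+x. ennreal (\<bar>f k x\<bar> powr p) \<partial>M) - enn2real (\<integral>\<^sup>+x. ennreal (\<bar>f k x - g x\<bar> powr p) \<partial>M)
     - enn2real (\<integral>\<^sup>+x. ennreal (\<bar>g x\<bar> powr p) \<partial>M)) \<le> enn2real (\<integral>\<^sup>+x. ennreal \<bar>?R k x\<bar> \<partial>M)) sequentially"
    proof (rule always_eventually, rule allI)
      fix k
      have "(\<integral>x. ?R k x \<partial>M) = (\<integral>x. \<bar>f k x\<bar> powr p \<partial>M) - (\<integral>x. \<bar>f k x - g x\<bar> powr p \<partial>M) - (\<integral>x. \<bar>g x\<bar> powr p \<partial>M)"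
        using int by simp
      moreover have "norm (\<integral>x. ?R k x \<partial>M) \<le> (\<integral>x. \<bar>?R k x\<bar> \<partial>M)"
        using integral_norm_bound[of M "?R k"] by simp
      ultimately show "norm (enn2real (\<integral>\<^sup>+x. ennreal (\<bar>f k x\<bar> powr p) \<partial>M) - enn2real (\<integral>\<^sup>+x. ennreal (\<bar>f k x - g x\<bar> powr p) \<partial>M)
     - enn2real (\<integral>\<^sup>+x. ennreal (\<bar>g x\<bar> powr p) \<partial>M)) \<le> enn2real (\<integral>\<^sup>+x. ennreal \<bar>?R k x\<bar> \<partial>M)"
        by (simp add: integral_eq_nn_integral)
    qed
  qed
  then show "(\<lambda>k. enn2real (\<integral>\<^sup>+x. ennreal (\<bar>f k x\<bar> powr p) \<partial>M) - enn2real (\<integral>\<^sup>+x. ennreal (\<bar>f k x - g x\<bar> powr p) \<partial>M))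
       \<longlonglongrightarrow> enn2real (\<integral>\<^sup>+x. ennreal (\<bar>g x\<bar> powr p) \<partial>M)"
    by (rule LIM_zero_cancel)
qed

text \<open>The seminorm is the p-th power of an L^p norm on the space of pairs (x, h), of a
  weighted difference that is linear in the function, so the general lemma applies there.\<close>

lemma Brezis_Lieb_gagliardo:
  fixes u :: "nat \<Rightarrow> real^'n::finite \<Rightarrow> real"
  assumes [measurable]: "\<And>k. u k \<in> borel_measurable borel" "w \<in> borel_measurable borel"
    and p: "0 < p" and A: "0 \<le> A" "\<And>k. gagliardo i \<sigma> p (u k) \<le> ennreal A"
    and lim: "AE x in lborel. (\<lambda>k. u k x) \<longlonglongrightarrow> w x"
  shows "gagliardo i \<sigma> p w \<le> ennreal A"
    and "gagliardo i \<sigma> p (\<lambda>x. u k x - w x) < \<infinity>"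
    and "(\<lambda>k. enn2real (gagliardo i \<sigma> p (u k)) - enn2real (gagliardo i \<sigma> p (\<lambda>x. u k x - w x)))
       \<longlonglongrightarrow> enn2real (gagliardo i \<sigma> p w)"
proof -
  \<comment> \<open>The p-th root of the kernel, to be absorbed into the function.\<close>
  let ?e = "- (1 + \<sigma> * p) / p"
  define F where "F v z = (v (fst z) - v (fst z + snd z *\<^sub>R axis i 1)) * \<bar>snd z\<bar> powr ?e"
    for v :: "real^'n \<Rightarrow> real" and z :: "(real^'n) \<times> real"
  have Fm[measurable]: "F v \<in> borel_measurable (lborel \<Otimes>\<^sub>M lborel)" if [measurable]: "v \<in> borel_measurable borel" for v
    unfolding F_def by measurable
  have G: "gagliardo i \<sigma> p v = (\<integral>\<^sup>+z. ennreal (\<bar>F v z\<bar> powr p) \<partial>(lborel \<Otimes>\<^sub>M lborel))" if "v \<in> borel_measurable borel" for v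
    unfolding gagliardo_eq_pair[OF that] F_def using p by (simp add: abs_mult powr_mult powr_powr)
  have D: "F (\<lambda>x. u k x - w x) z = F (u k) z - F w z" for k z
    by (simp add: F_def algebra_simps)
  have GD: "gagliardo i \<sigma> p (\<lambda>x. u k x - w x) = (\<integral>\<^sup>+z. ennreal (\<bar>F (u k) z - F w z\<bar> powr p) \<partial>(lborel \<Otimes>\<^sub>M lborel))" for k
    unfolding D[symmetric] by (rule G) measurable
  have limF: "AE z in lborel \<Otimes>\<^sub>M lborel. (\<lambda>k. F (u k) z) \<longlonglongrightarrow> F w z"
    using AE_lborel_pair_translate[OF lim, of "axis i 1"]
    by eventually_elim (auto simp: F_def intro!: tendsto_intros)
  have GA: "(\<integral>\<^sup>+z. ennreal (\<bar>F (u k) z\<bar> powr p) \<partial>(lborel \<Otimes>\<^sub>M lborel)) \<le> ennreal A" for k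
    using A(2)[of k] by (simp add: G)
  note BL = Brezis_Lieb[of "\<lambda>k. F (u k)", OF Fm Fm p A(1) GA limF]
  show "gagliardo i \<sigma> p w \<le> ennreal A" using BL(1) by (simp add: G)
  show "gagliardo i \<sigma> p (\<lambda>x. u k x - w x) < \<infinity>" unfolding GD by (rule BL(2)) auto
  show "(\<lambda>k. enn2real (gagliardo i \<sigma> p (u k)) - enn2real (gagliardo i \<sigma> p (\<lambda>x. u k x - w x)))
       \<longlonglongrightarrow> enn2real (gagliardo i \<sigma> p w)"
    unfolding GD using BL(3) by (simp add: G)
qed

section \<open>Existence of minimizers\<close>

lemma measurable_comp_vec_affine:
  fixes u :: "real^'n::finite \<Rightarrow> real"
  assumes [measurable]: "u \<in> borel_measurable borel"
  shows "(\<lambda>x. a * u (y + (\<chi> i. l i * x $ i))) \<in> borel_measurable borel"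
  by measurable

text \<open>Applied to m and to 1 - m, this makes the two powers sum to more than 1, which rules out
  a splitting of the mass.\<close>

lemma powr_gt_self:
  fixes m t :: real
  assumes "0 < m" "m < 1" "t < 1"
  shows "m < m powr t"
proof -
  have "m powr 1 < m powr t" by (rule powr_less_mono') (use assms in auto)
  then show ?thesis using assms by simp
qed

text \<open>
  Given \<open>spb\<close>, the last two conditions say that \<open>q = p_star s p\<close> and \<open>sp_bar s p < CARD('n)\<close>.  The numbers
  \<open>b i\<close> are the exponents of the dilations \<open>u \<mapsto> t * u (t powr b i * x $ i)\<close>, which preserve both the \<open>L\<^sup>q\<close> norm
  and every directional seminorm.
\<close>

locale aniso_exponents =
  fixes s p b :: "'n::finite \<Rightarrow> real" and q :: real
  assumes s: "\<And>i. 0 < s i" "\<And>i. s i < 1" and p: "\<And>i. 1 < p i" and b: "\<And>i. 0 < b i"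
    and spb: "\<And>i. s i * p i * b i = q - p i" and sum_b: "(\<Sum>i\<in>UNIV. b i) = q"
    and sum_sp: "1 < (\<Sum>i\<in>UNIV. 1 / (s i * p i))"
begin

lemma p_pos: "0 < p i" using p[of i] by simp

lemma q_gt_p: "p i < q"
proof -
  have "0 < s i * p i * b i" using s p_pos b by simp
  then show ?thesis using spb[of i] by simp
qed

lemma q_pos: "0 < q" using q_gt_p p_pos less_trans by blast

text \<open>The normalization of the fractional derivative combined with the factor 1 / p i of the
  functional.\<close>

definition weight :: "'n \<Rightarrow> real" where "weight i = s i * (1 - s i) / p i"

lemma weight_pos: "0 < weight i"
  unfolding weight_def using s[of i] p_pos[of i] by simp

definition energy :: "(real^'n \<Rightarrow> real) \<Rightarrow> ennreal" where
  "energy u = (\<Sum>i\<in>UNIV. ennreal (weight i) * gagliardo i (s i) (p i) u)"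

lemma energy_eq_ennreal:
  assumes "\<And>i. gagliardo i (s i) (p i) u < \<infinity>"
  shows "energy u = ennreal (\<Sum>i\<in>UNIV. weight i * enn2real (gagliardo i (s i) (p i) u))"
proof -
  have "energy u = (\<Sum>i\<in>UNIV. ennreal (weight i * enn2real (gagliardo i (s i) (p i) u)))"
    unfolding energy_def using assms weight_pos by (intro sum.cong) (auto simp: ennreal_mult less_imp_le)
  also have "\<dots> = ennreal (\<Sum>i\<in>UNIV. weight i * enn2real (gagliardo i (s i) (p i) u))"
    using weight_pos by (intro sum_ennreal) (simp add: less_imp_le)
  finally show ?thesis .
qed

definition inf_energy :: ennreal where
  "inf_energy = (INF u\<in>{u. u \<in> borel_measurable borel \<and> mass q u = 1}. energy u)"

text \<open>The power of the mass by which the infimum scales. In the notation of the statement it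
  equals 1 - \<open>sp_bar s p\<close> / n.\<close>

definition decay :: real where "decay = 1 - 1 / (\<Sum>i\<in>UNIV. 1 / (s i * p i))"

lemma decay: "0 < decay" "decay < 1"
  unfolding decay_def using sum_sp by auto

lemma prod_powr: "0 < (t::real) \<Longrightarrow> (\<Prod>i\<in>(UNIV::'n set). t powr f i) = t powr (\<Sum>i\<in>UNIV. f i)"
  by (rule powr_sum[symmetric]) simp

text \<open>
  The rescaling \<open>x $ i \<mapsto> m powr (1 / (A * s i * p i)) * x $ i\<close> with \<open>A = (\<Sum>i. 1 / (s i * p i))\<close> multiplies all
  directional seminorms by one common factor, so the infimum at mass \<open>m\<close> is a strictly concave power of \<open>m\<close>
  although the \<open>p i\<close> differ.
\<close>

lemma inf_energy_le:
  assumes w[measurable]: "w \<in> borel_measurable borel" and m: "mass q w = ennreal m" "0 \<le> m"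
  shows "inf_energy * ennreal (m powr decay) \<le> energy w"
proof (cases "m = 0")
  case False
  then have m0: "0 < m" using m by simp
  define A where "A = (\<Sum>i\<in>(UNIV::'n set). 1 / (s i * p i))"
  have A: "1 < A" using sum_sp by (simp add: A_def)
  \<comment> \<open>Chosen so that the Jacobian, t to the power \<open>A\<close>, equals
    \<open>m\<close>: the rescaled function has mass 1, and each seminorm is multiplied by
    \<open>t / m\<close>.\<close>
  define t where "t = m powr (1 / A)"
  have t: "0 < t" using m0 by (simp add: t_def)
  define l where "l i = t powr (1 / (s i * p i))" for i
  have l: "0 < l i" for i using t by (simp add: l_def)
  have P: "(\<Prod>i\<in>(UNIV::'n set). l i) = m"
    unfolding l_def prod_powr[OF t] A_def[symmetric] using A m0 by (simp add: t_def powr_powr)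
  let ?w = "\<lambda>x. 1 * w (0 + (\<chi> i. l i * x $ i))"
  have "mass q ?w = ennreal (1 powr q / (\<Prod>i\<in>UNIV. l i)) * mass q w"
    by (rule mass_scale) (use l in auto)
  also have "\<dots> = 1" using m0 by (simp add: P m ennreal_mult[symmetric])
  finally have "inf_energy \<le> energy ?w"
    unfolding inf_energy_def by (intro INF_lower) (auto intro!: measurable_comp_vec_affine[of w 1 0, simplified])
  also have "energy ?w = ennreal (t / m) * energy w"
    unfolding energy_def sum_distrib_left
  proof (rule sum.cong)
    fix i :: 'n
    have "gagliardo i (s i) (p i) ?w = ennreal (1 powr p i * l i powr (s i * p i) / (\<Prod>i\<in>UNIV. l i)) * gagliardo i (s i) (p i) w"
      by (rule gagliardo_scale) (use l in auto)
    also have "l i powr (s i * p i) = t"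
      using s[of i] p_pos[of i] t by (simp add: l_def powr_powr)
    finally show "ennreal (weight i) * gagliardo i (s i) (p i) ?w = ennreal (t / m) * (ennreal (weight i) * gagliardo i (s i) (p i) w)"
      by (simp add: P mult_ac)
  qed simp
  finally have "inf_energy * ennreal (m powr decay) \<le> ennreal (t / m) * energy w * ennreal (m powr decay)"
    by (rule mult_right_mono) simp
  also have "\<dots> = ennreal (t / m * m powr decay) * energy w"
    using t m0 by (subst ennreal_mult) (simp_all only: mult_ac, simp_all)
  also have "t / m * m powr decay = t * m powr (decay - 1)"
    using m0 by (simp add: powr_diff)
  also have "\<dots> = m powr (1 / A + (decay - 1))"
    unfolding t_def powr_add ..
  also have "1 / A + (decay - 1) = 0" by (simp add: decay_def A_def)
  finally show ?thesis using m0 by simp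
qed simp

text \<open>Invariance of the mass is \<open>sum_b\<close>, that of the seminorms is
  \<open>spb\<close>. The parameter is the reciprocal of the usual one, which matches the boxes of
  \<open>mass_le_gagliardo\<close>.\<close>

lemma dilation:
  assumes u[measurable]: "u \<in> borel_measurable borel" and t: "0 < t"
  shows "mass q (\<lambda>x. (1 / t) * u (y + (\<chi> i. t powr - b i * x $ i))) = mass q u"
    and "gagliardo i (s i) (p i) (\<lambda>x. (1 / t) * u (y + (\<chi> i. t powr - b i * x $ i))) = gagliardo i (s i) (p i) u"
proof -
  have P: "(\<Prod>i\<in>(UNIV::'n set). t powr - b i) = t powr - q"
    using prod_powr[OF t, of "\<lambda>i. - b i"] sum_b by (simp add: sum_negf)
  have it: "(1 / t) powr r = t powr - r" for r
    using t by (simp add: powr_divide powr_minus_divide)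
  have "mass q (\<lambda>x. (1 / t) * u (y + (\<chi> i. t powr - b i * x $ i))) = ennreal ((1 / t) powr q / (\<Prod>i\<in>UNIV. t powr - b i)) * mass q u"
    by (rule mass_scale) (use t in auto)
  then show "mass q (\<lambda>x. (1 / t) * u (y + (\<chi> i. t powr - b i * x $ i))) = mass q u"
    unfolding P it using t by simp
  have "gagliardo i (s i) (p i) (\<lambda>x. (1 / t) * u (y + (\<chi> i. t powr - b i * x $ i))) =
     ennreal ((1 / t) powr p i * (t powr - b i) powr (s i * p i) / (\<Prod>i\<in>UNIV. t powr - b i)) * gagliardo i (s i) (p i) u"
    by (rule gagliardo_scale) (use t in auto)
  also have "(1 / t) powr p i * (t powr - b i) powr (s i * p i) = t powr (- p i + - b i * (s i * p i))"
    unfolding it powr_powr powr_add ..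
  also have "- p i + - b i * (s i * p i) = - q"
    using spb[of i] by (simp add: algebra_simps)
  finally show "gagliardo i (s i) (p i) (\<lambda>x. (1 / t) * u (y + (\<chi> i. t powr - b i * x $ i))) = gagliardo i (s i) (p i) u"
    unfolding P using t by simp
qed

section \<open>Nonvanishing on a box, and positivity of the energy\<close>

lemma mass_le_gagliardo_aniso:
  assumes "u \<in> borel_measurable borel" "\<And>x. 0 \<le> u x" "0 < \<delta>"
    "\<And>t x. 0 < t \<Longrightarrow> emeasure lborel {y \<in> cube. \<delta> * t \<le> u (x + (\<chi> i. t powr - b i * y $ i))} < 1"
  shows "mass q u \<le> (\<Sum>i\<in>UNIV. ennreal (q * 2 powr q * 2 ^ (CARD('n) - 1) * real CARD('n) powr p i /
     ((s i * p i + 1) * b i) * \<delta> powr (q - p i)) * gagliardo i (s i) (p i) u)"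
  by (rule mass_le_gagliardo) (use assms s p_pos b spb in auto)

text \<open>Were all these sets of measure below 1, the refined inequality would bound the mass by
  positive powers of \<open>\<delta>\<close> times \<open>A\<close>. A \<open>\<delta>\<close>
  depending only on \<open>A\<close> makes that bound less than 1.\<close>

lemma nonvanishing:
  assumes A: "0 \<le> A"
  shows "\<exists>\<delta>>0. \<forall>u. u \<in> borel_measurable borel \<longrightarrow> (\<forall>x. 0 \<le> u x) \<longrightarrow> mass q u = 1 \<longrightarrow>
    (\<forall>i. gagliardo i (s i) (p i) u \<le> ennreal A) \<longrightarrow>
    (\<exists>t x. 0 < t \<and> 1 \<le> emeasure lborel {y \<in> cube. \<delta> \<le> (1 / t) * u (x + (\<chi> i. t powr - b i * y $ i))})"
proof -
  define C where "C i = q * 2 powr q * 2 ^ (CARD('n) - 1) * real CARD('n) powr p i / ((s i * p i + 1) * b i)" for i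
  have C: "0 \<le> C i" for i
    unfolding C_def using q_pos s[of i] p_pos[of i] b[of i] by (auto intro!: divide_nonneg_pos mult_nonneg_nonneg simp: add_pos_pos)
  have "(\<lambda>j. \<Sum>i\<in>UNIV. C i * (1 / real (Suc j)) powr (q - p i) * A) \<longlonglongrightarrow> (\<Sum>i\<in>(UNIV::'n set). C i * 0 * A)"
  proof (intro tendsto_intros)
    fix i
    have "(\<lambda>j. 1 / real (Suc j)) \<longlonglongrightarrow> 0"
      by (rule LIMSEQ_Suc[OF lim_1_over_n])
    then have "(\<lambda>j. (1 / real (Suc j)) powr (q - p i)) \<longlonglongrightarrow> 0 powr (q - p i)"
      by (rule tendsto_powr2) (use q_gt_p[of i] in auto)
    then show "(\<lambda>j. (1 / real (Suc j)) powr (q - p i)) \<longlonglongrightarrow> 0" by simp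
  qed
  then have "eventually (\<lambda>j. (\<Sum>i\<in>UNIV. C i * (1 / real (Suc j)) powr (q - p i) * A) < 1) sequentially"
    by (intro order_tendstoD) auto
  then obtain j where j: "(\<Sum>i\<in>UNIV. C i * (1 / real (Suc j)) powr (q - p i) * A) < 1"
    by (auto simp: eventually_sequentially)
  define \<delta> where "\<delta> = 1 / real (Suc j)"
  have \<delta>: "0 < \<delta>" by (simp add: \<delta>_def)
  have "\<exists>t x. 0 < t \<and> 1 \<le> emeasure lborel {y \<in> cube. \<delta> \<le> (1 / t) * u (x + (\<chi> i. t powr - b i * y $ i))}"
    if u: "u \<in> borel_measurable borel" "\<forall>x. 0 \<le> u x" "mass q u = 1" "\<forall>i. gagliardo i (s i) (p i) u \<le> ennreal A" for u
  proof (rule ccontr)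
    assume no: "\<not> ?thesis"
    have "emeasure lborel {y \<in> cube. \<delta> * t \<le> u (x + (\<chi> i. t powr - b i * y $ i))} < 1" if "0 < t" for t x
    proof -
      have "{y \<in> cube. \<delta> * t \<le> u (x + (\<chi> i. t powr - b i * y $ i))} = {y \<in> cube. \<delta> \<le> (1 / t) * u (x + (\<chi> i. t powr - b i * y $ i))}"
        using that by (simp add: pos_le_divide_eq)
      then show ?thesis using no that by (simp add: not_le)
    qed
    then have "mass q u \<le> (\<Sum>i\<in>UNIV. ennreal (C i * \<delta> powr (q - p i)) * gagliardo i (s i) (p i) u)"
      unfolding C_def using u \<delta> by (intro mass_le_gagliardo_aniso) auto
    also have "\<dots> \<le> (\<Sum>i\<in>UNIV. ennreal (C i * \<delta> powr (q - p i)) * ennreal A)"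
      using u by (intro sum_mono mult_left_mono) auto
    also have "\<dots> = ennreal (\<Sum>i\<in>UNIV. C i * \<delta> powr (q - p i) * A)"
      using C A by (simp add: ennreal_mult[symmetric])
    also have "\<dots> < 1" using j unfolding \<delta>_def[symmetric] by (simp add: ennreal_less_one_iff)
    finally show False using u by simp
  qed
  then show ?thesis using \<delta> by blast
qed

text \<open>This is the source of S > 0: a nonzero limit cannot have zero energy.\<close>

lemma gagliardo_zero_imp_mass_zero:
  assumes w[measurable]: "w \<in> borel_measurable borel" and nn: "\<And>x. 0 \<le> w x" and m: "mass q w \<le> 1"
    and z: "\<And>i. gagliardo i (s i) (p i) w = 0"
  shows "mass q w = 0"
proof -
  \<comment> \<open>With threshold 2 the smallness hypothesis holds automatically: dilation keeps
    the mass at most 1, and Chebyshev gives measure at most 2 to the power -q.\<close>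
  have "emeasure lborel {y \<in> cube. 2 * t \<le> w (x + (\<chi> i. t powr - b i * y $ i))} < 1" if t: "0 < t" for t x
  proof -
    let ?T = "\<lambda>y. (1 / t) * w (x + (\<chi> i. t powr - b i * y $ i))"
    have "emeasure lborel {y \<in> cube. 2 * t \<le> w (x + (\<chi> i. t powr - b i * y $ i))} =
       (\<integral>\<^sup>+y. indicator {y \<in> cube. 2 * t \<le> w (x + (\<chi> i. t powr - b i * y $ i))} y \<partial>lborel)"
      by simp
    also have "\<dots> \<le> (\<integral>\<^sup>+y. ennreal (2 powr - q) * ennreal (\<bar>?T y\<bar> powr q) \<partial>lborel)"
    proof (rule nn_integral_mono)
      fix y
      have "1 \<le> 2 powr - q * \<bar>?T y\<bar> powr q" if "2 * t \<le> w (x + (\<chi> i. t powr - b i * y $ i))"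
      proof -
        have "2 \<le> \<bar>?T y\<bar>" using that t nn by (simp add: pos_le_divide_eq)
        then have "2 powr q \<le> \<bar>?T y\<bar> powr q" using q_pos by (intro powr_mono2) auto
        then show ?thesis by (simp add: powr_minus field_simps)
      qed
      then show "indicator {y \<in> cube. 2 * t \<le> w (x + (\<chi> i. t powr - b i * y $ i))} y \<le> ennreal (2 powr - q) * ennreal (\<bar>?T y\<bar> powr q)"
        by (auto simp: indicator_def ennreal_mult[symmetric] simp flip: ennreal_1)
    qed
    also have "\<dots> = ennreal (2 powr - q) * mass q ?T"
      unfolding mass_def by (rule nn_integral_cmult) measurable
    also have "mass q ?T = mass q w" by (rule dilation(1)[OF w t])
    also have "ennreal (2 powr - q) * mass q w \<le> ennreal (2 powr - q) * 1"
      by (intro mult_left_mono m) simp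
    also have "\<dots> < 1"
      using q_pos powr_less_mono[of "- q" 0 "2::real"] by (simp add: ennreal_less_one_iff)
    finally show ?thesis .
  qed
  then have "mass q w \<le> (\<Sum>i\<in>UNIV. ennreal (q * 2 powr q * 2 ^ (CARD('n) - 1) * real CARD('n) powr p i /
     ((s i * p i + 1) * b i) * 2 powr (q - p i)) * gagliardo i (s i) (p i) w)"
    using nn by (intro mass_le_gagliardo_aniso) auto
  then show ?thesis by (simp add: z)
qed

section \<open>The normalized minimizing sequence and its limit\<close>

lemma exists_minimizing_sequence:
  assumes fin: "inf_energy < \<infinity>"
  shows "\<exists>u \<delta>. 0 < \<delta> \<and> (\<forall>k. u k \<in> borel_measurable borel \<and> (\<forall>x. 0 \<le> u k x) \<and> mass q (u k) = 1 \<and>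
    energy (u k) \<le> inf_energy + ennreal (1 / real (Suc k)) \<and>
    1 \<le> emeasure lborel {y \<in> cube. \<delta> \<le> u k y})
    \<and> (\<exists>A\<ge>0. \<forall>i k. gagliardo i (s i) (p i) (u k) \<le> ennreal A)"
proof -
  obtain S where S: "inf_energy = ennreal S" "0 \<le> S" using fin by (cases inf_energy) auto
  have "\<exists>v. v \<in> borel_measurable borel \<and> mass q v = 1 \<and> energy v < inf_energy + ennreal (1 / real (Suc k))" for k
  proof -
    have "inf_energy < inf_energy + ennreal (1 / real (Suc k))"
      using S by (simp add: ennreal_plus[symmetric] ennreal_less_iff del: ennreal_plus)
    then have "\<exists>v\<in>{u. u \<in> borel_measurable borel \<and> mass q u = 1}. energy v < inf_energy + ennreal (1 / real (Suc k))"
      unfolding inf_energy_def INF_less_iff by blast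
    then show ?thesis by blast
  qed
  then obtain v where v: "\<And>k. v k \<in> borel_measurable borel" "\<And>k. mass q (v k) = 1"
    "\<And>k. energy (v k) < inf_energy + ennreal (1 / real (Suc k))" by metis
  \<comment> \<open>Taking absolute values keeps the mass and does not raise the energy, and
    \<open>nonvanishing\<close> asks for nonnegative functions.\<close>
  define f where "f k x = \<bar>v k x\<bar>" for k x
  have f: "f k \<in> borel_measurable borel" "mass q (f k) = 1" for k
    unfolding f_def using v by auto
  have fE: "energy (f k) \<le> inf_energy + ennreal (1 / real (Suc k))" for k
  proof -
    have "energy (f k) \<le> energy (v k)"
      unfolding energy_def f_def by (intro sum_mono mult_left_mono gagliardo_abs p_pos) auto
    then show ?thesis using v(3)[of k] by (meson order.strict_implies_order order_trans)
  qed
  \<comment> \<open>All energies are at most S + 1, so the i-th seminorm is at most the i-th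
    summand; the sum is a bound common to all directions.\<close>
  define A where "A = (\<Sum>i\<in>UNIV. (S + 1) / weight i)"
  have A: "0 \<le> A" unfolding A_def using S weight_pos by (intro sum_nonneg divide_nonneg_pos) auto
  have fA: "gagliardo i (s i) (p i) (f k) \<le> ennreal A" for i k
  proof -
    have "ennreal (weight i) * gagliardo i (s i) (p i) (f k) \<le> energy (f k)"
      unfolding energy_def by (rule sum_nonneg_leq_bound[where s = UNIV, OF _ _ refl]) auto
    also have "\<dots> \<le> ennreal S + ennreal 1"
      using fE[of k] unfolding S by (rule order_trans) (intro add_left_mono ennreal_leI, simp)
    also have "\<dots> = ennreal (S + 1)" using S by simp
    finally have "ennreal (1 / weight i) * (ennreal (weight i) * gagliardo i (s i) (p i) (f k)) \<le> ennreal (1 / weight i) * ennreal (S + 1)"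
      by (rule mult_left_mono) simp
    then have "gagliardo i (s i) (p i) (f k) \<le> ennreal ((S + 1) / weight i)"
      using weight_pos[of i] S by (simp add: mult.assoc[symmetric] ennreal_mult[symmetric] del: ennreal_plus)
    also have "\<dots> \<le> ennreal A"
      unfolding A_def using S weight_pos by (intro ennreal_leI member_le_sum divide_nonneg_pos) auto
    finally show ?thesis .
  qed
  obtain \<delta> where \<delta>: "0 < \<delta>" and N: "\<And>u. u \<in> borel_measurable borel \<Longrightarrow> (\<forall>x. 0 \<le> u x) \<Longrightarrow> mass q u = 1 \<Longrightarrow>
    (\<forall>i. gagliardo i (s i) (p i) u \<le> ennreal A) \<Longrightarrow>
    (\<exists>t x. 0 < t \<and> 1 \<le> emeasure lborel {y \<in> cube. \<delta> \<le> (1 / t) * u (x + (\<chi> i. t powr - b i * y $ i))})"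
    using nonvanishing[OF A] by blast
  define P where "P k t x \<longleftrightarrow> 0 < t \<and> 1 \<le> emeasure lborel {y \<in> cube. \<delta> \<le> (1 / t) * f k (x + (\<chi> i. t powr - b i * y $ i))}" for k t x
  have "\<exists>t x. P k t x" for k
    unfolding P_def by (rule N[of "f k", OF f(1) _ f(2)]) (simp_all add: fA, simp add: f_def)
  then obtain t x where "\<And>k. P k (t k) (x k)" by metis
  then have t: "0 < t k" and tx: "1 \<le> emeasure lborel {y \<in> cube. \<delta> \<le> (1 / t k) * f k (x k + (\<chi> i. t k powr - b i * y $ i))}" for k
    unfolding P_def by auto
  \<comment> \<open>The box on which \<open>f k\<close> is large becomes the fixed cube; mass and
    seminorms do not change.\<close>
  define u where "u k y = (1 / t k) * f k (x k + (\<chi> i. t k powr - b i * y $ i))" for k y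
  have "u k \<in> borel_measurable borel" for k
    unfolding u_def by (rule measurable_comp_vec_affine) (rule f)
  moreover have "0 \<le> u k y" for k y using t[of k] by (simp add: u_def f_def)
  moreover have "mass q (u k) = 1" for k
    unfolding u_def using dilation(1)[OF f(1) t] f(2) by simp
  moreover have g: "gagliardo i (s i) (p i) (u k) = gagliardo i (s i) (p i) (f k)" for i k
    unfolding u_def by (rule dilation(2)[OF f(1) t])
  moreover have "energy (u k) \<le> inf_energy + ennreal (1 / real (Suc k))" for k
    using fE[of k] by (simp add: energy_def g)
  moreover have "1 \<le> emeasure lborel {y \<in> cube. \<delta> \<le> u k y}" for k
    using tx[of k] by (simp add: u_def)
  ultimately show ?thesis using \<delta> A fA by (intro exI[of _ u] exI[of _ \<delta>]) auto
qed

theorem exists_minimizer: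
  assumes fin: "inf_energy < \<infinity>"
  shows "\<exists>w. w \<in> borel_measurable borel \<and> (\<forall>x. 0 \<le> w x) \<and> mass q w = 1 \<and> energy w = inf_energy"
proof -
  obtain S where S: "inf_energy = ennreal S" "0 \<le> S" using fin by (cases inf_energy) auto
  obtain u0 \<delta> where \<delta>: "0 < \<delta>" and U: "\<forall>k. u0 k \<in> borel_measurable borel \<and> (\<forall>x. 0 \<le> u0 k x) \<and> mass q (u0 k) = 1 \<and>
    energy (u0 k) \<le> inf_energy + ennreal (1 / real (Suc k)) \<and> 1 \<le> emeasure lborel {y \<in> cube. \<delta> \<le> u0 k y}"
    and "\<exists>A\<ge>0. \<forall>i k. gagliardo i (s i) (p i) (u0 k) \<le> ennreal A"
    using exists_minimizing_sequence[OF fin] by blast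
  then obtain A where A: "0 \<le> A" "\<And>i k. gagliardo i (s i) (p i) (u0 k) \<le> ennreal A" by blast
  have u0: "\<And>k. u0 k \<in> borel_measurable borel" "\<And>k x. 0 \<le> u0 k x" "\<And>k. mass q (u0 k) = 1"
    "\<And>k. energy (u0 k) \<le> inf_energy + ennreal (1 / real (Suc k))"
    "\<And>k. 1 \<le> emeasure lborel {y \<in> cube. \<delta> \<le> u0 k y}"
    using U by blast+
  have "\<exists>r w. strict_mono r \<and> w \<in> borel_measurable borel \<and> (\<forall>x. 0 \<le> w x) \<and> (AE x in lborel. (\<lambda>k. u0 (r k) x) \<longlonglongrightarrow> w x)"
    by (rule compactness_AE[where q = q and \<sigma> = s and p = p and A = A]) (use u0 q_pos s p_pos A in auto)
  then obtain r w where r: "strict_mono r" and w[measurable]: "w \<in> borel_measurable borel" and w0: "\<And>x. 0 \<le> w x"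
    and lim: "AE x in lborel. (\<lambda>k. u0 (r k) x) \<longlonglongrightarrow> w x" by auto
  define u where "u k = u0 (r k)" for k
  have um[measurable]: "u k \<in> borel_measurable borel" for k unfolding u_def by (rule u0)
  have lim: "AE x in lborel. (\<lambda>k. u k x) \<longlonglongrightarrow> w x" using lim by (simp add: u_def)
  define E where "E v = (\<Sum>i\<in>UNIV. weight i * enn2real (gagliardo i (s i) (p i) v))" for v
  have E: "energy v = ennreal (E v)" "0 \<le> E v" if "\<And>i. gagliardo i (s i) (p i) v < \<infinity>" for v
  proof -
    show "energy v = ennreal (E v)" unfolding E_def by (rule energy_eq_ennreal) fact
    show "0 \<le> E v" unfolding E_def using weight_pos by (intro sum_nonneg) (simp add: less_imp_le)
  qed
  have uA: "gagliardo i (s i) (p i) (u k) \<le> ennreal A" for i k unfolding u_def by (rule A)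
  have BLg: "gagliardo i (s i) (p i) w \<le> ennreal A" "gagliardo i (s i) (p i) (\<lambda>x. u k x - w x) < \<infinity>"
    "(\<lambda>k. enn2real (gagliardo i (s i) (p i) (u k)) - enn2real (gagliardo i (s i) (p i) (\<lambda>x. u k x - w x)))
       \<longlonglongrightarrow> enn2real (gagliardo i (s i) (p i) w)" for i k
    using Brezis_Lieb_gagliardo[OF um w p_pos A(1) uA lim] by blast+
  have um1: "mass q (u k) \<le> ennreal 1" for k by (simp add: u_def u0)
  note BLm = Brezis_Lieb[of u lborel w q 1, folded mass_def, OF _ _ q_pos zero_le_one um1 lim]
  have wm: "mass q w \<le> 1" using BLm(1) by simp
  have dm: "mass q (\<lambda>x. u k x - w x) < \<infinity>" for k
    using BLm(2) by simp
  define m where "m = enn2real (mass q w)"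
  have m: "mass q w = ennreal m" "0 \<le> m" "m \<le> 1"
    using wm le_less_trans[OF wm, of top] by (auto simp: m_def enn2real_leI)
  define d where "d k = enn2real (mass q (\<lambda>x. u k x - w x))" for k
  have d: "mass q (\<lambda>x. u k x - w x) = ennreal (d k)" "0 \<le> d k" for k
    using dm[of k] by (auto simp: d_def)
  have "(\<lambda>k. 1 - d k) \<longlonglongrightarrow> m"
    unfolding m_def d_def using BLm(3) by (simp add: u_def u0)
  then have "(\<lambda>k. 1 - (1 - d k)) \<longlonglongrightarrow> 1 - m" by (intro tendsto_intros)
  then have dlim: "d \<longlonglongrightarrow> 1 - m" by simp
  have m0: "m \<noteq> 0"
  proof
    assume "m = 0"
    then have "(\<integral>\<^sup>+x. ennreal (\<bar>w x\<bar> powr q) \<partial>lborel) = 0" using m(1) by (simp add: mass_def)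
    then have "AE x in lborel. ennreal (\<bar>w x\<bar> powr q) = 0"
      by (subst (asm) nn_integral_0_iff_AE) auto
    then have "AE x in lborel. (\<lambda>k. u k x) \<longlonglongrightarrow> 0"
      using lim by eventually_elim simp
    \<comment> \<open>Truncation at \<open>\<delta>\<close> and restriction to the cube supply an
      integrable majorant. Vanishing of the limit would send these integrals to 0, although each is
      at least \<open>\<delta>\<close>.\<close>
    then have "AE x in lborel. (\<lambda>k. min (u k x) \<delta> * indicator cube x) \<longlonglongrightarrow> 0"
    proof eventually_elim
      case (elim x)
      have "(\<lambda>k. min (u k x) \<delta> * indicator cube x) \<longlonglongrightarrow> min 0 \<delta> * indicator cube x"
        by (intro tendsto_intros elim)
      then show ?case using \<delta> by simp
    qed
    then have "(\<lambda>k. \<integral>\<^sup>+x. ennreal (norm (0 - min (u k x) \<delta> * indicator cube x)) \<partial>lborel) \<longlonglongrightarrow> 0"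
    proof (intro nn_integral_dominated_convergence_norm)
      show "AE x in lborel. norm (min (u k x) \<delta> * indicator cube x) \<le> \<delta> * indicator cube x" for k
        using \<delta> u0(2) by (auto simp: u_def indicator_def)
      have "(\<integral>\<^sup>+(x::real^'n). ennreal (\<delta> * indicator cube x) \<partial>lborel) = (\<integral>\<^sup>+(x::real^'n). ennreal \<delta> * indicator cube x \<partial>lborel)"
        by (rule nn_integral_cong) (simp add: indicator_def)
      also have "\<dots> = ennreal \<delta> * 2 ^ CARD('n)"
        by (simp add: nn_integral_cmult emeasure_cube)
      also have "\<dots> < \<infinity>" by (simp add: ennreal_mult_less_top power_less_top_ennreal)
      finally show "(\<integral>\<^sup>+(x::real^'n). ennreal (\<delta> * indicator cube x) \<partial>lborel) < \<infinity>" .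
    qed auto
    moreover have "ennreal \<delta> \<le> (\<integral>\<^sup>+x. ennreal (norm (0 - min (u k x) \<delta> * indicator cube x)) \<partial>lborel)" for k
    proof -
      have "ennreal \<delta> * 1 \<le> ennreal \<delta> * emeasure lborel {y \<in> cube. \<delta> \<le> u k y}"
        using u0(5)[of "r k"] by (intro mult_left_mono) (auto simp: u_def)
      also have "\<dots> = (\<integral>\<^sup>+x. ennreal \<delta> * indicator {y \<in> cube. \<delta> \<le> u k y} x \<partial>lborel)"
        by (rule nn_integral_cmult_indicator[symmetric]) measurable
      also have "\<dots> \<le> (\<integral>\<^sup>+x. ennreal (norm (0 - min (u k x) \<delta> * indicator cube x)) \<partial>lborel)"
        by (rule nn_integral_mono) (use \<delta> in \<open>auto simp: indicator_def\<close>)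
      finally show ?thesis by simp
    qed
    ultimately have "ennreal \<delta> \<le> 0" by (intro LIMSEQ_le_const) blast+
    then show False using \<delta> by simp
  qed
  have Ew: "energy w = ennreal (E w)" "0 \<le> E w"
    using E[of w] le_less_trans[OF BLg(1)] by auto
  have Eu: "energy (u k) = ennreal (E (u k))" "0 \<le> E (u k)" for k
    using E[of "u k"] le_less_trans[OF uA] by auto
  have Ed: "energy (\<lambda>x. u k x - w x) = ennreal (E (\<lambda>x. u k x - w x))" "0 \<le> E (\<lambda>x. u k x - w x)" for k
    using E[of "\<lambda>x. u k x - w x"] BLg(2) by auto
  have Eulim: "(\<lambda>k. E (u k)) \<longlonglongrightarrow> S"
  proof (rule real_tendsto_sandwich)
    show "eventually (\<lambda>k. S \<le> E (u k)) sequentially"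
    proof (intro always_eventually allI)
      fix k
      have "inf_energy \<le> energy (u k)"
        unfolding inf_energy_def by (rule INF_lower) (use um u0 in \<open>auto simp: u_def\<close>)
      then show "S \<le> E (u k)" using S Eu[of k] by simp
    qed
    show "eventually (\<lambda>k. E (u k) \<le> S + 1 / real (Suc k)) sequentially"
    proof (intro always_eventually allI)
      fix k
      have "energy (u k) \<le> ennreal S + ennreal (1 / real (Suc (r k)))"
        unfolding u_def S(1)[symmetric] by (rule u0)
      also have "\<dots> = ennreal (S + 1 / real (Suc (r k)))" using S by simp
      finally have "E (u k) \<le> S + 1 / real (Suc (r k))" using S Eu[of k] by (simp del: ennreal_plus)
      also have "\<dots> \<le> S + 1 / real (Suc k)"
        using seq_suble[OF r, of k] by (intro add_left_mono divide_left_mono) auto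
      finally show "E (u k) \<le> S + 1 / real (Suc k)" .
    qed
    have "(\<lambda>k. S + 1 / real (Suc k)) \<longlonglongrightarrow> S + 0"
      by (intro tendsto_intros LIMSEQ_Suc[OF lim_1_over_n])
    then show "(\<lambda>k. S + 1 / real (Suc k)) \<longlonglongrightarrow> S" by simp
  qed simp
  have "(\<lambda>k. \<Sum>i\<in>UNIV. weight i * (enn2real (gagliardo i (s i) (p i) (u k)) - enn2real (gagliardo i (s i) (p i) (\<lambda>x. u k x - w x))))
     \<longlonglongrightarrow> (\<Sum>i\<in>UNIV. weight i * enn2real (gagliardo i (s i) (p i) w))"
    by (intro tendsto_intros BLg)
  then have "(\<lambda>k. E (u k) - E (\<lambda>x. u k x - w x)) \<longlonglongrightarrow> E w"
    by (simp add: E_def right_diff_distrib sum_subtractf)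
  then have "(\<lambda>k. E (u k) - (E (u k) - E (\<lambda>x. u k x - w x))) \<longlonglongrightarrow> S - E w"
    by (intro tendsto_intros Eulim)
  then have Edlim: "(\<lambda>k. E (\<lambda>x. u k x - w x)) \<longlonglongrightarrow> S - E w" by simp
  \<comment> \<open>The remainders have energy tending to S - E w and mass tending to 1 - m; each
    obeys the scaled lower bound.\<close>
  have low: "S * (1 - m) powr decay \<le> S - E w"
  proof (rule LIMSEQ_le[OF _ Edlim])
    show "(\<lambda>k. S * d k powr decay) \<longlonglongrightarrow> S * (1 - m) powr decay"
      \<comment> \<open>The limit 1 - m may be 0, so continuity of the power there uses positivity
        of \<open>decay\<close>.\<close>
      by (intro tendsto_mult tendsto_const tendsto_powr2 dlim) (use d decay in auto)
    have "S * d k powr decay \<le> E (\<lambda>x. u k x - w x)" for k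
    proof -
      have "inf_energy * ennreal (d k powr decay) \<le> energy (\<lambda>x. u k x - w x)"
        by (rule inf_energy_le) (use d in auto)
      then show ?thesis unfolding S Ed using S Ed(2)[of k] by (simp add: ennreal_mult[symmetric])
    qed
    then show "\<exists>N. \<forall>k\<ge>N. S * d k powr decay \<le> E (\<lambda>x. u k x - w x)" by blast
  qed
  have up: "S * m powr decay \<le> E w"
  proof -
    have "inf_energy * ennreal (m powr decay) \<le> energy w"
      by (rule inf_energy_le) (use m in auto)
    then show ?thesis unfolding S Ew using S Ew(2) by (simp add: ennreal_mult[symmetric])
  qed
  have "0 \<le> S * (1 - m) powr decay" using S by simp
  then have EwS: "E w \<le> S" using low by linarith
  \<comment> \<open>Needed to cancel S in the comparison below: S = 0 would force E w = 0, hence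
    zero mass, against \<open>m0\<close>.\<close>
  have "S \<noteq> 0"
  proof
    assume "S = 0"
    then have "E w = 0" using EwS Ew by simp
    then have "\<And>i. weight i * enn2real (gagliardo i (s i) (p i) w) = 0"
      unfolding E_def using weight_pos by (subst (asm) sum_nonneg_eq_0_iff) (auto simp: less_imp_le)
    then have "\<And>i. gagliardo i (s i) (p i) w = 0"
      using weight_pos le_less_trans[OF BLg(1)] by (auto simp: enn2real_eq_0_iff less_le)
    then have "mass q w = 0" using w0 wm by (intro gagliardo_zero_imp_mass_zero) auto
    then show False using m m0 by simp
  qed
  then have S0: "0 < S" using S by simp
  \<comment> \<open>Adding the lower bounds for the remainder and for \<open>w\<close> eliminates E
    w and leaves an inequality for m alone.\<close>
  have "S * (m powr decay + (1 - m) powr decay) \<le> S * 1"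
    using low up by (simp add: distrib_left)
  then have sum: "m powr decay + (1 - m) powr decay \<le> 1" using S0 by simp
  have "m = 1"
  proof (rule ccontr)
    assume "m \<noteq> 1"
    then have "m < m powr decay" "1 - m < (1 - m) powr decay"
      using m m0 decay by (auto intro!: powr_gt_self)
    then show False using sum by linarith
  qed
  then have "mass q w = 1" using m by simp
  moreover have "energy w = inf_energy"
  proof -
    have "S \<le> E w" using up \<open>m = 1\<close> by simp
    then show ?thesis using EwS S Ew by simp
  qed
  ultimately show ?thesis using w w0 by blast
qed

end

section \<open>Finiteness of the infimum\<close>

lemma ennreal_mult_less_top_pos: "0 < c \<Longrightarrow> ennreal c * x < \<infinity> \<longleftrightarrow> x < \<infinity>"
  by (auto simp: ennreal_mult_less_top)

lemma nn_integral_even_le: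
  fixes f :: "real \<Rightarrow> ennreal"
  assumes [measurable]: "f \<in> borel_measurable borel"
  shows "(\<integral>\<^sup>+h. f \<bar>h\<bar> \<partial>lborel) \<le> 2 * (\<integral>\<^sup>+h. f h * indicator {0..} h \<partial>lborel)"
proof -
  have "(\<integral>\<^sup>+h. f \<bar>h\<bar> \<partial>lborel) \<le> (\<integral>\<^sup>+h. f h * indicator {0..} h + f (0 + (-1) * h) * indicator {0..} (0 + (-1) * h) \<partial>lborel)"
    by (rule nn_integral_mono) (auto simp: indicator_def abs_if)
  also have "\<dots> = (\<integral>\<^sup>+h. f h * indicator {0..} h \<partial>lborel) + (\<integral>\<^sup>+h. f (0 + (-1) * h) * indicator {0..} (0 + (-1) * h) \<partial>lborel)"
    by (rule nn_integral_add) measurable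
  also have "(\<integral>\<^sup>+h. f (0 + (-1) * h) * indicator {0..} (0 + (-1) * h) \<partial>lborel) = (\<integral>\<^sup>+h. f h * indicator {0..} h \<partial>lborel)"
    by (subst (2) nn_integral_real_affine[where c = "-1" and t = 0]) auto
  finally show ?thesis by (simp add: mult_2)
qed

text \<open>Near 0 the bound by |h| leaves the exponent (1 - \<sigma>) * p - 1, integrable because
  \<sigma> < 1; far out the constant \<open>c\<close> leaves -(1 + \<sigma> * p), integrable because
  \<sigma> > 0.\<close>

lemma gagliardo_kernel_finite:
  fixes \<sigma> p c :: real
  assumes "0 < \<sigma>" "\<sigma> < 1" "0 < p" "0 \<le> c"
  shows "(\<integral>\<^sup>+h. ennreal (min \<bar>h\<bar> c powr p * \<bar>h\<bar> powr - (1 + \<sigma> * p)) \<partial>lborel) < \<infinity>"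
proof -
  have "(\<integral>\<^sup>+h. ennreal (min \<bar>h\<bar> c powr p * \<bar>h\<bar> powr - (1 + \<sigma> * p)) \<partial>lborel) \<le>
    2 * (\<integral>\<^sup>+h. ennreal (min h c powr p * h powr - (1 + \<sigma> * p)) * indicator {0..} h \<partial>lborel)"
    by (rule nn_integral_even_le) measurable
  also have "\<dots> \<le> 2 * (\<integral>\<^sup>+h. ennreal (h powr ((1 - \<sigma>) * p - 1)) * indicator {0..1} h +
      ennreal (c powr p) * (ennreal (h powr - (1 + \<sigma> * p)) * indicator {1..} h) \<partial>lborel)"
  proof (intro mult_left_mono nn_integral_mono)
    fix h :: real
    have "min h c powr p * h powr - (1 + \<sigma> * p) \<le> h powr ((1 - \<sigma>) * p - 1)" if "0 \<le> h"
    proof -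
      have "min h c powr p * h powr - (1 + \<sigma> * p) \<le> h powr p * h powr - (1 + \<sigma> * p)"
        using that assms by (intro mult_right_mono powr_mono2) auto
      also have "\<dots> = h powr ((1 - \<sigma>) * p - 1)"
        unfolding powr_add[symmetric] by (simp add: algebra_simps)
      finally show ?thesis .
    qed
    moreover have "min h c powr p * h powr - (1 + \<sigma> * p) \<le> c powr p * h powr - (1 + \<sigma> * p)" if "0 \<le> h"
      using that assms by (intro mult_right_mono powr_mono2) auto
    ultimately show "ennreal (min h c powr p * h powr - (1 + \<sigma> * p)) * indicator {0..} h \<le>
      ennreal (h powr ((1 - \<sigma>) * p - 1)) * indicator {0..1} h +
      ennreal (c powr p) * (ennreal (h powr - (1 + \<sigma> * p)) * indicator {1..} h)"
      by (auto simp: indicator_def ennreal_mult[symmetric] intro!: ennreal_leI add_increasing2)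
  qed simp
  also have "\<dots> = 2 * ((\<integral>\<^sup>+h. ennreal (h powr ((1 - \<sigma>) * p - 1)) * indicator {0..1} h \<partial>lborel) +
      ennreal (c powr p) * (\<integral>\<^sup>+h. ennreal (h powr - (1 + \<sigma> * p)) * indicator {1..} h \<partial>lborel))"
    by (simp add: nn_integral_add nn_integral_cmult)
  also have "(\<integral>\<^sup>+h. ennreal (h powr - (1 + \<sigma> * p)) * indicator {1..} h \<partial>lborel) = ennreal (- (1 powr (- (1 + \<sigma> * p) + 1)) / (- (1 + \<sigma> * p) + 1))"
    by (intro nn_integral_has_integral_lebesgue' has_integral_powr_to_inf) (use assms in auto)
  also have "(\<integral>\<^sup>+h. ennreal (h powr ((1 - \<sigma>) * p - 1)) * indicator {0..1} h \<partial>lborel) = ennreal (1 powr ((1 - \<sigma>) * p) / ((1 - \<sigma>) * p))"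
    by (rule nn_integral_powr_Icc) (use assms in auto)
  also have "2 * (ennreal (1 powr ((1 - \<sigma>) * p) / ((1 - \<sigma>) * p)) + ennreal (c powr p) * ennreal (- (1 powr (- (1 + \<sigma> * p) + 1)) / (- (1 + \<sigma> * p) + 1))) < \<infinity>"
    by (simp add: ennreal_mult_less_top)
  finally show ?thesis .
qed

text \<open>A 1-Lipschitz function of compact support. The height n + 1 makes it at least 1 on
  \<open>cube\<close>, where the norm is at most n.\<close>

definition tent :: "real^'n::finite \<Rightarrow> real" where
  "tent x = max 0 (real CARD('n) + 1 - norm x)"

lemma measurable_tent[measurable]: "tent \<in> borel_measurable borel"
  unfolding tent_def by measurable

lemma gagliardo_tent_finite:
  fixes i :: "'n::finite"
  assumes "0 < \<sigma>" "\<sigma> < 1" "0 < p"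
  shows "gagliardo i \<sigma> p (tent :: real^'n \<Rightarrow> real) < \<infinity>"
proof -
  let ?c = "real CARD('n) + 1"
  define B :: "(real^'n) set" where "B = cball 0 ?c"
  have [measurable]: "B \<in> sets borel" and Bfin: "emeasure lborel B < \<infinity>"
    unfolding B_def using emeasure_lborel_cball_finite by auto
  have tent_bounds: "0 \<le> tent x" "tent x \<le> ?c" for x :: "real^'n" by (auto simp: tent_def)
  \<comment> \<open>The increment is at most |h| by the Lipschitz bound and at most
    \<open>?c\<close> by the height, and it vanishes unless one endpoint lies in \<open>B\<close>.
    So the integral over x costs at most twice the volume of \<open>B\<close>, uniformly in
    h.\<close>
  have pt: "ennreal (\<bar>tent x - tent (x + h *\<^sub>R axis i 1)\<bar> powr p) \<le>
     ennreal (min \<bar>h\<bar> ?c powr p) * (indicator B x + indicator B (x + h *\<^sub>R axis i 1))" for x :: "real^'n" and h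
  proof (cases "x \<in> B \<or> x + h *\<^sub>R axis i 1 \<in> B")
    case True
    have "\<bar>norm x - norm (x + h *\<^sub>R axis i 1)\<bar> \<le> norm (x - (x + h *\<^sub>R axis i 1))"
      by (rule norm_triangle_ineq3)
    also have "\<dots> = \<bar>h\<bar>" by (simp add: norm_axis_1)
    finally have "\<bar>tent x - tent (x + h *\<^sub>R axis i 1)\<bar> \<le> \<bar>h\<bar>"
      by (auto simp: tent_def)
    moreover have "\<bar>tent x - tent (x + h *\<^sub>R axis i 1)\<bar> \<le> ?c"
      using tent_bounds[of x] tent_bounds[of "x + h *\<^sub>R axis i 1"] by linarith
    ultimately have "\<bar>tent x - tent (x + h *\<^sub>R axis i 1)\<bar> powr p \<le> min \<bar>h\<bar> ?c powr p"
      using assms by (intro powr_mono2) auto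
    then have "ennreal (\<bar>tent x - tent (x + h *\<^sub>R axis i 1)\<bar> powr p) \<le> ennreal (min \<bar>h\<bar> ?c powr p) * 1"
      by (simp add: ennreal_leI)
    also have "\<dots> \<le> ennreal (min \<bar>h\<bar> ?c powr p) * (indicator B x + indicator B (x + h *\<^sub>R axis i 1))"
      by (rule mult_left_mono) (use True in \<open>auto simp: indicator_def\<close>)
    finally show ?thesis .
  next
    case False
    then have "tent x = 0" "tent (x + h *\<^sub>R axis i 1) = 0" by (auto simp: tent_def B_def)
    then show ?thesis by simp
  qed
  have dp: "diff_pow i p tent h \<le> ennreal (min \<bar>h\<bar> ?c powr p) * (2 * emeasure lborel B)" for h
  proof -
    have "diff_pow i p tent h \<le> (\<integral>\<^sup>+x. ennreal (min \<bar>h\<bar> ?c powr p) * (indicator B x + indicator B (x + h *\<^sub>R axis i 1)) \<partial>lborel)"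
      unfolding diff_pow_def by (rule nn_integral_mono) (rule pt)
    also have "\<dots> = ennreal (min \<bar>h\<bar> ?c powr p) * ((\<integral>\<^sup>+x. indicator B x \<partial>lborel) + (\<integral>\<^sup>+x. indicator B (x + h *\<^sub>R axis i 1) \<partial>lborel))"
      by (subst nn_integral_cmult) (auto simp: nn_integral_add)
    also have "(\<integral>\<^sup>+x. indicator B (x + h *\<^sub>R axis i 1) \<partial>lborel) = (\<integral>\<^sup>+x. indicator B x \<partial>lborel)"
      by (rule nn_integral_lborel_translate) measurable
    finally show ?thesis by (simp add: mult_2)
  qed
  have "gagliardo i \<sigma> p (tent :: real^'n \<Rightarrow> real) \<le>
    (\<integral>\<^sup>+h. (2 * emeasure lborel B) * ennreal (min \<bar>h\<bar> ?c powr p * \<bar>h\<bar> powr - (1 + \<sigma> * p)) \<partial>lborel)"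
    unfolding gagliardo_def
  proof (rule nn_integral_mono)
    fix h
    have "diff_pow i p tent h * ennreal (\<bar>h\<bar> powr - (1 + \<sigma> * p)) \<le>
       ennreal (min \<bar>h\<bar> ?c powr p) * (2 * emeasure lborel B) * ennreal (\<bar>h\<bar> powr - (1 + \<sigma> * p))"
      by (rule mult_right_mono[OF dp]) simp
    also have "\<dots> = (2 * emeasure lborel B) * ennreal (min \<bar>h\<bar> ?c powr p * \<bar>h\<bar> powr - (1 + \<sigma> * p))"
      by (simp only: ennreal_mult powr_ge_zero mult_ac)
    finally show "diff_pow i p tent h * ennreal (\<bar>h\<bar> powr - (1 + \<sigma> * p)) \<le>
      (2 * emeasure lborel B) * ennreal (min \<bar>h\<bar> ?c powr p * \<bar>h\<bar> powr - (1 + \<sigma> * p))" .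
  qed
  also have "\<dots> = (2 * emeasure lborel B) * (\<integral>\<^sup>+h. ennreal (min \<bar>h\<bar> ?c powr p * \<bar>h\<bar> powr - (1 + \<sigma> * p)) \<partial>lborel)"
    by (rule nn_integral_cmult) measurable
  also have "\<dots> < \<infinity>"
    using gagliardo_kernel_finite[of \<sigma> p ?c] assms Bfin by (simp add: ennreal_mult_less_top)
  finally show ?thesis .
qed

lemma mass_tent:
  assumes q: "0 < q"
  shows "0 < mass q (tent :: real^'n::finite \<Rightarrow> real)" "mass q (tent :: real^'n::finite \<Rightarrow> real) < \<infinity>"
proof -
  let ?c = "real CARD('n) + 1"
  let ?B = "cball 0 ?c :: (real^'n) set"
  have "(0::ennreal) < 2 ^ CARD('n)" by (simp add: zero_less_iff_neq_zero)
  also have "\<dots> = (\<integral>\<^sup>+x. indicator (cube :: (real^'n) set) x \<partial>lborel)" by (simp add: emeasure_cube)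
  also have "\<dots> \<le> mass q (tent :: real^'n \<Rightarrow> real)"
    unfolding mass_def
  proof (rule nn_integral_mono)
    fix x :: "real^'n"
    have "1 \<le> \<bar>tent x\<bar> powr q" if "x \<in> cube"
    proof -
      have "norm x \<le> (\<Sum>i\<in>UNIV. \<bar>x $ i\<bar>)" by (rule norm_le_l1_cart)
      also have "\<dots> \<le> (\<Sum>i\<in>(UNIV::'n set). 1)" using that by (intro sum_mono) (simp add: cube_def)
      finally have "1 \<le> \<bar>tent x\<bar>" by (simp add: tent_def)
      then show ?thesis using q by (simp add: ge_one_powr_ge_zero)
    qed
    then show "indicator cube x \<le> ennreal (\<bar>tent x\<bar> powr q)"
      by (auto simp: indicator_def simp flip: ennreal_1)
  qed
  finally show "0 < mass q (tent :: real^'n::finite \<Rightarrow> real)" .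
  have "mass q (tent :: real^'n \<Rightarrow> real) \<le> (\<integral>\<^sup>+x. ennreal (?c powr q) * indicator ?B x \<partial>lborel)"
    unfolding mass_def
  proof (rule nn_integral_mono)
    fix x :: "real^'n"
    have "\<bar>tent x\<bar> powr q \<le> ?c powr q" using q by (intro powr_mono2) (auto simp: tent_def)
    moreover have "tent x = 0" if "x \<notin> ?B" using that by (auto simp: tent_def)
    ultimately show "ennreal (\<bar>tent x\<bar> powr q) \<le> ennreal (?c powr q) * indicator ?B x"
      by (auto simp: indicator_def ennreal_leI)
  qed
  also have "\<dots> < \<infinity>"
    using emeasure_bounded_finite[of ?B] by (subst nn_integral_cmult_indicator) (auto simp: ennreal_mult_less_top)
  finally show "mass q (tent :: real^'n::finite \<Rightarrow> real) < \<infinity>" .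
qed

text \<open>The scaled lower bound accepts any mass, so the test function can be used without
  normalization.\<close>

lemma (in aniso_exponents) inf_energy_finite: "inf_energy < \<infinity>"
proof -
  obtain m where m: "mass q (tent :: real^'n \<Rightarrow> real) = ennreal m" "0 \<le> m"
    using mass_tent(2)[OF q_pos, where 'n = 'n] by (cases "mass q (tent :: real^'n \<Rightarrow> real)") auto
  then have m0: "0 < m" using mass_tent(1)[OF q_pos, where 'n = 'n] by simp
  have "inf_energy * ennreal (m powr decay) \<le> energy tent"
    by (rule inf_energy_le) (use m in auto)
  also have "\<dots> < \<infinity>"
    unfolding energy_def using gagliardo_tent_finite[where 'n = 'n, OF s p_pos, simplified] by (simp add: ennreal_mult_less_top_pos[OF weight_pos, simplified])
  finally show ?thesis using m0 by (auto simp: ennreal_mult_less_top)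
qed

section \<open>The anisotropic Sobolev constant\<close>

text \<open>With A and B as in the proof, \<open>sp_bar s p\<close> is n / A and
  \<open>s_bar s\<close> is n / B, so q = B / (A - 1). The hypothesis on \<open>sp_bar\<close>
  becomes A > 1, and the sum of the \<open>b i\<close> is q * A - B, which equals q.\<close>

lemma aniso_exponents_p_star:
  fixes s p :: "'n::finite \<Rightarrow> real"
  assumes s: "\<And>i. 0 < s i" "\<And>i. s i < 1" and p: "\<And>i. 1 < p i"
    and sp: "sp_bar s p < real CARD('n)" and pmax: "p_max p < p_star s p"
  shows "aniso_exponents s p (\<lambda>i. (p_star s p - p i) / (s i * p i)) (p_star s p)"
proof -
  define A where "A = (\<Sum>i\<in>(UNIV::'n set). 1 / (s i * p i))"
  define B where "B = (\<Sum>i\<in>(UNIV::'n set). 1 / s i)"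
  let ?n = "real CARD('n)"
  have p0: "0 < p i" for i using p[of i] by simp
  have A0: "0 < A" unfolding A_def using s p0 by (intro sum_pos) auto
  have spA: "sp_bar s p = ?n / A" and sB: "s_bar s = ?n / B"
    by (simp_all add: sp_bar_def s_bar_def A_def B_def)
  have A1: "1 < A" using sp A0 unfolding spA by (simp add: field_simps)
  have q: "p_star s p = B / (A - 1)"
    unfolding p_star_def spA sB using A0 A1 by (simp add: field_simps)
  have "p i \<le> p_max p" for i unfolding p_max_def by (rule Max_ge) auto
  then have pq: "p i < p_star s p" for i using pmax le_less_trans by blast
  show ?thesis
  proof
    show "0 < (p_star s p - p i) / (s i * p i)" for i using pq[of i] s[of i] p0[of i] by simp
    show "s i * p i * ((p_star s p - p i) / (s i * p i)) = p_star s p - p i" for i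
      using s[of i] p0[of i] by simp
    show "1 < (\<Sum>i\<in>UNIV. 1 / (s i * p i))" using A1 by (simp add: A_def)
    have "(p_star s p - p i) / (s i * p i) = p_star s p * (1 / (s i * p i)) - 1 / s i" for i
      using s(1)[of i] p0[of i] by (simp add: field_simps)
    then have "(\<Sum>i\<in>UNIV. (p_star s p - p i) / (s i * p i)) = p_star s p * A - B"
      by (simp add: A_def B_def sum_subtractf sum_distrib_left)
    also have "\<dots> = p_star s p" unfolding q using A1 by (simp add: field_simps)
    finally show "(\<Sum>i\<in>UNIV. (p_star s p - p i) / (s i * p i)) = p_star s p" .
  qed (use s p in auto)
qed

section \<open>Lebesgue measurable functions and their Borel representatives\<close>

lemma Lq_space_iff_mass:
  fixes u v :: "real^'n::finite \<Rightarrow> real"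
  assumes [measurable]: "u \<in> borel_measurable lebesgue" and ae: "AE x in lborel. u x = v x"
  shows "u \<in> Lq_space q \<longleftrightarrow> mass q v < \<infinity>" and "Lq_norm q u = enn2real (mass q v) powr (1 / q)"
proof -
  have I: "(\<integral>\<^sup>+x. ennreal (\<bar>u x\<bar> powr q) \<partial>lebesgue) = mass q v"
    using mass_cong_AE[OF ae, of q] by (simp add: mass_def nn_integral_completion)
  show "u \<in> Lq_space q \<longleftrightarrow> mass q v < \<infinity>"
    unfolding Lq_space_def integrable_iff_bounded using I by simp
  show "Lq_norm q u = enn2real (mass q v) powr (1 / q)"
    unfolding Lq_norm_def using I by (subst integral_eq_nn_integral) auto
qed

context aniso_exponents
begin

lemma aniso_space_iff:
  assumes v: "v \<in> borel_measurable borel" and ae: "AE x in lborel. u x = v x"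
  shows "(\<Sum>i\<in>UNIV. \<integral>\<^sup>+x. frac_D_pow i (s i) (p i) u x \<partial>lebesgue) < \<infinity> \<longleftrightarrow> (\<forall>i. gagliardo i (s i) (p i) v < \<infinity>)"
proof -
  have "0 < s i * (1 - s i)" for i using s[of i] by simp
  then show ?thesis
    by (simp add: nn_integral_frac_D_pow[OF v ae] ennreal_mult_less_top_pos[simplified])
qed

text \<open>Finite seminorms make \<open>enn2real\<close> faithful, and the outer power p i undoes
  the root in \<open>frac_D_norm\<close>.\<close>

lemma aniso_energy_eq:
  assumes v: "v \<in> borel_measurable borel" and ae: "AE x in lborel. u x = v x"
    and fin: "\<And>i. gagliardo i (s i) (p i) v < \<infinity>"
  shows "ennreal (aniso_energy s p u) = energy v" "0 \<le> aniso_energy s p u"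
proof -
  have c: "0 \<le> s i * (1 - s i)" for i using s[of i] by simp
  have "1 / p i * frac_D_norm i (s i) (p i) u powr p i = weight i * enn2real (gagliardo i (s i) (p i) v)" for i
    using p_pos[of i] c[of i]
    by (simp add: frac_D_norm_def nn_integral_frac_D_pow[OF v ae] powr_powr enn2real_mult weight_def)
  then have E: "aniso_energy s p u = (\<Sum>i\<in>UNIV. weight i * enn2real (gagliardo i (s i) (p i) v))"
    by (simp add: aniso_energy_def)
  show "ennreal (aniso_energy s p u) = energy v" unfolding E using energy_eq_ennreal[of v] fin by simp
  show "0 \<le> aniso_energy s p u" unfolding E using weight_pos by (intro sum_nonneg) (simp add: less_imp_le)
qed

end

theorem theorem1p2:
  fixes s p :: "'n::finite \<Rightarrow> real"
  assumes "\<And>i. 0 < s i" and "\<And>i. s i < 1"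
    and "\<And>i. 1 < p i"
    and "sp_bar s p < real CARD('n)"
    and "p_max p < p_star s p"
  shows "\<exists>u \<in> aniso_space s p.
           (AE x in lebesgue. 0 \<le> u x) \<and>
           Lq_norm (p_star s p) u = 1 \<and>
           aniso_energy s p u = sobolev_const s p"
proof -
  let ?q = "p_star s p"
  interpret aniso_exponents s p "\<lambda>i. (?q - p i) / (s i * p i)" ?q
    by (rule aniso_exponents_p_star) fact+
  obtain w :: "real^'n \<Rightarrow> real" where w: "w \<in> borel_measurable borel" "\<And>x. 0 \<le> w x" "mass ?q w = 1" "energy w = inf_energy"
    using exists_minimizer[OF inf_energy_finite] by blast
  have wl: "w \<in> borel_measurable lebesgue" using w(1) by (intro measurable_completion) simp
  have "energy w < \<infinity>" using inf_energy_finite w(4) by simp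
  then have "ennreal (weight i) * gagliardo i (s i) (p i) w < \<infinity>" for i
    unfolding energy_def by simp
  then have wfin: "gagliardo i (s i) (p i) w < \<infinity>" for i
    using ennreal_mult_less_top_pos[OF weight_pos] by blast
  have mem: "w \<in> aniso_space s p"
    unfolding aniso_space_def using Lq_space_iff_mass(1)[OF wl, of w ?q] aniso_space_iff[OF w(1), of w] wfin w(3) by simp
  have norm: "Lq_norm ?q w = 1"
    using Lq_space_iff_mass(2)[OF wl, of w ?q] w(3) by simp
  have Ew: "ennreal (aniso_energy s p w) = inf_energy"
    using aniso_energy_eq(1)[OF w(1) _ wfin, of w] w(4) by simp
  \<comment> \<open>An attained lower bound identifies the real infimum directly, settling
    nonemptiness and boundedness from below together.\<close>
  have "sobolev_const s p = aniso_energy s p w"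
    unfolding sobolev_const_def
  proof (rule cInf_eq_minimum)
    show "aniso_energy s p w \<in> aniso_energy s p ` {u \<in> aniso_space s p. Lq_norm ?q u = 1}"
      using mem norm by blast
  next
    fix e assume "e \<in> aniso_energy s p ` {u \<in> aniso_space s p. Lq_norm ?q u = 1}"
    then obtain u where u: "u \<in> aniso_space s p" "Lq_norm ?q u = 1" "e = aniso_energy s p u" by blast
    then have ul: "u \<in> borel_measurable lebesgue" by (simp add: aniso_space_def Lq_space_def)
    \<comment> \<open>A competitor is only Lebesgue measurable; its Borel representative is
      admissible for \<open>inf_energy\<close>.\<close>
    obtain v where v: "v \<in> borel_measurable borel" and ae: "AE x in lborel. u x = v x"
      using completion_ex_borel_measurable_real[OF ul] by auto
    have mf: "mass ?q v < \<infinity>"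
      using u(1) Lq_space_iff_mass(1)[OF ul ae, of ?q] by (simp add: aniso_space_def)
    have "enn2real (mass ?q v) powr (1 / ?q) = 1"
      using u(2) Lq_space_iff_mass(2)[OF ul ae, of ?q] by simp
    \<comment> \<open>Raising to the power q removes the root in \<open>Lq_norm\<close>, so that
      norm 1 becomes mass 1.\<close>
    then have "(enn2real (mass ?q v) powr (1 / ?q)) powr ?q = 1" by simp
    then have "enn2real (mass ?q v) = 1" using q_pos by (simp add: powr_powr)
    then have m1: "mass ?q v = 1"
      using mf by (metis ennreal_1 ennreal_enn2real infinity_ennreal_def)
    have vfin: "gagliardo i (s i) (p i) v < \<infinity>" for i
      using u(1) aniso_space_iff[OF v ae] by (simp add: aniso_space_def)
    have "inf_energy \<le> energy v"
      unfolding inf_energy_def by (rule INF_lower) (use v m1 in auto)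
    then have "ennreal (aniso_energy s p w) \<le> ennreal (aniso_energy s p u)"
      using aniso_energy_eq(1)[OF v ae vfin] Ew by simp
    then show "aniso_energy s p w \<le> e"
      using aniso_energy_eq(2)[OF v ae vfin] u(3) by simp
  qed
  then show ?thesis using mem norm w(2) by (intro bexI[of _ w]) auto
qed

end
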